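(* Let $G$ be an exponential Lie group and let $(\pi,\mathcal{H}_\pi)$ be an irreducible unitary representation of $G$ admitting an admissible vector. Let $X=G/G_{[\eta]}$ (which is the same for all $\eta\in\mathcal{H}_\pi\setminus\{0\}$), let $p\colon G\to X$ be the projection, and let $\mu_X$ be a nonzero $G$-invariant Radon measure on $X$. Suppose that $\Gamma$ is a discrete subgroup of $G$ such that $\Gamma':=p(\Gamma)$ is a uniform subgroup of $X$. Let $s\colon X\to G$ be a Borel section of $p$. If there exists $\eta\in\mathcal{H}_\pi$ such that $\{\pi(s(\gamma'))\eta:\gamma'\in\Gamma'\}$ is complete in $\mathcal{H}_\pi$, then $$\mathrm{vol}(X/\Gamma)\,d_\pi\le1,$$ where $d_\pi>0$ is the unique constant, independent of $\eta\in\mathcal{H}_\pi$, such that $$\int_{X}|(f,\pi(s(x))\eta)|^2\,d\mu_X(x)=d_\pi^{-1}\|f\|^2\|\eta\|^2\quad\text{for all } f\in\mathcal{H}_\pi.$$ The conclusion is independent of the choice of the Borel section $s$ and of the choice of the $G$-invariant Radon measure $\mu_X$ on $X$.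
   Context: An exponential Lie group is a (real, finite-dimensional) Lie group whose exponential map is a diffeomorphism. With $\mathbb{T}=\{z\in\mathbb{C}:|z|=1\}$, for $\eta\in\mathcal{H}_\pi\setminus\{0\}$ the projective stabiliser is $G_{[\eta]}=\{x\in G:\pi(x)\eta\in\mathbb{T}\cdot\eta\}$. For exponential $G$ it equals $\mathrm{pker}(\pi)=\{x\in G:\pi(x)\in\mathbb{T}\cdot I_{\mathcal{H}_\pi}\}$, a closed connected normal subgroup, for every $\eta\neq0$, so $X$ is itself an exponential Lie group and a $G$-invariant Radon measure $\mu_X$ on it is a Haar measure. A nonzero vector $\eta$ is admissible if $\int_X|(f,\pi(s(x))\eta)|^2\,d\mu_X(x)<\infty$ for all $f\in\mathcal{H}_\pi$, where $s\colon X\to G$ is a measurable cross-section of $p$ (the integrand does not depend on $s$). A uniform subgroup of $X$ is a discrete cocompact subgroup. $\mathrm{vol}(X/\Gamma)=\mathrm{vol}(X/\Gamma')$ is the volume of the quotient induced by $\mu_X$, i.e. the $\mu_X$-measure of a fundamental domain for $\Gamma'$ in $X$. A family of vectors is complete in $\mathcal{H}_\pi$ if its linear span is dense. *)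

theory Defs
  imports "HOL-Analysis.Analysis" "HOL-Algebra.Left_Coset"
begin

section \<open>Complex Hilbert spaces\<close>

class complex_hilbert = banach +
  fixes scaleC :: "complex \<Rightarrow> 'a \<Rightarrow> 'a" (infixr \<open>*\<^sub>C\<close> 75)
    and cinner :: "'a \<Rightarrow> 'a \<Rightarrow> complex"
  assumes scaleC_add_right: "a *\<^sub>C (x + y) = a *\<^sub>C x + a *\<^sub>C y"
    and scaleC_add_left: "(a + b) *\<^sub>C x = a *\<^sub>C x + b *\<^sub>C x"
    and scaleC_scaleC: "a *\<^sub>C (b *\<^sub>C x) = (a * b) *\<^sub>C x"
    and scaleC_one: "1 *\<^sub>C x = x"
    and scaleR_scaleC: "r *\<^sub>R x = complex_of_real r *\<^sub>C x"
    and cinner_add_left: "cinner (x + y) z = cinner x z + cinner y z"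
    and cinner_scaleC_left: "cinner (a *\<^sub>C x) y = a * cinner x y"
    and cinner_commute: "cinner x y = cnj (cinner y x)"
    and cinner_self: "cinner x x = complex_of_real ((norm x)\<^sup>2)"

global_interpretation complex_vector:
  vector_space "scaleC :: complex \<Rightarrow> 'a \<Rightarrow> 'a::complex_hilbert"
  by unfold_locales
    (simp_all add: scaleC_add_right scaleC_add_left scaleC_scaleC scaleC_one)


section \<open>Topological preliminaries\<close>

text \<open>The finest topology on the image of \<open>topspace T\<close> for which \<open>q\<close> is continuous.\<close>

definition quotient_topology :: "'a topology \<Rightarrow> ('a \<Rightarrow> 'b) \<Rightarrow> 'b topology" where
  "quotient_topology T q =
     topology (\<lambda>U. U \<subseteq> q ` topspace T \<and> openin T {x \<in> topspace T. q x \<in> U})"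

lemma openin_quotient_topology:
  "openin (quotient_topology T q) U \<longleftrightarrow>
     U \<subseteq> q ` topspace T \<and> openin T {x \<in> topspace T. q x \<in> U}"
proof -
  let ?P = "\<lambda>U. U \<subseteq> q ` topspace T \<and> openin T {x \<in> topspace T. q x \<in> U}"
  have "istopology ?P"
    unfolding istopology_def
  proof (intro conjI allI impI)
    fix S U assume S: "?P S" and U: "?P U"
    show "S \<inter> U \<subseteq> q ` topspace T" using S by blast
    have "{x \<in> topspace T. q x \<in> S \<inter> U} =
        {x \<in> topspace T. q x \<in> S} \<inter> {x \<in> topspace T. q x \<in> U}" by blast
    then show "openin T {x \<in> topspace T. q x \<in> S \<inter> U}" using S U by auto
  next
    fix K assume K: "\<forall>S\<in>K. ?P S"
    then show "\<Union>K \<subseteq> q ` topspace T" by blast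
    have "{x \<in> topspace T. q x \<in> \<Union>K} = (\<Union>S\<in>K. {x \<in> topspace T. q x \<in> S})" by blast
    then show "openin T {x \<in> topspace T. q x \<in> \<Union>K}" using K by auto
  qed
  then show ?thesis
    by (simp add: quotient_topology_def topology_inverse')
qed

lemma quotient_map_quotient_topology: "quotient_map T (quotient_topology T q) q"
proof -
  have eq: "{x \<in> topspace T. q x \<in> q ` topspace T} = topspace T" by blast
  have "topspace (quotient_topology T q) = q ` topspace T"
  proof (rule subset_antisym)
    show "topspace (quotient_topology T q) \<subseteq> q ` topspace T"
      using openin_topspace[of "quotient_topology T q"] by (simp only: openin_quotient_topology)
    show "q ` topspace T \<subseteq> topspace (quotient_topology T q)"
      by (rule openin_subset) (simp add: openin_quotient_topology eq)
  qed
  then show ?thesis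
    by (auto simp: quotient_map_def openin_quotient_topology)
qed

definition borel_of :: "'a topology \<Rightarrow> 'a measure" where
  "borel_of T = sigma (topspace T) {U. openin T U}"

definition radon_measure :: "'a topology \<Rightarrow> 'a measure \<Rightarrow> bool" where
  "radon_measure T M \<longleftrightarrow>
     sets M = sets (borel_of T) \<and>
     (\<forall>K. compactin T K \<longrightarrow> emeasure M K < \<infinity>) \<and>
     (\<forall>B\<in>sets M. emeasure M B = (INF U\<in>{U. openin T U \<and> B \<subseteq> U}. emeasure M U)) \<and>
     (\<forall>U. openin T U \<longrightarrow>
        emeasure M U = (SUP K\<in>{K. compactin T K \<and> K \<subseteq> U}. emeasure M K))"


section \<open>Smooth manifolds\<close>

fun higher_differentiable_on ::
  "'v::real_normed_vector set \<Rightarrow> ('v \<Rightarrow> 'w::real_normed_vector) \<Rightarrow> nat \<Rightarrow> bool" where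
  "higher_differentiable_on S f 0 \<longleftrightarrow> continuous_on S f"
| "higher_differentiable_on S f (Suc k) \<longleftrightarrow>
     (\<forall>x\<in>S. f differentiable (at x)) \<and>
     (\<forall>v. higher_differentiable_on S (\<lambda>x. frechet_derivative f (at x) v) k)"

text \<open>Only used for open \<open>S\<close> in a finite-dimensional space; derivatives are taken in the
  ambient space.\<close>

definition smooth_on ::
  "'v::real_normed_vector set \<Rightarrow> ('v \<Rightarrow> 'w::real_normed_vector) \<Rightarrow> bool" where
  "smooth_on S f \<longleftrightarrow> (\<forall>k. higher_differentiable_on S f k)"

text \<open>A chart is a pair of its domain and its coordinate map.\<close>

type_synonym ('m, 'v) atlas = "('m set \<times> ('m \<Rightarrow> 'v)) set"

text \<open>The model space is a finite-dimensional normed space rather than a type of class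
  \<open>euclidean_space\<close>, because the latter excludes dimension \<open>0\<close>.\<close>

definition smooth_manifold :: "'m topology \<Rightarrow> ('m, 'v::real_normed_vector) atlas \<Rightarrow> bool" where
  "smooth_manifold T A \<longleftrightarrow>
     (\<exists>B::'v set. finite B \<and> span B = UNIV) \<and>
     Hausdorff_space T \<and> second_countable T \<and>
     (\<forall>(U, \<phi>)\<in>A. openin T U \<and> open (\<phi> ` U) \<and>
        homeomorphic_map (subtopology T U) (top_of_set (\<phi> ` U)) \<phi>) \<and>
     (\<Union>(U, \<phi>)\<in>A. U) = topspace T \<and>
     (\<forall>(U, \<phi>)\<in>A. \<forall>(V, \<psi>)\<in>A. smooth_on (\<phi> ` (U \<inter> V)) (\<psi> \<circ> inv_into U \<phi>))"

definition prod_atlas ::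
  "('m, 'v) atlas \<Rightarrow> ('n, 'w) atlas \<Rightarrow> ('m \<times> 'n, 'v \<times> 'w) atlas" where
  "prod_atlas A B = {(U \<times> V, map_prod \<phi> \<psi>) | U \<phi> V \<psi>. (U, \<phi>) \<in> A \<and> (V, \<psi>) \<in> B}"

definition vector_atlas :: "('v, 'v) atlas" where
  "vector_atlas = {(UNIV, id)}"

definition smooth_map ::
  "'m topology \<Rightarrow> ('m, 'v::real_normed_vector) atlas \<Rightarrow>
   'n topology \<Rightarrow> ('n, 'w::real_normed_vector) atlas \<Rightarrow> ('m \<Rightarrow> 'n) \<Rightarrow> bool" where
  "smooth_map T A T' A' f \<longleftrightarrow>
     continuous_map T T' f \<and>
     (\<forall>(U, \<phi>)\<in>A. \<forall>(V, \<psi>)\<in>A'. smooth_on (\<phi> ` (U \<inter> f -` V)) (\<psi> \<circ> f \<circ> inv_into U \<phi>))"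

definition diffeomorphism ::
  "'m topology \<Rightarrow> ('m, 'v::real_normed_vector) atlas \<Rightarrow>
   'n topology \<Rightarrow> ('n, 'w::real_normed_vector) atlas \<Rightarrow> ('m \<Rightarrow> 'n) \<Rightarrow> bool" where
  "diffeomorphism T A T' A' f \<longleftrightarrow>
     bij_betw f (topspace T) (topspace T') \<and>
     smooth_map T A T' A' f \<and> smooth_map T' A' T A (inv_into (topspace T) f)"


section \<open>Topological groups and exponential Lie groups\<close>

definition topological_group :: "'g monoid \<Rightarrow> 'g topology \<Rightarrow> bool" where
  "topological_group G T \<longleftrightarrow>
     group G \<and> topspace T = carrier G \<and>
     continuous_map (prod_topology T T) T (\<lambda>(x, y). x \<otimes>\<^bsub>G\<^esub> y) \<and>
     continuous_map T T (\<lambda>x. inv\<^bsub>G\<^esub> x)"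

definition discrete_subgroup :: "'g monoid \<Rightarrow> 'g topology \<Rightarrow> 'g set \<Rightarrow> bool" where
  "discrete_subgroup G T D \<longleftrightarrow>
     topological_group G T \<and> subgroup D G \<and> subtopology T D = discrete_topology D"

definition uniform_subgroup :: "'g monoid \<Rightarrow> 'g topology \<Rightarrow> 'g set \<Rightarrow> bool" where
  "uniform_subgroup G T D \<longleftrightarrow>
     discrete_subgroup G T D \<and> compact_space (quotient_topology T (\<lambda>x. x <#\<^bsub>G\<^esub> D))"

definition lie_group ::
  "'g monoid \<Rightarrow> 'g topology \<Rightarrow> ('g, 'v::real_normed_vector) atlas \<Rightarrow> bool" where
  "lie_group G T A \<longleftrightarrow>
     group G \<and> topspace T = carrier G \<and> smooth_manifold T A \<and>
     smooth_map (prod_topology T T) (prod_atlas A A) T A (\<lambda>(x, y). x \<otimes>\<^bsub>G\<^esub> y) \<and>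
     smooth_map T A T A (\<lambda>x. inv\<^bsub>G\<^esub> x)"

definition one_parameter_subgroup ::
  "'g monoid \<Rightarrow> 'g topology \<Rightarrow> ('g, 'v::real_normed_vector) atlas \<Rightarrow> (real \<Rightarrow> 'g) \<Rightarrow> bool" where
  "one_parameter_subgroup G T A \<gamma> \<longleftrightarrow>
     smooth_map euclidean vector_atlas T A \<gamma> \<and>
     (\<forall>s t. \<gamma> (s + t) = \<gamma> s \<otimes>\<^bsub>G\<^esub> \<gamma> t)"

text \<open>A chart \<open>\<phi>\<close> around the identity identifies the Lie algebra, as the tangent space at the
  identity, with the model space; \<open>exp v\<close> is the value at time 1 of the one-parameter subgroup
  with initial velocity \<open>v\<close>.\<close>

definition lie_exp ::
  "'g monoid \<Rightarrow> 'g topology \<Rightarrow> ('g, 'v::real_normed_vector) atlas \<Rightarrow> ('g \<Rightarrow> 'v) \<Rightarrow> 'v \<Rightarrow> 'g" where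
  "lie_exp G T A \<phi> v =
     (THE \<gamma>. one_parameter_subgroup G T A \<gamma> \<and>
        ((\<lambda>t. \<phi> (\<gamma> t)) has_vector_derivative v) (at 0)) 1"

text \<open>Changing the chart composes the exponential map with a linear isomorphism, so it does not
  matter which chart around the identity is used.\<close>

definition exponential_lie_group ::
  "'g monoid \<Rightarrow> 'g topology \<Rightarrow> ('g, 'v::real_normed_vector) atlas \<Rightarrow> bool" where
  "exponential_lie_group G T A \<longleftrightarrow>
     lie_group G T A \<and>
     (\<exists>(U, \<phi>)\<in>A. \<one>\<^bsub>G\<^esub> \<in> U \<and> diffeomorphism euclidean vector_atlas T A (lie_exp G T A \<phi>))"


section \<open>Unitary representations\<close>

definition unitary_operator :: "('h::complex_hilbert \<Rightarrow> 'h) \<Rightarrow> bool" where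
  "unitary_operator u \<longleftrightarrow>
     Vector_Spaces.linear scaleC scaleC u \<and> surj u \<and>
     (\<forall>v w. cinner (u v) (u w) = cinner v w)"

definition unitary_representation ::
  "'g monoid \<Rightarrow> 'g topology \<Rightarrow> ('g \<Rightarrow> 'h::complex_hilbert \<Rightarrow> 'h) \<Rightarrow> bool" where
  "unitary_representation G T \<pi> \<longleftrightarrow>
     (\<forall>x\<in>carrier G. unitary_operator (\<pi> x)) \<and>
     (\<forall>x\<in>carrier G. \<forall>y\<in>carrier G. \<pi> (x \<otimes>\<^bsub>G\<^esub> y) = \<pi> x \<circ> \<pi> y) \<and>
     (\<forall>v. continuous_map T euclidean (\<lambda>x. \<pi> x v))"

definition irreducible_representation ::
  "'g monoid \<Rightarrow> ('g \<Rightarrow> 'h::complex_hilbert \<Rightarrow> 'h) \<Rightarrow> bool" where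
  "irreducible_representation G \<pi> \<longleftrightarrow>
     (\<exists>v::'h. v \<noteq> 0) \<and>
     (\<forall>S. complex_vector.subspace S \<and> closed S \<and> (\<forall>x\<in>carrier G. \<pi> x ` S \<subseteq> S)
        \<longrightarrow> S = {0} \<or> S = UNIV)"

definition projective_stabiliser ::
  "'g monoid \<Rightarrow> ('g \<Rightarrow> 'h::complex_hilbert \<Rightarrow> 'h) \<Rightarrow> 'h \<Rightarrow> 'g set" where
  "projective_stabiliser G \<pi> \<eta> = {x \<in> carrier G. \<exists>z. cmod z = 1 \<and> \<pi> x \<eta> = z *\<^sub>C \<eta>}"

definition complete_family :: "'h::complex_hilbert set \<Rightarrow> bool" where
  "complete_family S \<longleftrightarrow> closure (complex_vector.span S) = UNIV"


section \<open>The homogeneous space\<close>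

definition borel_section ::
  "'g topology \<Rightarrow> 'x topology \<Rightarrow> ('g \<Rightarrow> 'x) \<Rightarrow> ('x \<Rightarrow> 'g) \<Rightarrow> bool" where
  "borel_section T TX p s \<longleftrightarrow>
     s \<in> borel_of TX \<rightarrow>\<^sub>M borel_of T \<and> (\<forall>x\<in>topspace TX. p (s x) = x)"

text \<open>Points of the homogeneous space are left cosets; \<open>g\<close> maps \<open>C\<close> to the coset \<open>gC\<close>.\<close>

definition invariant_radon_measure ::
  "'g monoid \<Rightarrow> 'g set topology \<Rightarrow> 'g set measure \<Rightarrow> bool" where
  "invariant_radon_measure G TX \<mu> \<longleftrightarrow>
     radon_measure TX \<mu> \<and> emeasure \<mu> (space \<mu>) \<noteq> 0 \<and>
     (\<forall>g\<in>carrier G. \<forall>B\<in>sets \<mu>. emeasure \<mu> ((\<lambda>C. g <#\<^bsub>G\<^esub> C) ` B) = emeasure \<mu> B)"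

definition coefficient_integral ::
  "'x measure \<Rightarrow> ('g \<Rightarrow> 'h::complex_hilbert \<Rightarrow> 'h) \<Rightarrow> ('x \<Rightarrow> 'g) \<Rightarrow> 'h \<Rightarrow> 'h \<Rightarrow> ennreal" where
  "coefficient_integral \<mu> \<pi> s f \<eta> =
     (\<integral>\<^sup>+ x. ennreal ((cmod (cinner f (\<pi> (s x) \<eta>)))\<^sup>2) \<partial>\<mu>)"

definition admissible_vector ::
  "'x measure \<Rightarrow> ('g \<Rightarrow> 'h::complex_hilbert \<Rightarrow> 'h) \<Rightarrow> ('x \<Rightarrow> 'g) \<Rightarrow> 'h \<Rightarrow> bool" where
  "admissible_vector \<mu> \<pi> s \<eta> \<longleftrightarrow> \<eta> \<noteq> 0 \<and> (\<forall>f. coefficient_integral \<mu> \<pi> s f \<eta> < \<infinity>)"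

definition is_formal_degree ::
  "'x measure \<Rightarrow> ('g \<Rightarrow> 'h::complex_hilbert \<Rightarrow> 'h) \<Rightarrow> ('x \<Rightarrow> 'g) \<Rightarrow> real \<Rightarrow> bool" where
  "is_formal_degree \<mu> \<pi> s d \<longleftrightarrow>
     0 < d \<and>
     (\<forall>f \<eta>. coefficient_integral \<mu> \<pi> s f \<eta> = ennreal (inverse d * (norm f)\<^sup>2 * (norm \<eta>)\<^sup>2))"

definition formal_degree ::
  "'x measure \<Rightarrow> ('g \<Rightarrow> 'h::complex_hilbert \<Rightarrow> 'h) \<Rightarrow> ('x \<Rightarrow> 'g) \<Rightarrow> real" where
  "formal_degree \<mu> \<pi> s = (THE d. is_formal_degree \<mu> \<pi> s d)"

text \<open>The quotient of \<open>X\<close> by \<open>D\<close> consists of the left cosets \<open>xD\<close>, so a fundamental domain is a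
  Borel set whose right translates by the elements of \<open>D\<close> tile \<open>X\<close>.\<close>

definition fundamental_domain ::
  "'x monoid \<Rightarrow> 'x topology \<Rightarrow> 'x set \<Rightarrow> 'x set \<Rightarrow> bool" where
  "fundamental_domain X TX D F \<longleftrightarrow>
     F \<in> sets (borel_of TX) \<and>
     (\<forall>x\<in>carrier X. \<exists>!\<gamma>. \<gamma> \<in> D \<and> (\<exists>y\<in>F. x = y \<otimes>\<^bsub>X\<^esub> \<gamma>))"

definition covolume ::
  "'x monoid \<Rightarrow> 'x topology \<Rightarrow> 'x measure \<Rightarrow> 'x set \<Rightarrow> ennreal" where
  "covolume X TX \<mu> D = (THE v. \<exists>F. fundamental_domain X TX D F \<and> v = emeasure \<mu> F)"

end

theory Submission
  imports Defs
begin

text \<open>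
  Write \<open>X = G / H\<close> with \<open>H\<close> the projective stabiliser.  That \<open>X\<close> is a group forces \<open>H\<close> to be normal.
  The orbit of \<open>\<eta>\<^sub>0\<close> then consists of joint eigenvectors of \<open>H\<close>, whose eigencharacter is locally
  constant along the connected group \<open>G\<close>; by irreducibility \<open>H\<close> acts by scalars (\<open>H_scalar\<close>).  Hence
  \<open>\<rho> = \<pi> \<circ> s\<close> is an irreducible projective representation of \<open>X\<close>, and another section changes it only by
  phases.

  A group with a uniform lattice \<open>\<Gamma>'\<close> is unimodular, because all translates of a fundamental domain
  have the same right-invariant measure (\<open>nn_integral_inv\<close>).  Therefore invariant measures are
  proportional, the covolume does not depend on the fundamental domain, and \<open>\<integral> |\<langle>f, \<rho> x \<eta>\<rangle>|\<^sup>2 d\<mu>\<close> is symmetric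
  in \<open>f\<close> and \<open>\<eta>\<close>.  For admissible \<open>\<eta>\<close> it is an invariant quadratic form in \<open>f\<close>, so by Schur's lemma a
  multiple of \<open>\<parallel>f\<parallel>\<^sup>2\<close>; by the symmetry it equals \<open>\<kappa> \<parallel>f\<parallel>\<^sup>2 \<parallel>\<eta>\<parallel>\<^sup>2\<close>, first for admissible \<open>\<eta>\<close> and then, since
  these form a closed invariant subspace, for all \<open>\<eta>\<close> (\<open>orthogonality_relation\<close>).  The formal degree is
  \<open>1 / \<kappa>\<close>.

  It remains to bound the covolume by \<open>\<kappa>\<close> (\<open>fundamental_domain_measure_le\<close>).  If the orbit of \<open>\<eta>\<close>
  under the lattice were a Parseval frame, then \<open>\<parallel>\<eta>\<parallel> \<le> 1\<close>, and integrating the identity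
  \<open>\<Sum>\<^sub>\<gamma> |\<langle>f, \<rho> (x \<gamma>) \<eta>\<rangle>|\<^sup>2 = \<parallel>f\<parallel>\<^sup>2\<close> over a fundamental domain would give
  \<open>\<kappa> \<parallel>f\<parallel>\<^sup>2 \<parallel>\<eta>\<parallel>\<^sup>2 = vol (X / \<Gamma>') \<parallel>f\<parallel>\<^sup>2\<close>.  In general the frame operator \<open>S\<close> of the orbit is an unbounded
  injective operator, given by a closed quadratic form.  In place of the Parseval frame generated by
  \<open>S\<^sup>-\<^sup>1\<^sup>/\<^sup>2 \<eta>\<close>, the proof pairs the orbit of \<open>\<eta>\<close> with that of \<open>h = (S + \<epsilon>)\<^sup>-\<^sup>1 \<eta>\<close>.  This needs only the
  resolvent of the form, which minimises a quadratic functional.  It commutes with the lattice,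
  \<open>\<langle>\<eta>, h\<rangle> \<le> 1\<close> replaces \<open>\<parallel>\<eta>\<parallel> \<le> 1\<close>, and the mixed frame operator \<open>S (S + \<epsilon>)\<^sup>-\<^sup>1\<close> tends weakly to the
  identity as \<open>\<epsilon> \<rightarrow> 0\<close>, because \<open>S\<close> is injective by completeness.
\<close>

section \<open>Complex Hilbert spaces\<close>

lemma cinner_add_right: "cinner x (y + z) = cinner x y + cinner x z"
  by (metis cinner_add_left cinner_commute complex_cnj_add)

lemma cinner_scaleC_right: "cinner x (a *\<^sub>C y) = cnj a * cinner x y"
  by (metis cinner_scaleC_left cinner_commute complex_cnj_mult)

lemma cinner_zero_left [simp]: "cinner 0 (x::'h::complex_hilbert) = 0"
  by (metis add_cancel_right_left cinner_add_left)

lemma cinner_zero_right [simp]: "cinner (x::'h::complex_hilbert) 0 = 0"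
  by (metis add_cancel_right_left cinner_add_right)

lemma cinner_minus_left: "cinner (- x) y = - cinner x y"
  by (metis add.right_inverse add_eq_0_iff cinner_add_left cinner_zero_left)

lemma cinner_minus_right: "cinner x (- y) = - cinner x y"
  by (metis add.right_inverse add_eq_0_iff cinner_add_right cinner_zero_right)

lemma cinner_diff_left: "cinner (x - y) z = cinner x z - cinner y z"
  using cinner_add_left[of x "- y" z] by (simp add: cinner_minus_left)

lemma cinner_diff_right: "cinner x (y - z) = cinner x y - cinner x z"
  using cinner_add_right[of x y "- z"] by (simp add: cinner_minus_right)

lemma cinner_scaleR_left: "cinner (r *\<^sub>R x) y = complex_of_real r * cinner x y"
  by (simp add: scaleR_scaleC cinner_scaleC_left)

lemma cinner_scaleR_right: "cinner x (r *\<^sub>R y) = complex_of_real r * cinner x y"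
  by (simp add: scaleR_scaleC cinner_scaleC_right)

lemmas cinner_algebra = cinner_add_left cinner_add_right cinner_diff_left cinner_diff_right
  cinner_minus_left cinner_minus_right cinner_scaleC_left cinner_scaleC_right
  cinner_scaleR_left cinner_scaleR_right

lemma cinner_eq_zero_iff: "cinner x x = 0 \<longleftrightarrow> x = (0::'h::complex_hilbert)"
  by (simp add: cinner_self)

lemma Re_cinner_self: "Re (cinner x x) = (norm x)\<^sup>2"
  by (simp add: cinner_self)

lemma Re_cinner_commute: "Re (cinner x y) = Re (cinner y x)"
  by (metis cinner_commute cnj.simps(1))

lemma cmod_cinner_commute: "cmod (cinner x y) = cmod (cinner y x)"
  by (metis cinner_commute complex_mod_cnj)

lemma norm_add_sq: "(norm (x + y))\<^sup>2 = (norm x)\<^sup>2 + 2 * Re (cinner x y) + (norm (y::'h::complex_hilbert))\<^sup>2"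
  using Re_cinner_commute[of y x]
  by (simp add: Re_cinner_self[symmetric] cinner_algebra)

lemma norm_diff_sq: "(norm (x - y))\<^sup>2 = (norm x)\<^sup>2 - 2 * Re (cinner x y) + (norm (y::'h::complex_hilbert))\<^sup>2"
  using Re_cinner_commute[of y x]
  by (simp add: Re_cinner_self[symmetric] cinner_algebra)

lemma norm_scaleC: "norm (a *\<^sub>C x) = cmod a * norm (x::'h::complex_hilbert)"
proof -
  have "(norm (a *\<^sub>C x))\<^sup>2 = Re (a * (cnj a * cinner x x))"
    by (simp only: Re_cinner_self[symmetric] cinner_scaleC_left cinner_scaleC_right mult.left_commute)
  also have "\<dots> = Re (complex_of_real ((cmod a)\<^sup>2) * complex_of_real ((norm x)\<^sup>2))"
    by (simp only: cinner_self complex_norm_square mult.assoc)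
  also have "\<dots> = (cmod a * norm x)\<^sup>2"
    by (metis Re_complex_of_real of_real_mult power_mult_distrib)
  finally show ?thesis
    by (rule power2_eq_imp_eq) simp_all
qed

lemma cauchy_schwarz: "cmod (cinner x y) \<le> norm x * norm (y::'h::complex_hilbert)"
proof (cases "y = 0")
  case False
  define c where "c = cinner x y / complex_of_real ((norm y)\<^sup>2)"
  have c: "c * cinner y y = cinner x y"
    using False by (simp add: c_def cinner_self)
  have "cinner x (c *\<^sub>C y) = cnj c * (c * cinner y y)"
    by (simp add: cinner_algebra c)
  also have "\<dots> = complex_of_real ((cmod c * norm y)\<^sup>2)"
    using complex_norm_square[of c] by (simp add: cinner_self power_mult_distrib mult_ac)
  finally have "(norm (x - c *\<^sub>C y))\<^sup>2 = (norm x)\<^sup>2 - (cmod c * norm y)\<^sup>2"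
    using norm_diff_sq[of x "c *\<^sub>C y"] by (simp add: norm_scaleC)
  then have "(cmod c * norm y)\<^sup>2 \<le> (norm x)\<^sup>2"
    using zero_le_power2[of "norm (x - c *\<^sub>C y)"] by linarith
  then have "cmod c * norm y \<le> norm x"
    by (rule power2_le_imp_le) simp
  moreover have "cmod c = cmod (cinner x y) / (norm y)\<^sup>2"
    by (simp add: c_def norm_divide norm_power)
  ultimately show ?thesis
    using False by (simp add: power2_eq_square field_simps)
qed simp

lemma bounded_bilinear_cinner: "bounded_bilinear (cinner :: 'h::complex_hilbert \<Rightarrow> 'h \<Rightarrow> complex)"
proof
  show "\<exists>K. \<forall>a b. cmod (cinner (a::'h) b) \<le> norm a * norm b * K"
    by (rule exI[of _ 1]) (simp add: cauchy_schwarz)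
qed (simp_all add: cinner_algebra scaleR_conv_of_real)

lemmas tendsto_cinner = bounded_bilinear.tendsto[OF bounded_bilinear_cinner]
lemmas continuous_on_cinner = bounded_bilinear.continuous_on[OF bounded_bilinear_cinner]

lemma bounded_bilinear_scaleC:
  "bounded_bilinear (scaleC :: complex \<Rightarrow> 'h::complex_hilbert \<Rightarrow> 'h)"
proof
  show "\<exists>K. \<forall>a b. norm (a *\<^sub>C (b::'h)) \<le> norm a * norm b * K"
    by (rule exI[of _ 1]) (simp add: norm_scaleC)
qed (simp_all add: scaleC_add_right scaleC_add_left scaleR_scaleC scaleC_scaleC
    scaleR_conv_of_real mult.commute)

lemmas tendsto_scaleC = bounded_bilinear.tendsto[OF bounded_bilinear_scaleC]
lemmas continuous_on_scaleC = bounded_bilinear.continuous_on[OF bounded_bilinear_scaleC]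

lemma scaleC_minus_one: "(- 1) *\<^sub>C x = - (x::'h::complex_hilbert)"
  using complex_vector.scale_minus_left[of 1 x] by (simp add: scaleC_one)

lemma cinner_left_ext:
  assumes "\<And>v. cinner x v = cinner y v" shows "x = (y::'h::complex_hilbert)"
  using assms[of "x - y"] cinner_eq_zero_iff[of "x - y"] by (simp add: cinner_diff_left)

abbreviation clinear :: "('h::complex_hilbert \<Rightarrow> 'h) \<Rightarrow> bool" where
  "clinear \<equiv> Vector_Spaces.linear scaleC scaleC"

text \<open>The vectors to which a bounded sequence is asymptotically orthogonal form a closed subspace,
  so a complete family tests weak convergence to zero.\<close>

lemma weakly_null_on_complete_family:
  fixes x :: "nat \<Rightarrow> 'h::complex_hilbert"
  assumes bounded: "\<And>n. norm (x n) \<le> C"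
    and S: "\<And>z. z \<in> S \<Longrightarrow> (\<lambda>n. cinner (x n) z) \<longlonglongrightarrow> 0"
    and complete: "complete_family S"
  shows "(\<lambda>n. cinner (x n) z) \<longlonglongrightarrow> 0"
proof -
  let ?M = "{z. (\<lambda>n. cinner (x n) z) \<longlonglongrightarrow> 0}"
  have C: "C \<ge> 0"
    using bounded[of 0] norm_ge_zero order_trans by blast
  have "complex_vector.subspace ?M"
  proof (unfold complex_vector.subspace_def, intro conjI ballI allI)
    fix a b assume "a \<in> ?M" "b \<in> ?M"
    then show "a + b \<in> ?M"
      using tendsto_add[of "\<lambda>n. cinner (x n) a" 0 sequentially "\<lambda>n. cinner (x n) b" 0]
      by (simp add: cinner_add_right)
  next
    fix c a assume "a \<in> ?M"
    then show "c *\<^sub>C a \<in> ?M"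
      by (simp add: cinner_scaleC_right tendsto_mult_right_zero)
  qed simp
  then have span: "complex_vector.span S \<subseteq> ?M"
    using S by (intro complex_vector.span_minimal) auto
  have "z \<in> closure (complex_vector.span S)"
    using complete by (simp add: complete_family_def)
  show ?thesis
  proof (rule LIMSEQ_I)
    fix r :: real assume "r > 0"
    define e where "e = r / (2 * (C + 1))"
    have e: "e > 0" "C * e \<le> r / 2"
      using \<open>r > 0\<close> C by (simp_all add: e_def field_simps)
    obtain y where y: "y \<in> complex_vector.span S" "norm (z - y) < e"
      using \<open>z \<in> closure _\<close> e(1) by (metis closure_approachable dist_norm norm_minus_commute)
    then have "(\<lambda>n. cinner (x n) y) \<longlonglongrightarrow> 0"
      using span by auto
    from LIMSEQ_D[OF this, of "r / 2"] obtain N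
      where N: "\<And>n. n \<ge> N \<Longrightarrow> cmod (cinner (x n) y) < r / 2"
      using \<open>r > 0\<close> by auto
    have "cmod (cinner (x n) z - 0) < r" if "n \<ge> N" for n
    proof -
      have "cmod (cinner (x n) (z - y)) \<le> C * e"
        using cauchy_schwarz[of "x n" "z - y"] bounded[of n] y(2) C
        by (meson less_eq_real_def mult_mono norm_ge_zero order_trans)
      moreover have "cinner (x n) z = cinner (x n) (z - y) + cinner (x n) y"
        by (simp add: cinner_diff_right)
      ultimately show ?thesis
        using N[OF that] e(2) norm_triangle_ineq[of "cinner (x n) (z - y)" "cinner (x n) y"]
        by simp
    qed
    then show "\<exists>N. \<forall>n\<ge>N. cmod (cinner (x n) z - 0) < r" by blast
  qed
qed

section \<open>Schur's lemma\<close>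

definition bounded_symmetric :: "('h::complex_hilbert \<Rightarrow> 'h) \<Rightarrow> bool" where
  "bounded_symmetric A \<longleftrightarrow> clinear A \<and>
     (\<exists>K. \<forall>v. norm (A v) \<le> K * norm v) \<and> (\<forall>v w. cinner (A v) w = cinner v (A w))"

text \<open>A fixed point \<open>Y = (X + Y\<^sup>2) / 2\<close> satisfies \<open>(1 - Y)\<^sup>2 = 1 - X\<close>, so this iteration computes
  \<open>1 - \<surd>(1 - X)\<close>.  For a contraction \<open>X\<close> its increments are bounded in norm by those of the numerical
  iteration, which is the case \<open>X = 1\<close> and increases inside the unit interval.\<close>

fun sqrt_iter :: "('h::complex_hilbert \<Rightarrow> 'h) \<Rightarrow> nat \<Rightarrow> 'h \<Rightarrow> 'h" where
  "sqrt_iter X 0 = (\<lambda>v. 0)"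
| "sqrt_iter X (Suc n) = (\<lambda>v. (1/2) *\<^sub>R (X v + sqrt_iter X n (sqrt_iter X n v)))"

fun sqrt_bound :: "nat \<Rightarrow> real" where
  "sqrt_bound 0 = 0"
| "sqrt_bound (Suc n) = (1 + (sqrt_bound n)\<^sup>2) / 2"

lemma sqrt_bound_range: "0 \<le> sqrt_bound n \<and> sqrt_bound n \<le> 1"
proof (induction n)
  case (Suc n)
  then have "(sqrt_bound n)\<^sup>2 \<le> 1"
    by (simp add: power_le_one)
  then show ?case by simp
qed simp

lemma sqrt_bound_mono: "sqrt_bound n \<le> sqrt_bound (Suc n)"
proof -
  have "0 \<le> (sqrt_bound n - 1)\<^sup>2" by simp
  then show ?thesis by (simp add: power2_eq_square algebra_simps)
qed

lemma sqrt_iter_linear: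
  assumes "clinear X"
  shows "clinear (sqrt_iter X n)"
proof -
  interpret X: Vector_Spaces.linear scaleC scaleC X by fact
  show ?thesis
  proof (induction n)
    case 0
    show ?case
      by unfold_locales simp_all
  next
    case (Suc n)
    interpret Y: Vector_Spaces.linear scaleC scaleC "sqrt_iter X n" by fact
    show ?case
      by unfold_locales
        (simp_all add: X.add X.scale Y.add Y.scale scaleR_scaleC scaleC_add_right scaleC_scaleC
          mult.commute)
  qed
qed

lemma sqrt_iter_commute:
  assumes "clinear U" "\<And>v. U (X v) = X (U v)"
  shows "U (sqrt_iter X n v) = sqrt_iter X n (U v)"
proof -
  interpret U: Vector_Spaces.linear scaleC scaleC U by fact
  show ?thesis
    by (induction n arbitrary: v) (simp_all add: U.zero U.add U.scale assms(2) scaleR_scaleC)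
qed

lemma sqrt_iter_norm:
  assumes "\<And>v. norm (X v) \<le> norm (v::'h::complex_hilbert)"
  shows "norm (sqrt_iter X n v) \<le> sqrt_bound n * norm v"
proof (induction n arbitrary: v)
  case (Suc n)
  let ?b = "sqrt_bound n"
  have "norm (sqrt_iter X n (sqrt_iter X n v)) \<le> ?b * (?b * norm v)"
    by (meson Suc.IH mult_left_mono order_trans sqrt_bound_range)
  moreover have "norm (X v + sqrt_iter X n (sqrt_iter X n v))
      \<le> norm v + norm (sqrt_iter X n (sqrt_iter X n v))"
    using norm_triangle_le assms by (metis add_le_cancel_right norm_triangle_ineq order_trans)
  ultimately have "norm (X v + sqrt_iter X n (sqrt_iter X n v)) \<le> (1 + ?b\<^sup>2) * norm v"
    by (simp add: power2_eq_square distrib_right mult.assoc)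
  then show ?case by simp
qed simp

lemma sqrt_iter_increment:
  assumes lin: "clinear X"
    and contr: "\<And>v. norm (X v) \<le> norm (v::'h::complex_hilbert)"
  shows "norm (sqrt_iter X (Suc n) v - sqrt_iter X n v)
           \<le> (sqrt_bound (Suc n) - sqrt_bound n) * norm v"
  \<comment> \<open>The iterates commute, so \<open>Z\<^sup>2 - Y\<^sup>2 = (Z + Y) (Z - Y)\<close> holds as for numbers.\<close>
proof (induction n arbitrary: v)
  case 0
  then show ?case using contr[of v] by simp
next
  case (Suc n)
  let ?Y = "sqrt_iter X n" and ?Z = "sqrt_iter X (Suc n)"
  let ?y = "sqrt_bound n" and ?z = "sqrt_bound (Suc n)"
  interpret Y: Vector_Spaces.linear scaleC scaleC ?Y by (rule sqrt_iter_linear[OF lin])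
  interpret Z: Vector_Spaces.linear scaleC scaleC ?Z by (rule sqrt_iter_linear[OF lin])
  have YX: "?Y (X v) = X (?Y v)" for v
    by (rule sqrt_iter_commute[where U = X and X = X, OF lin refl, symmetric])
  have YZ: "?Y (?Z v) = ?Z (?Y v)" for v
    by (rule sqrt_iter_commute[where U = ?Y and X = X, OF Y.linear_axioms YX])
  define w where "w = ?Z v - ?Y v"
  have w: "norm w \<le> (?z - ?y) * norm v" unfolding w_def by (rule Suc.IH)
  have "sqrt_iter X (Suc (Suc n)) v - ?Z v = (1/2) *\<^sub>R (?Z (?Z v) - ?Y (?Y v))"
    by (subst (1) sqrt_iter.simps(2), subst (3) sqrt_iter.simps(2)) (simp add: scaleR_diff_right scaleR_add_right del: sqrt_iter.simps)
  also have "?Z (?Z v) - ?Y (?Y v) = ?Z w + ?Y w"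
    unfolding w_def Z.diff Y.diff YZ[of v] by simp
  finally have "norm (sqrt_iter X (Suc (Suc n)) v - ?Z v) \<le> (norm (?Z w) + norm (?Y w)) / 2"
    by (simp add: norm_triangle_ineq del: sqrt_iter.simps)
  also have "\<dots> \<le> (?z * norm w + ?y * norm w) / 2"
    by (intro divide_right_mono add_mono sqrt_iter_norm contr) simp
  also have "\<dots> = (?z + ?y) / 2 * norm w" by (simp add: algebra_simps)
  also have "\<dots> \<le> (?z + ?y) / 2 * ((?z - ?y) * norm v)"
    using w sqrt_bound_range[of n] sqrt_bound_range[of "Suc n"]
    by (intro mult_left_mono) auto
  also have "\<dots> = (sqrt_bound (Suc (Suc n)) - ?z) * norm v"
  proof -
    have "sqrt_bound (Suc (Suc n)) - ?z = (?z + ?y) / 2 * (?z - ?y)"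
    proof -
      have "sqrt_bound (Suc (Suc n)) - ?z = (?z\<^sup>2 - ?y\<^sup>2) / 2"
        using sqrt_bound.simps(2)[of "Suc n"] sqrt_bound.simps(2)[of n] by argo
      also have "?z\<^sup>2 - ?y\<^sup>2 = (?z + ?y) * (?z - ?y)"
        by (simp only: power2_eq_square square_diff_square_factored)
      finally show ?thesis by (simp del: sqrt_bound.simps)
    qed
    then show ?thesis by simp
  qed
  finally show ?case .
qed

lemma sqrt_iter_convergent:
  assumes lin: "clinear X"
    and contr: "\<And>v. norm (X v) \<le> norm (v::'h::complex_hilbert)"
  shows "convergent (\<lambda>n. sqrt_iter X n v)"
proof -
  have "summable (\<lambda>n. sqrt_bound (Suc n) - sqrt_bound n)"
  proof -
    have "convergent sqrt_bound"
      using sqrt_bound_mono sqrt_bound_range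
      by (intro Bseq_monoseq_convergent BseqI'[of _ 1]) (auto simp: monoseq_Suc)
    then show ?thesis
      unfolding convergent_def using telescope_summable by blast
  qed
  then have "summable (\<lambda>n. (sqrt_bound (Suc n) - sqrt_bound n) * norm v)"
    by (rule summable_mult2)
  then have "summable (\<lambda>n. sqrt_iter X (Suc n) v - sqrt_iter X n v)"
    by (rule summable_comparison_test') (use sqrt_iter_increment[OF lin contr] in blast)
  then have "convergent (\<lambda>n. \<Sum>k<n. sqrt_iter X (Suc k) v - sqrt_iter X k v)"
    by (simp add: summable_iff_convergent)
  then show ?thesis
    by (simp add: sum_lessThan_telescope[where f = "\<lambda>k. sqrt_iter X k v"] del: sqrt_iter.simps(2))
qed

text \<open>Here \<open>W = 1 - Y\<close> is the absolute value of \<open>A\<close>, with \<open>Y\<close> the limit of the iteration for \<open>X = 1 - A\<^sup>2\<close>.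
  It is nonnegative since \<open>\<parallel>Y\<parallel> \<le> 1\<close>, and like all iterates it commutes with every bounded
  operator that commutes with \<open>A\<close>.\<close>

lemma symmetric_contraction_abs:
  fixes A :: "'h::complex_hilbert \<Rightarrow> 'h"
  assumes lin: "clinear A"
    and contr: "\<And>v. norm (A v) \<le> norm v"
    and sym: "\<And>v w. cinner (A v) w = cinner v (A w)"
  obtains W where "clinear W" "\<And>v. norm (W v) \<le> 2 * norm v"
    "\<And>v. W (W v) = A (A v)" "\<And>v. Re (cinner (W v) v) \<ge> 0"
    "\<And>U v. clinear U \<Longrightarrow> bounded_linear U \<Longrightarrow>
       (\<And>v. U (A v) = A (U v)) \<Longrightarrow> U (W v) = W (U v)"
proof -
  interpret A: Vector_Spaces.linear scaleC scaleC A by fact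
  define X where "X = (\<lambda>v. v - A (A v))"
  interpret X: Vector_Spaces.linear scaleC scaleC X
    by unfold_locales
      (simp_all add: X_def A.add A.scale complex_vector.scale_right_diff_distrib)
  have X_contr: "norm (X v) \<le> norm v" for v
  proof -
    have "cinner v (A (A v)) = cinner (A v) (A v)"
      by (simp add: sym)
    then have "(norm (X v))\<^sup>2 = (norm v)\<^sup>2 - 2 * (norm (A v))\<^sup>2 + (norm (A (A v)))\<^sup>2"
      by (simp add: X_def norm_diff_sq cinner_self)
    moreover have "(norm (A (A v)))\<^sup>2 \<le> (norm (A v))\<^sup>2"
      by (simp add: contr)
    ultimately have "(norm (X v))\<^sup>2 \<le> (norm v)\<^sup>2"
      using zero_le_power2[of "norm (A v)"] by linarith
    then show ?thesis by (rule power2_le_imp_le) simp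
  qed
  note X_lin = X.linear_axioms
  let ?Y = "sqrt_iter X"
  define Y where "Y = (\<lambda>v. lim (\<lambda>n. ?Y n v))"
  have Y_lim: "(\<lambda>n. ?Y n v) \<longlonglongrightarrow> Y v" for v
    using sqrt_iter_convergent[OF X_lin X_contr] by (simp add: Y_def convergent_LIMSEQ_iff)
  have Yn_norm: "norm (?Y n v) \<le> norm v" for n v
    using sqrt_iter_norm[OF X_contr, of n v] sqrt_bound_range[of n]
    by (meson mult_left_le_one_le norm_ge_zero order_trans)
  have Y_norm: "norm (Y v) \<le> norm v" for v
    using tendsto_norm[OF Y_lim[of v]] by (rule LIMSEQ_le_const2) (use Yn_norm in blast)
  interpret Y: Vector_Spaces.linear scaleC scaleC Y
  proof unfold_locales
    fix a b
    interpret Yn: Vector_Spaces.linear scaleC scaleC "?Y n" for n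
      by (rule sqrt_iter_linear[OF X_lin])
    show "Y (a + b) = Y a + Y b"
      using LIMSEQ_unique[OF Y_lim[of "a + b"]] tendsto_add[OF Y_lim[of a] Y_lim[of b]]
      by (simp add: Yn.add)
    fix c
    show "Y (c *\<^sub>C a) = c *\<^sub>C Y a"
      using LIMSEQ_unique[OF Y_lim[of "c *\<^sub>C a"]] tendsto_scaleC[OF tendsto_const Y_lim[of a]]
      by (simp add: Yn.scale)
  qed
  have YY_lim: "(\<lambda>n. ?Y n (?Y n v)) \<longlonglongrightarrow> Y (Y v)" for v
  proof -
    interpret Yn: Vector_Spaces.linear scaleC scaleC "?Y n" for n
      by (rule sqrt_iter_linear[OF X_lin])
    have "(\<lambda>n. ?Y n (?Y n v - Y v)) \<longlonglongrightarrow> 0"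
    proof (rule Lim_null_comparison)
      show "\<forall>\<^sub>F n in sequentially. norm (?Y n (?Y n v - Y v)) \<le> norm (?Y n v - Y v)"
        using Yn_norm by simp
      show "(\<lambda>n. norm (?Y n v - Y v)) \<longlonglongrightarrow> 0"
        using Y_lim[of v] by (simp add: LIM_zero tendsto_norm_zero)
    qed
    from tendsto_add[OF this Y_lim[of "Y v"]] show ?thesis
      by (simp add: Yn.diff)
  qed
  have fixpoint: "2 *\<^sub>R Y v = X v + Y (Y v)" for v
  proof -
    have "(\<lambda>n. ?Y (Suc n) v) \<longlonglongrightarrow> (1/2) *\<^sub>R (X v + Y (Y v))"
      unfolding sqrt_iter.simps by (intro tendsto_intros YY_lim)
    moreover have "(\<lambda>n. ?Y (Suc n) v) \<longlonglongrightarrow> Y v"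
      using Y_lim LIMSEQ_Suc by blast
    ultimately have "Y v = (1/2) *\<^sub>R (X v + Y (Y v))"
      using LIMSEQ_unique by blast
    then show ?thesis by (metis divide_self_if mult.commute scaleR_one scaleR_scaleR times_divide_eq_right zero_neq_numeral)
  qed
  define W where "W = (\<lambda>v. v - Y v)"
  show ?thesis
  proof
    show "clinear W"
      by unfold_locales
        (simp_all add: W_def Y.add Y.scale complex_vector.scale_right_diff_distrib)
    show "norm (W v) \<le> 2 * norm v" for v
      unfolding W_def using norm_triangle_ineq4[of v "Y v"] Y_norm[of v] by linarith
    show "W (W v) = A (A v)" for v
    proof -
      have "W (W v) = v - 2 *\<^sub>R Y v + Y (Y v)"
        by (simp add: W_def Y.diff scaleR_2 algebra_simps)
      then show ?thesis by (simp add: fixpoint X_def)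
    qed
    show "Re (cinner (W v) v) \<ge> 0" for v
    proof -
      have "Re (cinner (Y v) v) \<le> norm v * norm v"
        using cauchy_schwarz[of "Y v" v] Y_norm[of v] complex_Re_le_cmod[of "cinner (Y v) v"]
        by (meson mult_right_mono norm_ge_zero order_trans)
      then show ?thesis
        by (simp add: W_def cinner_diff_left Re_cinner_self power2_eq_square)
    qed
    fix U :: "'h \<Rightarrow> 'h" and v
    assume U: "clinear U" "bounded_linear U"
      and UA: "\<And>v. U (A v) = A (U v)"
    interpret U: Vector_Spaces.linear scaleC scaleC U by fact
    have "U (X v) = X (U v)" for v
      by (simp add: X_def U.diff UA)
    from sqrt_iter_commute[where U = U and X = X, OF U(1) this]
    have "U (?Y n v) = ?Y n (U v)" for n .
    with bounded_linear.tendsto[OF U(2) Y_lim[of v]] have "(\<lambda>n. ?Y n (U v)) \<longlonglongrightarrow> U (Y v)"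
      by simp
    then have "U (Y v) = Y (U v)"
      using Y_lim LIMSEQ_unique by blast
    then show "U (W v) = W (U v)"
      by (simp add: W_def U.diff)
  qed
qed

lemma unitary_operator_linear: "unitary_operator u \<Longrightarrow> clinear u"
  by (simp add: unitary_operator_def)

lemma unitary_operator_norm: "unitary_operator u \<Longrightarrow> norm (u v) = norm v"
  unfolding unitary_operator_def
  by (metis Re_cinner_self norm_ge_zero power2_eq_imp_eq)

lemma bounded_clinear:
  fixes A :: "'h::complex_hilbert \<Rightarrow> 'h"
  assumes "clinear A" and "\<And>v. norm (A v) \<le> K * norm v"
  shows "bounded_linear A"
proof -
  interpret A: Vector_Spaces.linear scaleC scaleC A by fact
  show ?thesis
  proof
    show "\<exists>K. \<forall>x. norm (A x) \<le> norm x * K"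
      using assms(2) by (intro exI[of _ K]) (simp add: mult.commute)
  qed (simp_all add: A.add A.scale scaleR_scaleC)
qed

lemma unitary_operator_bounded: "unitary_operator u \<Longrightarrow> bounded_linear u"
  by (rule bounded_clinear[of u 1]) (simp_all add: unitary_operator_linear unitary_operator_norm)

text \<open>With \<open>W\<close> the absolute value of \<open>A\<close>, one has \<open>(W - A) (W + A) = 0\<close>.  The kernel of \<open>W - A\<close> is
  invariant, so irreducibility leaves \<open>A = W\<close> or \<open>A = - W\<close>.\<close>

lemma irreducible_commutant_semidefinite:
  fixes \<pi> :: "'g \<Rightarrow> 'h::complex_hilbert \<Rightarrow> 'h"
  assumes irr: "irreducible_representation G \<pi>"
    and unit: "\<And>x. x \<in> carrier G \<Longrightarrow> unitary_operator (\<pi> x)"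
    and A: "bounded_symmetric A"
    and comm: "\<And>x v. x \<in> carrier G \<Longrightarrow> \<pi> x (A v) = A (\<pi> x v)"
  shows "(\<forall>v. Re (cinner (A v) v) \<ge> 0) \<or> (\<forall>v. Re (cinner (A v) v) \<le> 0)"
proof -
  interpret A: Vector_Spaces.linear scaleC scaleC A
    using A by (simp add: bounded_symmetric_def)
  obtain K where K: "\<And>v. norm (A v) \<le> K * norm v"
    using A by (auto simp: bounded_symmetric_def)
  \<comment> \<open>Scale \<open>A\<close> to a contraction.\<close>
  define c where "c = inverse (\<bar>K\<bar> + 1)"
  have c: "c > 0" by (simp add: c_def)
  define A1 where "A1 = (\<lambda>v. c *\<^sub>R A v)"
  have lin1: "clinear A1"
    by unfold_locales (simp_all add: A1_def A.add A.scale scaleR_scaleC scaleC_add_right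
        scaleC_scaleC mult.commute)
  have contr1: "norm (A1 v) \<le> norm v" for v
  proof -
    have "norm (A v) \<le> (\<bar>K\<bar> + 1) * norm v"
      using K[of v] by (smt (verit) mult_right_mono norm_ge_zero)
    then show ?thesis by (simp add: A1_def c_def field_simps)
  qed
  have sym1: "cinner (A1 v) w = cinner v (A1 w)" for v w
    using A by (simp add: A1_def cinner_algebra bounded_symmetric_def)
  obtain W where W: "clinear W" "\<And>v. norm (W v) \<le> 2 * norm v"
    "\<And>v. W (W v) = A1 (A1 v)" "\<And>v. Re (cinner (W v) v) \<ge> 0"
    and W_comm: "\<And>U v. clinear U \<Longrightarrow> bounded_linear U \<Longrightarrow>
       (\<And>v. U (A1 v) = A1 (U v)) \<Longrightarrow> U (W v) = W (U v)"
    using symmetric_contraction_abs[OF lin1 contr1 sym1] by blast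
  interpret W: Vector_Spaces.linear scaleC scaleC W by fact
  interpret A1: Vector_Spaces.linear scaleC scaleC A1 by fact
  have bA1: "bounded_linear A1"
    using lin1 contr1 by (intro bounded_clinear[of _ 1]) auto
  have bW: "bounded_linear W"
    using W by (intro bounded_clinear) auto
  have A1W: "A1 (W v) = W (A1 v)" for v
    by (rule W_comm[where U = A1, OF lin1 bA1 refl])
  let ?M = "{v. W v = A1 v}"
  have "complex_vector.subspace ?M"
    by (auto simp: complex_vector.subspace_def W.zero A1.zero W.add A1.add W.scale A1.scale)
  moreover have "closed ?M"
    using bA1 bW by (intro closed_Collect_eq) (simp_all add: linear_continuous_on)
  moreover have "\<forall>x\<in>carrier G. \<pi> x ` ?M \<subseteq> ?M"
  proof (intro ballI subsetI)
    fix x w assume x: "x \<in> carrier G" and "w \<in> \<pi> x ` ?M"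
    then obtain v where v: "w = \<pi> x v" "W v = A1 v" by auto
    interpret P: Vector_Spaces.linear scaleC scaleC "\<pi> x"
      using unit[OF x] by (rule unitary_operator_linear)
    have P1: "\<pi> x (A1 v) = A1 (\<pi> x v)" for v
      using comm[OF x] by (simp add: A1_def scaleR_scaleC P.scale)
    have "\<pi> x (W v) = W (\<pi> x v)"
      by (rule W_comm[where U = "\<pi> x", OF P.linear_axioms unitary_operator_bounded[OF unit[OF x]] P1])
    then show "w \<in> ?M" using v P1 by simp
  qed
  ultimately consider "?M = {0}" | "?M = UNIV"
    using irr unfolding irreducible_representation_def by blast
  then show ?thesis
  proof cases
    case 1
    have "W v = - A1 v" for v
    proof -
      have "W (W v + A1 v) = A1 (W v + A1 v)"
        by (simp add: W.add A1.add A1W W(3))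
      then have "W v + A1 v = 0" using 1 by blast
      then show ?thesis by (simp add: add_eq_0_iff2)
    qed
    then have "- (c * Re (cinner (A v) v)) \<ge> 0" for v
      using W(4)[of v] by (simp add: A1_def cinner_algebra)
    then show ?thesis using c by (simp add: mult_le_0_iff)
  next
    case 2
    then have "W v = A1 v" for v by blast
    then have "c * Re (cinner (A v) v) \<ge> 0" for v
      using W(4)[of v] by (simp add: A1_def cinner_algebra)
    then show ?thesis using c by (simp add: zero_le_mult_iff)
  qed
qed

text \<open>Applied to all shifts \<open>A - \<lambda>\<close>, the dichotomy makes the Rayleigh quotient of \<open>A\<close> constant.\<close>

lemma schur:
  fixes \<pi> :: "'g \<Rightarrow> 'h::complex_hilbert \<Rightarrow> 'h"
  assumes irr: "irreducible_representation G \<pi>"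
    and unit: "\<And>x. x \<in> carrier G \<Longrightarrow> unitary_operator (\<pi> x)"
    and A: "bounded_symmetric A"
    and comm: "\<And>x v. x \<in> carrier G \<Longrightarrow> \<pi> x (A v) = A (\<pi> x v)"
  shows "\<exists>r::real. \<forall>v. A v = r *\<^sub>R v"
proof -
  interpret A: Vector_Spaces.linear scaleC scaleC A
    using A by (simp add: bounded_symmetric_def)
  obtain K where K: "\<And>v. norm (A v) \<le> K * norm v"
    using A by (auto simp: bounded_symmetric_def)
  have sym: "cinner (A v) w = cinner v (A w)" for v w
    using A by (simp add: bounded_symmetric_def)
  have shift: "bounded_symmetric (\<lambda>v. A v - r *\<^sub>R v)" for r
    unfolding bounded_symmetric_def
  proof (intro conjI allI exI)
    show "clinear (\<lambda>v. A v - r *\<^sub>R v)"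
      by unfold_locales (simp_all add: A.add A.scale complex_vector.scale_right_diff_distrib
          scaleR_scaleC scaleC_add_right scaleC_scaleC mult.commute)
    show "norm (A v - r *\<^sub>R v) \<le> (K + \<bar>r\<bar>) * norm v" for v
      using norm_triangle_ineq4[of "A v" "r *\<^sub>R v"] K[of v] by (simp add: distrib_right)
    show "cinner (A v - r *\<^sub>R v) w = cinner v (A w - r *\<^sub>R w)" for v w
      by (simp add: cinner_algebra sym)
  qed
  have dich: "(\<forall>v. Re (cinner (A v) v) \<ge> r * (norm v)\<^sup>2) \<or> (\<forall>v. Re (cinner (A v) v) \<le> r * (norm v)\<^sup>2)"
    for r
  proof -
    have "\<pi> x (A v - r *\<^sub>R v) = A (\<pi> x v) - r *\<^sub>R \<pi> x v" if x: "x \<in> carrier G" for x v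
    proof -
      interpret P: Vector_Spaces.linear scaleC scaleC "\<pi> x"
        using unit[OF x] by (rule unitary_operator_linear)
      show ?thesis by (simp add: P.diff P.scale scaleR_scaleC comm[OF x])
    qed
    from irreducible_commutant_semidefinite[where A = "\<lambda>v. A v - r *\<^sub>R v" and \<pi> = \<pi>,
        OF irr unit shift this]
    show ?thesis by (simp add: cinner_algebra Re_cinner_self)
  qed
  obtain e :: 'h where e: "e \<noteq> 0"
    using irr by (auto simp: irreducible_representation_def)
  define q where "q = (\<lambda>v. Re (cinner (A v) v) / (norm v)\<^sup>2)"
  have const: "\<not> q v < q w" if "v \<noteq> 0" "w \<noteq> 0" for v w
  proof
    assume "q v < q w"
    then obtain r where r: "q v < r" "r < q w" using dense by blast
    then have "Re (cinner (A v) v) < r * (norm v)\<^sup>2" "Re (cinner (A w) w) > r * (norm w)\<^sup>2"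
      using that by (simp_all add: q_def field_simps)
    then have "\<not> (\<forall>v. Re (cinner (A v) v) \<ge> r * (norm v)\<^sup>2)"
      and "\<not> (\<forall>v. Re (cinner (A v) v) \<le> r * (norm v)\<^sup>2)"
      using not_le by blast+
    with dich[of r] show False by blast
  qed
  define B where "B = (\<lambda>v. A v - q e *\<^sub>R v)"
  have B0: "Re (cinner (B v) v) = 0" for v
  proof (cases "v = 0")
    case False
    then have "q v = q e" using const[of v e] const[of e v] e by linarith
    then have "Re (cinner (A v) v) = q e * (norm v)\<^sup>2"
      using False unfolding q_def by (simp add: field_simps)
    then show ?thesis by (simp add: B_def cinner_algebra Re_cinner_self)
  qed (simp add: B_def)
  \<comment> \<open>A symmetric operator with vanishing quadratic form is zero: test on \<open>v + B v\<close>.\<close>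
  have "B v = 0" for v
  proof -
    have symB: "cinner (B v) w = cinner v (B w)" for v w
      using shift[of "q e"] by (simp add: bounded_symmetric_def B_def)
    have add: "B (v + B v) = B v + B (B v)"
      by (simp add: B_def A.add A.diff A.scale scaleR_scaleC complex_vector.scale_right_diff_distrib scaleC_add_right algebra_simps)
    have "Re (cinner (B (v + B v)) (v + B v))
        = Re (cinner (B v) v) + Re (cinner (B (B v)) (B v)) + 2 * Re (cinner (B v) (B v))"
      unfolding add cinner_add_left cinner_add_right symB[of "B v" v] by simp
    then show ?thesis by (simp add: B0 Re_cinner_self)
  qed
  then have "A v = q e *\<^sub>R v" for v by (simp add: B_def)
  then show ?thesis by blast
qed

section \<open>Quadratic forms given by square integrals and their resolvents\<close>

text \<open>The Cauchy-Schwarz inequality for semidefinite forms, in the shape in which it arises from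
  expanding the form at \<open>u + t w\<close>.\<close>

lemma quadratic_nonneg_discriminant:
  fixes a b c :: real
  assumes "\<And>t. 0 \<le> a + 2 * b * t + c * t\<^sup>2" "0 \<le> c"
  shows "b\<^sup>2 \<le> a * c"
proof (cases "c = 0")
  case True
  have "b = 0"
  proof (rule ccontr)
    assume b: "b \<noteq> 0"
    \<comment> \<open>Evaluate where the affine function equals \<open>-1\<close>.\<close>
    have "0 \<le> a + 2 * b * (- (a + 1) / (2 * b))"
      using assms(1)[of "- (a + 1) / (2 * b)"] True by simp
    also have "2 * b * (- (a + 1) / (2 * b)) = - (a + 1)"
      using b by (simp add: field_simps)
    finally show False by simp
  qed
  then show ?thesis using True by simp
next
  case False
  have "0 \<le> a + 2 * b * (- b / c) + c * (- b / c)\<^sup>2" by (rule assms)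
  also have "\<dots> = a - b\<^sup>2 / c" using False by (simp add: power2_eq_square field_simps)
  finally show ?thesis using False assms(2) by (simp add: field_simps)
qed

lemma power2_diff_le: "(a - b)\<^sup>2 \<le> 2 * a\<^sup>2 + 2 * (b::real)\<^sup>2"
  using zero_le_power2[of "a + b"] by (simp add: power2_eq_square algebra_simps)

lemma cnj_measurable [measurable]: "cnj \<in> borel_measurable borel"
  by (intro borel_measurable_continuous_onI continuous_intros)

abbreviation sqcoeff :: "'h::complex_hilbert \<Rightarrow> 'h \<Rightarrow> ennreal" where
  "sqcoeff f v \<equiv> ennreal ((cmod (cinner f v))\<^sup>2)"

text \<open>The quadratic form of the frame operator of the family \<open>k\<close>, infinite outside of its form domain.
  The family is indexed below by a group with invariant measure or by a lattice with counting
  measure.\<close>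

definition energy :: "'y measure \<Rightarrow> ('y \<Rightarrow> 'h::complex_hilbert) \<Rightarrow> 'h \<Rightarrow> ennreal" where
  "energy N k f = (\<integral>\<^sup>+ y. sqcoeff f (k y) \<partial>N)"

lemma energy_zero [simp]: "energy N k 0 = 0"
  by (simp add: energy_def)

locale energy_form =
  fixes N :: "'y measure" and k :: "'y \<Rightarrow> 'h::complex_hilbert"
  assumes coefficient_measurable [measurable]: "\<And>f. (\<lambda>y. cinner f (k y)) \<in> borel_measurable N"
begin

abbreviation "Q \<equiv> energy N k"

text \<open>The sesquilinear form of \<open>Q\<close>, meaningful for vectors of finite energy.\<close>

definition B :: "'h \<Rightarrow> 'h \<Rightarrow> complex" where
  "B u v = (LINT y|N. cinner u (k y) * cnj (cinner v (k y)))"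

lemma energy_scaleC: "Q (c *\<^sub>C v) = ennreal ((cmod c)\<^sup>2) * Q v"
  unfolding energy_def
  by (subst nn_integral_cmult[symmetric])
     (simp_all add: cinner_scaleC_left norm_mult power_mult_distrib ennreal_mult)

lemma energy_parallelogram: "Q (u + v) + Q (u - v) = 2 * Q u + 2 * Q v"
proof -
  have pt: "ennreal ((cmod (a + b))\<^sup>2) + ennreal ((cmod (a - b))\<^sup>2)
      = 2 * ennreal ((cmod a)\<^sup>2) + 2 * ennreal ((cmod b)\<^sup>2)" for a b :: complex
  proof -
    have "(cmod (a + b))\<^sup>2 + (cmod (a - b))\<^sup>2 = 2 * (cmod a)\<^sup>2 + 2 * (cmod b)\<^sup>2"
      unfolding cmod_power2 by (simp add: power2_eq_square algebra_simps)
    then have "ennreal ((cmod (a + b))\<^sup>2 + (cmod (a - b))\<^sup>2) = ennreal (2 * (cmod a)\<^sup>2 + 2 * (cmod b)\<^sup>2)"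
      by simp
    then show ?thesis
      by (simp add: ennreal_plus ennreal_mult del: ennreal_plus[symmetric])
  qed
  have "Q (u + v) + Q (u - v) = (\<integral>\<^sup>+ y. ennreal ((cmod (cinner u (k y) + cinner v (k y)))\<^sup>2)
      + ennreal ((cmod (cinner u (k y) - cinner v (k y)))\<^sup>2) \<partial>N)"
    unfolding energy_def cinner_add_left cinner_diff_left
    by (rule nn_integral_add[symmetric]) measurable
  also have "\<dots> = 2 * Q u + 2 * Q v"
    unfolding pt energy_def by (simp add: nn_integral_add nn_integral_cmult)
  finally show ?thesis .
qed

lemma finite_energy_add:
  assumes "Q u < \<infinity>" "Q v < \<infinity>" shows "Q (u + v) < \<infinity>"
proof -
  have "Q (u + v) \<le> 2 * Q u + 2 * Q v"
    by (subst energy_parallelogram[symmetric]) simp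
  also have "\<dots> < \<infinity>" using assms by (simp add: ennreal_mult_less_top)
  finally show ?thesis .
qed

lemma finite_energy_scaleC: "Q u < \<infinity> \<Longrightarrow> Q (c *\<^sub>C u) < \<infinity>"
  by (simp add: energy_scaleC ennreal_mult_less_top)

lemma finite_energy_scaleR: "Q u < \<infinity> \<Longrightarrow> Q (r *\<^sub>R u) < \<infinity>"
  by (simp only: scaleR_scaleC finite_energy_scaleC)

lemma finite_energy_diff:
  assumes "Q u < \<infinity>" "Q v < \<infinity>" shows "Q (u - v) < \<infinity>"
  using finite_energy_add[OF assms(1) finite_energy_scaleR[OF assms(2), of "-1"]] by simp

lemma integrable_coefficient_sq:
  assumes "Q u < \<infinity>" shows "integrable N (\<lambda>y. (cmod (cinner u (k y)))\<^sup>2)"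
  using assms by (intro integrableI_nonneg) (simp_all add: energy_def)

lemma integrable_coefficient_mult:
  assumes "Q u < \<infinity>" "Q v < \<infinity>"
  shows "integrable N (\<lambda>y. cinner u (k y) * cnj (cinner v (k y)))"
proof (rule Bochner_Integration.integrable_bound)
  show "integrable N (\<lambda>y. (cmod (cinner u (k y)))\<^sup>2 + (cmod (cinner v (k y)))\<^sup>2)"
    using assms by (intro Bochner_Integration.integrable_add integrable_coefficient_sq)
  show "AE y in N. norm (cinner u (k y) * cnj (cinner v (k y)))
      \<le> norm ((cmod (cinner u (k y)))\<^sup>2 + (cmod (cinner v (k y)))\<^sup>2)"
  proof (rule AE_I2)
    fix y
    have "cmod (cinner u (k y)) * cmod (cinner v (k y))
        \<le> (cmod (cinner u (k y)))\<^sup>2 + (cmod (cinner v (k y)))\<^sup>2"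
      using sum_squares_bound[of "cmod (cinner u (k y))" "cmod (cinner v (k y))"]
        mult_nonneg_nonneg[OF norm_ge_zero norm_ge_zero, of "cinner u (k y)" "cinner v (k y)"]
      by linarith
    then show "norm (cinner u (k y) * cnj (cinner v (k y)))
      \<le> norm ((cmod (cinner u (k y)))\<^sup>2 + (cmod (cinner v (k y)))\<^sup>2)"
      by (simp add: norm_mult)
  qed
qed measurable

lemma B_add_left:
  assumes "Q u < \<infinity>" "Q v < \<infinity>" "Q w < \<infinity>" shows "B (u + v) w = B u w + B v w"
  unfolding B_def using assms
  by (simp add: cinner_add_left distrib_right integrable_coefficient_mult)

lemma B_scaleC_left: "B (c *\<^sub>C u) w = c * B u w"
  unfolding B_def by (simp add: cinner_scaleC_left mult.assoc)

lemma B_commute: "B u v = cnj (B v u)"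
proof -
  have "cnj (B v u) = (LINT y|N. cnj (cinner v (k y) * cnj (cinner u (k y))))"
    unfolding B_def by (rule Bochner_Integration.integral_cnj[symmetric])
  then show ?thesis by (simp add: B_def mult.commute)
qed

lemma B_self:
  assumes "Q u < \<infinity>" shows "B u u = complex_of_real (enn2real (Q u))"
proof -
  have "B u u = (LINT y|N. complex_of_real ((cmod (cinner u (k y)))\<^sup>2))"
    unfolding B_def by (simp only: complex_norm_square)
  also have "\<dots> = complex_of_real (LINT y|N. (cmod (cinner u (k y)))\<^sup>2)"
    by (rule integral_complex_of_real)
  also have "(LINT y|N. (cmod (cinner u (k y)))\<^sup>2) = enn2real (Q u)"
    unfolding energy_def by (rule integral_eq_nn_integral) simp_all
  finally show ?thesis .
qed

lemma B_diff_left: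
  assumes "Q u < \<infinity>" "Q v < \<infinity>" "Q w < \<infinity>" shows "B (u - v) w = B u w - B v w"
  using B_add_left[OF assms(1) finite_energy_scaleC[OF assms(2), of "-1"] assms(3)]
    B_scaleC_left[of "-1" v w]
  by (simp add: scaleC_minus_one)

lemma energy_eq_ennreal: "Q u < \<infinity> \<Longrightarrow> Q u = ennreal (enn2real (Q u))"
  by simp

lemma energy_add_expand:
  assumes "Q u < \<infinity>" "Q v < \<infinity>"
  shows "enn2real (Q (u + v)) = enn2real (Q u) + 2 * Re (B u v) + enn2real (Q v)"
proof -
  have uv: "Q (u + v) < \<infinity>" using assms by (rule finite_energy_add)
  have "B (u + v) (u + v) = B u (u + v) + B v (u + v)"
    using assms uv by (simp add: B_add_left)
  also have "\<dots> = cnj (B u u + B v u) + cnj (B u v + B v v)"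
    using assms uv by (simp add: B_commute[of _ "u + v"] B_add_left)
  finally have "Re (B (u + v) (u + v)) = Re (B u u) + (Re (B u v) + Re (B v u)) + Re (B v v)"
    by simp
  moreover have "Re (B v u) = Re (B u v)"
    by (subst B_commute) simp
  ultimately show ?thesis using assms uv by (simp add: B_self)
qed

lemma energy_polarisation:
  assumes "Q u < \<infinity>" "Q v < \<infinity>"
  shows "4 * Re (B u v) = enn2real (Q (u + v)) - enn2real (Q (u - v))"
proof -
  have m: "Q (- v) < \<infinity>" using finite_energy_scaleC[OF assms(2), of "-1"] by (simp add: scaleC_minus_one)
  have "B (- v) u = - B v u" using B_scaleC_left[of "-1" v u] by (simp add: scaleC_minus_one)
  then have "Re (B u (- v)) = - Re (B u v)"
    by (subst B_commute, subst (2) B_commute) simp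
  moreover have "Q (- v) = Q v" using energy_scaleC[of "-1" v] by (simp add: scaleC_minus_one)
  ultimately show ?thesis
    using energy_add_expand[OF assms] energy_add_expand[OF assms(1) m] by simp
qed

text \<open>Coefficients converge pointwise, so Fatou's lemma makes the form lower semicontinuous, which
  amounts to its being closed.\<close>

lemma energy_le_of_tendsto:
  assumes "v \<longlonglongrightarrow> u" "\<forall>\<^sub>F n in sequentially. Q (v n) \<le> C"
  shows "Q u \<le> C"
proof -
  have "Q u = (\<integral>\<^sup>+ y. liminf (\<lambda>n. sqcoeff (v n) (k y)) \<partial>N)"
    unfolding energy_def
  proof (rule nn_integral_cong)
    fix y
    have "(\<lambda>n. sqcoeff (v n) (k y)) \<longlonglongrightarrow> sqcoeff u (k y)"
      by (intro tendsto_ennrealI tendsto_power tendsto_norm tendsto_cinner assms(1) tendsto_const)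
    then show "sqcoeff u (k y) = liminf (\<lambda>n. sqcoeff (v n) (k y))"
      using lim_imp_Liminf trivial_limit_sequentially by metis
  qed
  also have "\<dots> \<le> liminf (\<lambda>n. Q (v n))"
    unfolding energy_def by (rule nn_integral_liminf) measurable
  also have "\<dots> \<le> limsup (\<lambda>n. Q (v n))"
    by (rule Liminf_le_Limsup) simp
  also have "\<dots> \<le> C"
    using assms(2) by (rule Limsup_bounded)
  finally show ?thesis .
qed

text \<open>The weak formulation of \<open>u = (S + \<epsilon>)\<^sup>-\<^sup>1 y\<close>, where \<open>S\<close> is the possibly unbounded operator of the
  form.\<close>

definition is_resolvent :: "real \<Rightarrow> 'h \<Rightarrow> 'h \<Rightarrow> bool" where
  "is_resolvent \<epsilon> y u \<longleftrightarrow> Q u < \<infinity> \<and>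
     (\<forall>v. Q v < \<infinity> \<longrightarrow> B u v + complex_of_real \<epsilon> * cinner u v = cinner y v)"

lemma is_resolvent_unique:
  assumes "\<epsilon> > 0" "is_resolvent \<epsilon> y u" "is_resolvent \<epsilon> y u'" shows "u = u'"
proof -
  let ?w = "u - u'"
  have fin: "Q u < \<infinity>" "Q u' < \<infinity>" using assms by (simp_all add: is_resolvent_def)
  then have w: "Q ?w < \<infinity>" by (rule finite_energy_diff)
  have "B u ?w + complex_of_real \<epsilon> * cinner u ?w = B u' ?w + complex_of_real \<epsilon> * cinner u' ?w"
    using assms(2,3) w by (simp add: is_resolvent_def)
  then have "B ?w ?w + complex_of_real \<epsilon> * cinner ?w ?w = 0"
    using fin w by (simp add: B_diff_left cinner_diff_left algebra_simps)
  then have "enn2real (Q ?w) + \<epsilon> * (norm ?w)\<^sup>2 = 0"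
    using w by (simp add: B_self cinner_self flip: of_real_power of_real_mult of_real_add)
  then show ?thesis
    using assms(1) by (simp add: add_nonneg_eq_0_iff)
qed

text \<open>The resolvent is the minimiser of \<open>v \<mapsto> Q v + \<epsilon> \<parallel>v\<parallel>\<^sup>2 - 2 Re \<langle>y, v\<rangle>\<close>.  Along a minimising sequence
  the first variation tends to zero, uniformly on energy balls.  Testing it on differences of
  members shows that the sequence is Cauchy for the energy, and closedness provides the limit.\<close>

lemma is_resolvent_exists:
  assumes \<epsilon>: "\<epsilon> > 0" shows "\<exists>u. is_resolvent \<epsilon> y u"
proof -
  \<comment> \<open>\<open>E\<close> is the real inner product \<open>Q + \<epsilon>\<close> on the form domain and \<open>J\<close> is the functional.\<close>
  define E where "E = (\<lambda>u v. Re (B u v) + \<epsilon> * Re (cinner u v))"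
  define J where "J = (\<lambda>v. E v v - 2 * Re (cinner y v))"
  have E_diff: "E (u - v) w = E u w - E v w" if "Q u < \<infinity>" "Q v < \<infinity>" "Q w < \<infinity>" for u v w
    using that by (simp add: E_def B_diff_left cinner_diff_left algebra_simps)
  have E_self: "E v v = enn2real (Q v) + \<epsilon> * (norm v)\<^sup>2" if "Q v < \<infinity>" for v
    using that by (simp add: E_def B_self Re_cinner_self)
  have E_nonneg: "E v v \<ge> 0" if "Q v < \<infinity>" for v
    using E_self[OF that] \<epsilon> by simp
  have E_expand: "E (u + t *\<^sub>R w) (u + t *\<^sub>R w) = E u u + 2 * E u w * t + E w w * t\<^sup>2"
    if "Q u < \<infinity>" "Q w < \<infinity>" for u w and t :: real
  proof -
    have tw: "Q (t *\<^sub>R w) < \<infinity>" using that(2) by (rule finite_energy_scaleR)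
    have 1: "Re (B u (t *\<^sub>R w)) = t * Re (B u w)"
      by (subst B_commute, subst (2) B_commute) (simp add: scaleR_scaleC B_scaleC_left)
    have 2: "enn2real (Q (t *\<^sub>R w)) = t\<^sup>2 * enn2real (Q w)"
      by (simp add: scaleR_scaleC energy_scaleC enn2real_mult)
    show ?thesis
      using energy_add_expand[OF that(1) tw] norm_add_sq[of u "t *\<^sub>R w"] 1 2
      unfolding E_self[OF finite_energy_add[OF that(1) tw]] E_self[OF that(1)] E_self[OF that(2)]
      by (simp add: E_def cinner_scaleR_right power_mult_distrib algebra_simps)
  qed
  have J_expand: "J (u + t *\<^sub>R w) = J u + 2 * (E u w - Re (cinner y w)) * t + E w w * t\<^sup>2"
    if "Q u < \<infinity>" "Q w < \<infinity>" for u w t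
    unfolding J_def E_expand[OF that] by (simp add: cinner_algebra algebra_simps)
  have J_bound: "- ((norm y)\<^sup>2 / \<epsilon>) \<le> J v" if "Q v < \<infinity>" for v
  proof -
    have "Re (cinner y v) \<le> norm y * norm v"
      using cauchy_schwarz[of y v] complex_Re_le_cmod[of "cinner y v"] by linarith
    moreover have "\<epsilon> * (norm v)\<^sup>2 - 2 * (norm y * norm v) + (norm y)\<^sup>2 / \<epsilon> \<ge> 0"
    proof -
      have "\<epsilon> * (norm v)\<^sup>2 - 2 * (norm y * norm v) + (norm y)\<^sup>2 / \<epsilon> = (\<epsilon> * norm v - norm y)\<^sup>2 / \<epsilon>"
        using \<epsilon> by (simp add: power2_diff power_mult_distrib add_divide_distrib
            diff_divide_distrib power2_eq_square[of \<epsilon>])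
      also have "\<dots> \<ge> 0" using \<epsilon> by (intro divide_nonneg_pos) simp_all
      finally show ?thesis .
    qed
    ultimately show ?thesis
      using E_self[OF that] enn2real_nonneg[of "Q v"] unfolding J_def by linarith
  qed
  define m where "m = Inf (J ` {v. Q v < \<infinity>})"
  have "Q 0 < \<infinity>" by simp
  then have ne: "J ` {v. Q v < \<infinity>} \<noteq> {}" by blast
  have bdd: "bdd_below (J ` {v. Q v < \<infinity>})"
    using J_bound by (intro bdd_belowI) auto
  have m: "m \<le> J v" if "Q v < \<infinity>" for v
    unfolding m_def using bdd that by (intro cInf_lower) auto
  have "\<exists>v. Q v < \<infinity> \<and> J v < m + 1 / Suc n" for n
    using cInf_lessD[OF ne, of "m + 1 / Suc n"] unfolding m_def by auto
  then obtain v where v: "\<And>n. Q (v n) < \<infinity>" "\<And>n. J (v n) < m + 1 / Suc n"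
    by metis
  \<comment> \<open>Half of the first variation of \<open>J\<close> at \<open>v n\<close> in the direction \<open>w\<close>.\<close>
  define L where "L = (\<lambda>n w. E (v n) w - Re (cinner y w))"
  have L_bound: "(L n w)\<^sup>2 \<le> E w w / Suc n" if w: "Q w < \<infinity>" for n w
  proof -
    have "(L n w)\<^sup>2 \<le> (J (v n) - m) * E w w"
    proof (rule quadratic_nonneg_discriminant)
      show "0 \<le> J (v n) - m + 2 * L n w * t + E w w * t\<^sup>2" for t
        using m[OF finite_energy_add[OF v(1)[of n] finite_energy_scaleR[OF w, of t]]]
        unfolding J_expand[OF v(1) w] L_def by simp
    qed (rule E_nonneg[OF w])
    also have "\<dots> \<le> (1 / Suc n) * E w w"
      using v(2)[of n] E_nonneg[OF w] by (intro mult_right_mono) simp_all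
    finally show ?thesis by simp
  qed
  have v_cauchy: "E (v n - v l) (v n - v l) \<le> 4 / Suc n" if "n \<le> l" for n l
  proof -
    let ?w = "v n - v l"
    have w: "Q ?w < \<infinity>" using v(1) by (intro finite_energy_diff)
    have "E ?w ?w = L n ?w - L l ?w"
      using v(1) w by (simp add: E_diff L_def)
    then have "(E ?w ?w)\<^sup>2 = (L n ?w - L l ?w)\<^sup>2" by simp
    also have "\<dots> \<le> 2 * (L n ?w)\<^sup>2 + 2 * (L l ?w)\<^sup>2"
      by (rule power2_diff_le)
    also have "\<dots> \<le> 2 * (E ?w ?w / Suc n) + 2 * (E ?w ?w / Suc l)"
      using L_bound[OF w] by (intro add_mono mult_left_mono) simp_all
    also have "E ?w ?w / Suc l \<le> E ?w ?w / Suc n"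
      using that E_nonneg[OF w] by (intro divide_left_mono) auto
    finally have *: "E ?w ?w * E ?w ?w \<le> (4 / Suc n) * E ?w ?w"
      by (simp add: power2_eq_square)
    show ?thesis
    proof (cases "E ?w ?w = 0")
      case False
      then have "E ?w ?w > 0" using E_nonneg[OF w] by simp
      with * show ?thesis by (rule mult_right_le_imp_le)
    qed simp
  qed
  have norm_bound: "(norm (v n - v l))\<^sup>2 \<le> 4 / \<epsilon> / Suc n" if "n \<le> l" for n l
  proof -
    have "\<epsilon> * (norm (v n - v l))\<^sup>2 \<le> 4 / Suc n"
      using v_cauchy[OF that] E_self[OF finite_energy_diff[OF v(1)[of n] v(1)[of l]]]
        enn2real_nonneg[of "Q (v n - v l)"] by linarith
    then have "(norm (v n - v l))\<^sup>2 \<le> 4 / Suc n / \<epsilon>"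
      using \<epsilon> by (simp only: pos_le_divide_eq mult.commute)
    then show ?thesis by (simp only: divide_divide_eq_left mult.commute)
  qed
  have to0: "(\<lambda>n. c / real (Suc n)) \<longlonglongrightarrow> 0" for c
    using tendsto_mult_right_zero[OF LIMSEQ_inverse_real_of_nat, of c] by (simp add: field_simps)
  have "Cauchy v"
  proof (rule metric_CauchyI)
    fix e :: real assume e: "e > 0"
    have "\<forall>\<^sub>F n in sequentially. 4 / \<epsilon> / real (Suc n) < (e / 2)\<^sup>2"
      using to0[of "4 / \<epsilon>"] e by (intro order_tendstoD(2)) auto
    then obtain M where M: "4 / \<epsilon> / real (Suc M) < (e / 2)\<^sup>2"
      by (auto simp: eventually_sequentially)
    have half: "norm (v M - v l) < e / 2" if "M \<le> l" for l
      using norm_bound[OF that] M e by (intro power2_less_imp_less[of _ "e / 2"]) auto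
    have "dist (v i) (v j) < e" if "M \<le> i" "M \<le> j" for i j
      using half[OF that(1)] half[OF that(2)] dist_triangle_half_r[of "v M" "v i" e "v j"]
      by (simp add: dist_norm)
    then show "\<exists>M. \<forall>m\<ge>M. \<forall>n\<ge>M. dist (v m) (v n) < e" by blast
  qed
  then obtain u where u: "v \<longlonglongrightarrow> u"
    using Cauchy_convergent convergentD by blast
  have vu: "(\<lambda>l. v n - v l) \<longlonglongrightarrow> v n - u" for n
    by (intro tendsto_intros u)
  have Q_vu: "Q (v n - u) \<le> ennreal (4 / Suc n)" for n
  proof (rule energy_le_of_tendsto[OF vu])
    have "Q (v n - v l) \<le> ennreal (4 / Suc n)" if "n \<le> l" for l
    proof -
      have fin: "Q (v n - v l) < \<infinity>" using v(1) by (intro finite_energy_diff)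
      have "enn2real (Q (v n - v l)) \<le> 4 / Suc n"
        using v_cauchy[OF that] E_self[OF fin] \<epsilon> zero_le_power2[of "norm (v n - v l)"]
        by (smt (verit) mult_nonneg_nonneg)
      then show ?thesis using fin
        by (subst energy_eq_ennreal) (simp_all add: ennreal_leI)
    qed
    then show "\<forall>\<^sub>F l in sequentially. Q (v n - v l) \<le> ennreal (4 / Suc n)"
      unfolding eventually_sequentially by blast
  qed
  then have fin_vu: "Q (v n - u) < \<infinity>" for n
    using order_le_less_trans ennreal_less_top infinity_ennreal_def by metis
  have fin_u: "Q u < \<infinity>"
    using finite_energy_diff[OF v(1)[of 0] fin_vu[of 0]] by simp
  have E_vu: "E (v n - u) (v n - u) \<le> 8 / Suc n" for n
  proof -
    have "enn2real (Q (v n - u)) \<le> 4 / Suc n"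
      using Q_vu[of n] enn2real_leI by auto
    moreover have "(norm (v n - u))\<^sup>2 \<le> 4 / \<epsilon> / Suc n"
      using tendsto_power[OF tendsto_norm[OF vu[of n]], of 2]
      by (rule LIMSEQ_le_const2) (use norm_bound in blast)
    then have "\<epsilon> * (norm (v n - u))\<^sup>2 \<le> \<epsilon> * (4 / \<epsilon> / Suc n)"
      using \<epsilon> by (intro mult_left_mono) simp_all
    then have "\<epsilon> * (norm (v n - u))\<^sup>2 \<le> 4 / Suc n" using \<epsilon> by simp
    ultimately show ?thesis using E_self[OF fin_vu[of n]] by simp
  qed
  have Re_eq: "E u w = Re (cinner y w)" if w: "Q w < \<infinity>" for w
  proof -
    define l where "l = E u w - Re (cinner y w)"
    have "l\<^sup>2 \<le> 18 * E w w / Suc n" for n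
    proof -
      have "(E (v n - u) w)\<^sup>2 \<le> E (v n - u) (v n - u) * E w w"
      proof (rule quadratic_nonneg_discriminant)
        show "0 \<le> E (v n - u) (v n - u) + 2 * E (v n - u) w * t + E w w * t\<^sup>2" for t
          using E_nonneg[OF finite_energy_add[OF fin_vu finite_energy_scaleR[OF w, of t]]]
          by (simp add: E_expand[OF fin_vu w])
      qed (rule E_nonneg[OF w])
      also have "\<dots> \<le> 8 / Suc n * E w w"
        using E_vu E_nonneg[OF w] by (rule mult_right_mono)
      finally have 1: "(E (v n - u) w)\<^sup>2 \<le> 8 * (E w w / Suc n)" by simp
      have "l = L n w - E (v n - u) w"
        using v(1) fin_u w by (simp add: l_def L_def E_diff)
      then have "l\<^sup>2 \<le> 2 * (L n w)\<^sup>2 + 2 * (E (v n - u) w)\<^sup>2"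
        by (simp only: power2_diff_le)
      then show ?thesis using 1 L_bound[OF w, of n] by simp
    qed
    then have "l\<^sup>2 \<le> 0"
      using LIMSEQ_le_const[OF to0[of "18 * E w w"], of "l\<^sup>2"] by blast
    then show ?thesis by (simp add: l_def)
  qed
  have "is_resolvent \<epsilon> y u"
    unfolding is_resolvent_def
  proof (intro conjI allI impI fin_u)
    fix w assume w: "Q w < \<infinity>"
    let ?d = "B u w + complex_of_real \<epsilon> * cinner u w - cinner y w"
    have "Re ?d = 0" using Re_eq[OF w] by (simp add: E_def)
    \<comment> \<open>The real part of the equation for \<open>\<i> w\<close> is its imaginary part for \<open>w\<close>.\<close>
    moreover have "Im ?d = 0"
    proof -
      have "B u (\<i> *\<^sub>C w) = - \<i> * B u w"
        by (subst B_commute, subst (2) B_commute) (simp add: B_scaleC_left)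
      then show ?thesis
        using Re_eq[OF finite_energy_scaleC[OF w, of \<i>]] by (simp add: E_def cinner_scaleC_right)
    qed
    ultimately have "?d = 0" by (simp add: complex_eq_iff)
    then show "B u w + complex_of_real \<epsilon> * cinner u w = cinner y w" by simp
  qed
  then show ?thesis by blast
qed

definition resolvent :: "real \<Rightarrow> 'h \<Rightarrow> 'h" where
  "resolvent \<epsilon> y = (THE u. is_resolvent \<epsilon> y u)"

lemma resolvent: "\<epsilon> > 0 \<Longrightarrow> is_resolvent \<epsilon> y (resolvent \<epsilon> y)"
  unfolding resolvent_def by (rule theI') (use is_resolvent_exists is_resolvent_unique in blast)

lemma resolvent_eqI: "\<epsilon> > 0 \<Longrightarrow> is_resolvent \<epsilon> y u \<Longrightarrow> resolvent \<epsilon> y = u"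
  using resolvent is_resolvent_unique by blast

lemma resolvent_finite: "\<epsilon> > 0 \<Longrightarrow> Q (resolvent \<epsilon> y) < \<infinity>"
  using resolvent by (simp add: is_resolvent_def)

lemma resolvent_eq:
  "\<epsilon> > 0 \<Longrightarrow> Q v < \<infinity> \<Longrightarrow>
     B (resolvent \<epsilon> y) v + complex_of_real \<epsilon> * cinner (resolvent \<epsilon> y) v = cinner y v"
  using resolvent by (simp add: is_resolvent_def)

lemma resolvent_energy:
  assumes "\<epsilon> > 0"
  shows "complex_of_real (enn2real (Q (resolvent \<epsilon> y)) + \<epsilon> * (norm (resolvent \<epsilon> y))\<^sup>2)
           = cinner y (resolvent \<epsilon> y)"
  using resolvent_eq[OF assms resolvent_finite[OF assms], of y y]
  by (simp add: B_self[OF resolvent_finite[OF assms]] cinner_self)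

lemma resolvent_norm:
  assumes "\<epsilon> > 0" shows "\<epsilon> * norm (resolvent \<epsilon> y) \<le> norm y"
proof (cases "resolvent \<epsilon> y = 0")
  case False
  let ?u = "resolvent \<epsilon> y"
  have "enn2real (Q ?u) + \<epsilon> * (norm ?u)\<^sup>2 = Re (cinner y ?u)"
    using arg_cong[OF resolvent_energy[OF assms, of y], of Re] by simp
  also have "\<dots> \<le> norm y * norm ?u"
    using cauchy_schwarz[of y ?u] complex_Re_le_cmod[of "cinner y ?u"] by linarith
  finally have "\<epsilon> * norm ?u * norm ?u \<le> norm y * norm ?u"
    using enn2real_nonneg[of "Q ?u"] unfolding power2_eq_square mult.assoc by linarith
  then show ?thesis using False by (simp add: mult_le_cancel_right)
qed simp

lemma resolvent_symmetric:
  assumes "\<epsilon> > 0" shows "cinner (resolvent \<epsilon> y) z = cinner y (resolvent \<epsilon> z)"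
proof -
  let ?u = "resolvent \<epsilon> y" and ?w = "resolvent \<epsilon> z"
  have "cinner ?u z = cnj (cinner z ?u)" by (rule cinner_commute)
  also have "\<dots> = cnj (B ?w ?u + complex_of_real \<epsilon> * cinner ?w ?u)"
    using resolvent_eq[OF assms resolvent_finite[OF assms]] by simp
  also have "\<dots> = B ?u ?w + complex_of_real \<epsilon> * cinner ?u ?w"
    using B_commute[of ?u ?w] cinner_commute[of ?u ?w] by simp
  also have "\<dots> = cinner y ?w"
    using resolvent_eq[OF assms resolvent_finite[OF assms]] by simp
  finally show ?thesis .
qed

lemma resolvent_bounded_symmetric:
  assumes "\<epsilon> > 0" shows "bounded_symmetric (resolvent \<epsilon>)"
  unfolding bounded_symmetric_def
proof (intro conjI exI allI)
  show "clinear (resolvent \<epsilon>)"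
  proof unfold_locales
    show "resolvent \<epsilon> (x + y) = resolvent \<epsilon> x + resolvent \<epsilon> y" for x y
      by (rule cinner_left_ext) (simp add: resolvent_symmetric[OF assms] cinner_add_left)
    show "resolvent \<epsilon> (c *\<^sub>C x) = c *\<^sub>C resolvent \<epsilon> x" for c x
      by (rule cinner_left_ext) (simp add: resolvent_symmetric[OF assms] cinner_scaleC_left)
  qed
  show "norm (resolvent \<epsilon> v) \<le> inverse \<epsilon> * norm v" for v
    using resolvent_norm[OF assms, of v] assms by (simp add: field_simps)
qed (rule resolvent_symmetric[OF assms])

text \<open>By polarisation, a unitary that preserves \<open>Q\<close> preserves everything that characterises the
  resolvent.\<close>

lemma resolvent_commute:
  assumes "\<epsilon> > 0" and U: "unitary_operator U" and inv: "\<And>v. Q (U v) = Q v"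
  shows "U (resolvent \<epsilon> y) = resolvent \<epsilon> (U y)"
proof (rule resolvent_eqI[OF assms(1), symmetric])
  let ?u = "resolvent \<epsilon> y"
  interpret U: Vector_Spaces.linear scaleC scaleC U by (rule unitary_operator_linear[OF U])
  have Re_B: "Re (B (U u) (U v)) = Re (B u v)" if "Q u < \<infinity>" "Q v < \<infinity>" for u v
    using energy_polarisation[OF that] energy_polarisation[of "U u" "U v"] that
    by (simp add: inv flip: U.add U.diff)
  have B_U: "B (U u) (U v) = B u v" if "Q u < \<infinity>" "Q v < \<infinity>" for u v
  proof (rule complex_eqI)
    have "Re (B (U (\<i> *\<^sub>C u)) (U v)) = Re (B (\<i> *\<^sub>C u) v)"
      using that by (intro Re_B finite_energy_scaleC)
    then show "Im (B (U u) (U v)) = Im (B u v)"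
      by (simp add: U.scale B_scaleC_left)
  qed (rule Re_B[OF that])
  show "is_resolvent \<epsilon> (U y) (U ?u)"
    unfolding is_resolvent_def
  proof (intro conjI allI impI)
    show "Q (U ?u) < \<infinity>" using resolvent_finite[OF assms(1)] by (simp add: inv)
    fix v assume v: "Q v < \<infinity>"
    obtain w where w: "v = U w" using U unfolding unitary_operator_def surj_def by blast
    have isom: "cinner (U a) (U b) = cinner a b" for a b
      using U by (simp add: unitary_operator_def)
    have "Q w < \<infinity>" using v by (simp add: w inv)
    then show "B (U ?u) v + complex_of_real \<epsilon> * cinner (U ?u) v = cinner (U y) v"
      unfolding w isom B_U[OF resolvent_finite[OF assms(1)] \<open>Q w < \<infinity>\<close>]
      by (rule resolvent_eq[OF assms(1)])
  qed
qed

text \<open>As \<open>\<epsilon> \<rightarrow> 0\<close>, the operators \<open>\<epsilon> (S + \<epsilon>)\<^sup>-\<^sup>1\<close> tend weakly to the projection to the null space of the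
  form.  A null vector of the form is orthogonal to the family, so completeness makes the limit zero.
  Concretely, \<open>\<epsilon> (S + \<epsilon>)\<^sup>-\<^sup>1 w\<close> is bounded and its energy is at most \<open>\<epsilon> \<parallel>w\<parallel>\<^sup>2\<close>.\<close>

lemma resolvent_weakly_null:
  fixes \<epsilon> :: "nat \<Rightarrow> real"
  assumes \<epsilon>: "\<And>n. \<epsilon> n > 0" "\<epsilon> \<longlonglongrightarrow> 0"
    and bound: "\<And>y f. y \<in> S \<Longrightarrow> sqcoeff f (k y) \<le> Q f"
    and complete: "complete_family (k ` S)"
  shows "(\<lambda>n. \<epsilon> n * Re (cinner (resolvent (\<epsilon> n) w) z)) \<longlonglongrightarrow> 0"
proof -
  let ?u = "\<lambda>n. resolvent (\<epsilon> n) w"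
  have "(\<lambda>n. cinner (\<epsilon> n *\<^sub>R ?u n) z) \<longlonglongrightarrow> 0"
  proof (rule weakly_null_on_complete_family[OF _ _ complete])
    show "norm (\<epsilon> n *\<^sub>R ?u n) \<le> norm w" for n
      using resolvent_norm[OF \<epsilon>(1), of n w] \<epsilon>(1)[of n] by simp
    fix z' assume "z' \<in> k ` S"
    then obtain y where y: "y \<in> S" "z' = k y" by blast
    have le: "(cmod (cinner (\<epsilon> n *\<^sub>R ?u n) z'))\<^sup>2 \<le> \<epsilon> n * (norm w)\<^sup>2" for n
    proof -
      have pos: "\<epsilon> n > 0" by (rule \<epsilon>)
      have fin: "Q (?u n) < \<infinity>" by (rule resolvent_finite[OF pos])
      have "sqcoeff (?u n) z' \<le> ennreal (enn2real (Q (?u n)))"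
        using bound[OF y(1), of "?u n"] fin by (simp add: y(2))
      then have "(cmod (cinner (?u n) z'))\<^sup>2 \<le> enn2real (Q (?u n))"
        by (simp add: ennreal_le_iff)
      also have "\<dots> \<le> Re (cinner w (?u n))"
        using arg_cong[OF resolvent_energy[OF pos, of w], of Re] pos zero_le_power2[of "norm (?u n)"]
        by (smt (verit) Re_complex_of_real mult_nonneg_nonneg)
      also have "\<dots> \<le> norm w * norm (?u n)"
        using cauchy_schwarz[of w "?u n"] complex_Re_le_cmod[of "cinner w (?u n)"] by linarith
      finally have 1: "(cmod (cinner (?u n) z'))\<^sup>2 \<le> norm w * norm (?u n)" .
      have "(cmod (cinner (\<epsilon> n *\<^sub>R ?u n) z'))\<^sup>2 = (\<epsilon> n)\<^sup>2 * (cmod (cinner (?u n) z'))\<^sup>2"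
        by (simp add: cinner_scaleR_left norm_mult power_mult_distrib)
      also have "\<dots> \<le> (\<epsilon> n)\<^sup>2 * (norm w * norm (?u n))"
        using 1 by (intro mult_left_mono) simp_all
      also have "\<dots> = \<epsilon> n * norm w * (\<epsilon> n * norm (?u n))"
        by (simp add: power2_eq_square)
      also have "\<dots> \<le> \<epsilon> n * norm w * norm w"
        using resolvent_norm[OF pos, of w] pos by (intro mult_left_mono) simp_all
      finally show ?thesis by (simp add: power2_eq_square mult.assoc)
    qed
    have "(\<lambda>n. (cmod (cinner (\<epsilon> n *\<^sub>R ?u n) z'))\<^sup>2) \<longlonglongrightarrow> 0"
      by (rule tendsto_sandwich[OF _ _ tendsto_const tendsto_mult_left_zero[OF \<epsilon>(2), of "(norm w)\<^sup>2"]])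
         (use le in simp_all)
    then have "(\<lambda>n. sqrt ((cmod (cinner (\<epsilon> n *\<^sub>R ?u n) z'))\<^sup>2)) \<longlonglongrightarrow> sqrt 0"
      by (rule tendsto_real_sqrt)
    then show "(\<lambda>n. cinner (\<epsilon> n *\<^sub>R ?u n) z') \<longlonglongrightarrow> 0"
      by (simp add: tendsto_norm_zero_iff)
  qed
  from tendsto_Re[OF this] show ?thesis
    by (simp add: cinner_scaleR_left)
qed

end

section \<open>Invariant measures on groups with a uniform lattice\<close>

lemma space_borel_of [simp]: "space (borel_of T) = topspace T"
  unfolding borel_of_def by (rule space_measure_of) (auto dest: openin_subset)

lemma openin_borel_of: "openin T U \<Longrightarrow> U \<in> sets (borel_of T)"
  unfolding borel_of_def by (subst sets_measure_of) (auto dest: openin_subset)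

lemma continuous_map_borel_of:
  assumes "continuous_map S T f" shows "f \<in> borel_of S \<rightarrow>\<^sub>M borel_of T"
  unfolding borel_of_def[of T]
proof (rule measurable_measure_of)
  show "f \<in> space (borel_of S) \<rightarrow> topspace T"
    using assms continuous_map_image_subset_topspace by fastforce
  fix U assume "U \<in> {U. openin T U}"
  then have "openin S {x \<in> topspace S. f x \<in> U}"
    using assms by (simp add: continuous_map_def)
  moreover have "f -` U \<inter> space (borel_of S) = {x \<in> topspace S. f x \<in> U}" by auto
  ultimately show "f -` U \<inter> space (borel_of S) \<in> sets (borel_of S)"
    using openin_borel_of by metis
qed (auto dest: openin_subset)

text \<open>An open subset of the product is a union of rectangles from the countable bases.  This is
  what makes the group multiplication jointly Borel measurable.\<close>

lemma openin_prod_borel_of: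
  assumes "second_countable S" "second_countable T" "openin (prod_topology S T) U"
  shows "U \<in> sets (borel_of S \<Otimes>\<^sub>M borel_of T)"
proof -
  obtain A where A: "countable A" "\<And>V. V \<in> A \<Longrightarrow> openin S V"
    "\<And>U x. openin S U \<Longrightarrow> x \<in> U \<Longrightarrow> \<exists>V\<in>A. x \<in> V \<and> V \<subseteq> U"
    using assms(1) unfolding second_countable_def by metis
  obtain B where B: "countable B" "\<And>V. V \<in> B \<Longrightarrow> openin T V"
    "\<And>U x. openin T U \<Longrightarrow> x \<in> U \<Longrightarrow> \<exists>V\<in>B. x \<in> V \<and> V \<subseteq> U"
    using assms(2) unfolding second_countable_def by metis
  let ?R = "{(V, W) \<in> A \<times> B. V \<times> W \<subseteq> U}"
  have "U = (\<Union>(V, W)\<in>?R. V \<times> W)"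
  proof (intro subset_antisym subsetI)
    fix z assume z: "z \<in> U"
    then obtain V W where VW: "openin S V" "openin T W" "z \<in> V \<times> W" "V \<times> W \<subseteq> U"
      using assms(3) unfolding openin_prod_topology_alt by (metis mem_Sigma_iff prod.collapse)
    obtain V' W' where "V' \<in> A" "fst z \<in> V'" "V' \<subseteq> V" "W' \<in> B" "snd z \<in> W'" "W' \<subseteq> W"
      using A(3)[OF VW(1)] B(3)[OF VW(2)] VW(3) by (metis mem_Times_iff)
    with VW(4) show "z \<in> (\<Union>(V, W)\<in>?R. V \<times> W)"
      by (intro UN_I[of "(V', W')"]) (auto simp: mem_Times_iff)
  qed auto
  moreover have "countable ?R"
    by (rule countable_subset[of _ "A \<times> B"]) (use A(1) B(1) in auto)
  then have "(\<Union>(V, W)\<in>?R. V \<times> W) \<in> sets (borel_of S \<Otimes>\<^sub>M borel_of T)"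
    using A(2) B(2) by (intro sets.countable_UN') (auto intro!: pair_measureI openin_borel_of)
  ultimately show ?thesis by simp
qed

locale second_countable_group = group G for G :: "'g monoid" (structure) +
  fixes T :: "'g topology"
  assumes topological: "topological_group G T" and second_countable: "second_countable T"
begin

lemma topspace [simp]: "topspace T = carrier G"
  using topological by (simp add: topological_group_def)

lemma continuous_mult: "continuous_map (prod_topology T T) T (\<lambda>(x, y). x \<otimes> y)"
  using topological by (simp add: topological_group_def)

lemma continuous_inv: "continuous_map T T (\<lambda>x. inv x)"
  using topological by (simp add: topological_group_def)

lemma continuous_map_mult:
  assumes "continuous_map S T f" "continuous_map S T g"
  shows "continuous_map S T (\<lambda>x. f x \<otimes> g x)"
  using continuous_map_compose[OF continuous_map_pairedI[OF assms] continuous_mult]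
  by (simp add: o_def)

lemma continuous_map_inv:
  assumes "continuous_map S T f" shows "continuous_map S T (\<lambda>x. inv (f x))"
  using continuous_map_compose[OF assms continuous_inv] by (simp add: o_def)

lemma continuous_map_translate:
  assumes "a \<in> carrier G"
  shows "continuous_map T T (\<lambda>x. a \<otimes> x)" "continuous_map T T (\<lambda>x. x \<otimes> a)"
  using assms by (auto intro!: continuous_map_mult)

lemma left_translate_image:
  assumes "a \<in> carrier G" "B \<subseteq> carrier G"
  shows "(\<lambda>x. a \<otimes> x) ` B = {y \<in> carrier G. inv a \<otimes> y \<in> B}"
proof (intro subset_antisym subsetI)
  fix y assume "y \<in> {y \<in> carrier G. inv a \<otimes> y \<in> B}"
  then have "y = a \<otimes> (inv a \<otimes> y)" using assms by (simp add: m_assoc[symmetric])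
  then show "y \<in> (\<lambda>x. a \<otimes> x) ` B" using \<open>y \<in> _\<close> by blast
qed (use assms in \<open>auto simp: m_assoc[symmetric]\<close>)

lemma right_translate_image:
  assumes "a \<in> carrier G" "B \<subseteq> carrier G"
  shows "(\<lambda>x. x \<otimes> a) ` B = {y \<in> carrier G. y \<otimes> inv a \<in> B}"
proof (intro subset_antisym subsetI)
  fix y assume "y \<in> {y \<in> carrier G. y \<otimes> inv a \<in> B}"
  then have "y = (y \<otimes> inv a) \<otimes> a" using assms by (simp add: m_assoc)
  then show "y \<in> (\<lambda>x. x \<otimes> a) ` B" using \<open>y \<in> _\<close> by blast
qed (use assms in \<open>auto simp: m_assoc\<close>)

lemma openin_left_translate:
  assumes "a \<in> carrier G" "openin T U" shows "openin T ((\<lambda>x. a \<otimes> x) ` U)"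
  using openin_continuous_map_preimage[OF continuous_map_translate(1) assms(2), of "inv a"]
    left_translate_image[OF assms(1) openin_subset[OF assms(2), simplified]] assms(1) by simp

lemma openin_right_translate:
  assumes "a \<in> carrier G" "openin T U" shows "openin T ((\<lambda>x. x \<otimes> a) ` U)"
  using openin_continuous_map_preimage[OF continuous_map_translate(2) assms(2), of "inv a"]
    right_translate_image[OF assms(1) openin_subset[OF assms(2), simplified]] assms(1) by simp

lemma l_coset_eq_iff:
  assumes H: "subgroup H G" and xy: "x \<in> carrier G" "y \<in> carrier G"
  shows "x <#\<^bsub>G\<^esub> H = y <#\<^bsub>G\<^esub> H \<longleftrightarrow> (\<exists>h\<in>H. x = y \<otimes> h)"
proof
  assume "x <#\<^bsub>G\<^esub> H = y <#\<^bsub>G\<^esub> H"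
  then have "x \<in> y <#\<^bsub>G\<^esub> H" using lcos_self[OF xy(1) H] by simp
  then show "\<exists>h\<in>H. x = y \<otimes> h" by (auto simp: l_coset_def)
next
  assume "\<exists>h\<in>H. x = y \<otimes> h"
  then have "x \<in> y <#\<^bsub>G\<^esub> H" by (auto simp: l_coset_def)
  then show "x <#\<^bsub>G\<^esub> H = y <#\<^bsub>G\<^esub> H"
    by (rule l_repr_independence[OF _ xy(2) H, symmetric])
qed

lemma l_coset_saturation:
  assumes H: "subgroup H G" and U: "U \<subseteq> carrier G"
  shows "{y \<in> carrier G. y <#\<^bsub>G\<^esub> H \<in> (\<lambda>x. x <#\<^bsub>G\<^esub> H) ` U} = (\<Union>h\<in>H. (\<lambda>y. y \<otimes> h) ` U)"
proof (intro subset_antisym subsetI)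
  fix y assume "y \<in> {y \<in> carrier G. y <#\<^bsub>G\<^esub> H \<in> (\<lambda>x. x <#\<^bsub>G\<^esub> H) ` U}"
  then obtain u where u: "y \<in> carrier G" "u \<in> U" "y <#\<^bsub>G\<^esub> H = u <#\<^bsub>G\<^esub> H" by auto
  then obtain h where "h \<in> H" "y = u \<otimes> h"
    using l_coset_eq_iff[OF H u(1), of u] U by auto
  then show "y \<in> (\<Union>h\<in>H. (\<lambda>y. y \<otimes> h) ` U)" using u(2) by auto
next
  fix y assume "y \<in> (\<Union>h\<in>H. (\<lambda>y. y \<otimes> h) ` U)"
  then obtain u h where "u \<in> U" "h \<in> H" "y = u \<otimes> h" by auto
  then show "y \<in> {y \<in> carrier G. y <#\<^bsub>G\<^esub> H \<in> (\<lambda>x. x <#\<^bsub>G\<^esub> H) ` U}"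
    using U l_coset_eq_iff[OF H, of y u] subgroup.mem_carrier[OF H, of h] by auto
qed

lemma openin_saturation:
  assumes H: "subgroup H G" and U: "openin T U"
  shows "openin T (\<Union>h\<in>H. (\<lambda>y. y \<otimes> h) ` U)"
  using openin_right_translate[OF _ U] subgroup.mem_carrier[OF H]
  by (intro openin_Union) auto

lemma topspace_quotient: "topspace (quotient_topology T (\<lambda>x. x <#\<^bsub>G\<^esub> H)) = (\<lambda>x. x <#\<^bsub>G\<^esub> H) ` carrier G"
  using quotient_map_quotient_topology[of T "\<lambda>x. x <#\<^bsub>G\<^esub> H"] by (simp add: quotient_map_def)

lemma open_map_quotient:
  assumes H: "subgroup H G"
  shows "open_map T (quotient_topology T (\<lambda>x. x <#\<^bsub>G\<^esub> H)) (\<lambda>x. x <#\<^bsub>G\<^esub> H)"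
  unfolding open_map_def openin_quotient_topology
proof (intro allI impI conjI)
  fix U assume U: "openin T U"
  then have UG: "U \<subseteq> carrier G" using openin_subset by fastforce
  then show "(\<lambda>x. x <#\<^bsub>G\<^esub> H) ` U \<subseteq> (\<lambda>x. x <#\<^bsub>G\<^esub> H) ` topspace T" by auto
  show "openin T {x \<in> topspace T. x <#\<^bsub>G\<^esub> H \<in> (\<lambda>x. x <#\<^bsub>G\<^esub> H) ` U}"
    unfolding topspace l_coset_saturation[OF H UG] by (rule openin_saturation[OF H U])
qed

lemma measurable_mult [measurable (raw)]:
  assumes "f \<in> M \<rightarrow>\<^sub>M borel_of T" "g \<in> M \<rightarrow>\<^sub>M borel_of T"
  shows "(\<lambda>x. f x \<otimes> g x) \<in> M \<rightarrow>\<^sub>M borel_of T"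
proof -
  have "(\<lambda>(x, y). x \<otimes> y) \<in> borel_of T \<Otimes>\<^sub>M borel_of T \<rightarrow>\<^sub>M borel_of T"
    unfolding borel_of_def[of T]
  proof (rule measurable_measure_of, fold borel_of_def)
    show "(\<lambda>(x, y). x \<otimes> y) \<in> space (borel_of T \<Otimes>\<^sub>M borel_of T) \<rightarrow> topspace T"
      by (auto simp: space_pair_measure)
    fix U assume "U \<in> {U. openin T U}"
    then have "openin (prod_topology T T) {z \<in> topspace (prod_topology T T). (\<lambda>(x, y). x \<otimes> y) z \<in> U}"
      by (intro openin_continuous_map_preimage[OF continuous_mult]) simp
    from openin_prod_borel_of[OF second_countable second_countable this]
    show "(\<lambda>(x, y). x \<otimes> y) -` U \<inter> space (borel_of T \<Otimes>\<^sub>M borel_of T) \<in> sets (borel_of T \<Otimes>\<^sub>M borel_of T)"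
      by (simp add: space_pair_measure vimage_def Int_def conj_commute)
  qed (use openin_subset in fastforce)
  from measurable_compose[OF measurable_Pair[OF assms] this] show ?thesis by simp
qed

lemma measurable_inv [measurable (raw)]:
  assumes "f \<in> M \<rightarrow>\<^sub>M borel_of T" shows "(\<lambda>x. inv (f x)) \<in> M \<rightarrow>\<^sub>M borel_of T"
  using measurable_compose[OF assms continuous_map_borel_of[OF continuous_inv]] .

lemma countable_translates_cover:
  assumes "openin T U" "U \<noteq> {}"
  obtains A where "countable A" "A \<subseteq> carrier G" "(\<Union>a\<in>A. (\<lambda>x. a \<otimes> x) ` U) = carrier G"
proof -
  have U: "U \<subseteq> carrier G" using openin_subset[OF assms(1)] by simp
  let ?\<U> = "(\<lambda>a. (\<lambda>x. a \<otimes> x) ` U) ` carrier G"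
  have sub: "\<Union>?\<U> \<subseteq> carrier G" using U by auto
  have "carrier G \<subseteq> \<Union>?\<U>"
  proof
    fix y assume y: "y \<in> carrier G"
    obtain u where u: "u \<in> U" using assms(2) by blast
    then have "y = (y \<otimes> inv u) \<otimes> u" using U y by (auto simp: m_assoc)
    then show "y \<in> \<Union>?\<U>" using u y U by (intro UnionI[of "(\<lambda>x. (y \<otimes> inv u) \<otimes> x) ` U"]) auto
  qed
  with sub have "\<Union>?\<U> = topspace T" by auto
  moreover have "Lindelof_space T" using second_countable by (rule second_countable_imp_Lindelof_space)
  ultimately obtain \<V> where "countable \<V>" "\<V> \<subseteq> ?\<U>" "\<Union>\<V> = topspace T"
    using openin_left_translate[OF _ assms(1)] unfolding Lindelof_space_def by (metis (no_types, lifting) imageE)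
  moreover from this obtain A where "countable A" "A \<subseteq> carrier G" "\<V> = (\<lambda>a. (\<lambda>x. a \<otimes> x) ` U) ` A"
    using countable_subset_image by metis
  ultimately show thesis using that by auto
qed

end

text \<open>Finiteness near the identity makes the measure sigma-finite, since countably many translates of a
  neighbourhood cover the group.\<close>

locale haar = second_countable_group G T for G :: "'g monoid" (structure) and T +
  fixes \<mu> :: "'g measure"
  assumes sets_haar [measurable_cong]: "sets \<mu> = sets (borel_of T)"
    and emeasure_left_translate:
      "\<And>a B. a \<in> carrier G \<Longrightarrow> B \<in> sets \<mu> \<Longrightarrow> emeasure \<mu> ((\<lambda>x. a \<otimes> x) ` B) = emeasure \<mu> B"
    and nonzero: "emeasure \<mu> (space \<mu>) \<noteq> 0"
    and locally_finite: "\<exists>U. openin T U \<and> \<one> \<in> U \<and> emeasure \<mu> U < \<infinity>"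
begin

lemma space_haar [simp]: "space \<mu> = carrier G"
  using sets_eq_imp_space_eq[OF sets_haar] by simp

lemma nn_integral_left_translate:
  assumes [measurable]: "\<phi> \<in> borel_measurable (borel_of T)" and a: "a \<in> carrier G"
  shows "(\<integral>\<^sup>+ x. \<phi> (a \<otimes> x) \<partial>\<mu>) = (\<integral>\<^sup>+ x. \<phi> x \<partial>\<mu>)"
proof -
  have [measurable]: "a \<in> space (borel_of T)" using a by simp
  have m: "(\<lambda>x. a \<otimes> x) \<in> \<mu> \<rightarrow>\<^sub>M \<mu>" by measurable
  have "distr \<mu> \<mu> (\<lambda>x. a \<otimes> x) = \<mu>"
  proof (rule measure_eqI)
    fix B assume B: "B \<in> sets (distr \<mu> \<mu> (\<lambda>x. a \<otimes> x))"
    then have "B \<in> sets \<mu>" by simp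
    then have "B \<subseteq> carrier G" using sets.sets_into_space by fastforce
    then have "(\<lambda>x. a \<otimes> x) -` B \<inter> space \<mu> = (\<lambda>x. inv a \<otimes> x) ` B"
      using left_translate_image[of "inv a" B] a by auto
    then show "emeasure (distr \<mu> \<mu> (\<lambda>x. a \<otimes> x)) B = emeasure \<mu> B"
      using \<open>B \<in> sets \<mu>\<close> a by (simp add: emeasure_distr[OF m] emeasure_left_translate)
  qed simp
  then show ?thesis
    using nn_integral_distr[OF m, of \<phi>] by simp
qed

text \<open>The group is covered by countably many translates of a nonempty open set, and all of them have
  the same measure.\<close>

lemma open_positive:
  assumes "openin T U" "U \<noteq> {}" shows "emeasure \<mu> U > 0"
proof (rule ccontr)
  assume "\<not> emeasure \<mu> U > 0"
  then have 0: "emeasure \<mu> U = 0" by simp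
  obtain A where A: "countable A" "A \<subseteq> carrier G" "(\<Union>a\<in>A. (\<lambda>x. a \<otimes> x) ` U) = carrier G"
    using countable_translates_cover[OF assms] .
  have "(\<Union>a\<in>A. (\<lambda>x. a \<otimes> x) ` U) \<in> null_sets \<mu>"
  proof (rule null_sets_UN'[OF A(1)])
    fix a assume "a \<in> A"
    then show "(\<lambda>x. a \<otimes> x) ` U \<in> null_sets \<mu>"
      using A(2) 0 openin_left_translate[OF _ assms(1), of a] openin_borel_of[OF assms(1)]
      by (auto simp: null_sets_def sets_haar openin_borel_of emeasure_left_translate)
  qed
  then show False using nonzero A(3) by auto
qed

lemma open_nonempty_finite:
  obtains U where "openin T U" "\<one> \<in> U" "emeasure \<mu> U \<noteq> 0" "emeasure \<mu> U < \<infinity>"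
  using locally_finite open_positive by (metis empty_iff less_irrefl)

lemma sigma_finite: "sigma_finite_measure \<mu>"
proof -
  obtain U where U: "openin T U" "\<one> \<in> U" "emeasure \<mu> U < \<infinity>"
    using locally_finite by blast
  obtain A where A: "countable A" "A \<subseteq> carrier G" "(\<Union>a\<in>A. (\<lambda>x. a \<otimes> x) ` U) = carrier G"
    using countable_translates_cover[OF U(1)] U(2) by blast
  show ?thesis
  proof (standard, intro exI conjI)
    show "countable ((\<lambda>a. (\<lambda>x. a \<otimes> x) ` U) ` A)" using A(1) by simp
    show "(\<lambda>a. (\<lambda>x. a \<otimes> x) ` U) ` A \<subseteq> sets \<mu>"
      using A(2) openin_left_translate[OF _ U(1)] by (auto simp: sets_haar openin_borel_of)
    show "\<Union> ((\<lambda>a. (\<lambda>x. a \<otimes> x) ` U) ` A) = space \<mu>" using A(3) by simp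
    show "\<forall>B\<in>(\<lambda>a. (\<lambda>x. a \<otimes> x) ` U) ` A. emeasure \<mu> B \<noteq> \<infinity>"
      using A(2) U openin_borel_of[OF U(1)] by (auto simp: emeasure_left_translate sets_haar)
  qed
qed

text \<open>Weil's comparison of two left-invariant measures: substitute \<open>y \<mapsto> x y\<close> in one of the
  integrals, exchange their order, and substitute \<open>x \<mapsto> y x\<close> in the other one.\<close>

lemma haar_comparison:
  assumes \<nu>: "haar G T \<nu>"
    and [measurable]: "\<phi> \<in> borel_measurable (borel_of T)" "\<psi> \<in> borel_measurable (borel_of T)"
  shows "(\<integral>\<^sup>+ x. \<phi> x \<partial>\<mu>) * (\<integral>\<^sup>+ y. \<psi> (inv y) \<partial>\<nu>) = (\<integral>\<^sup>+ x. \<psi> x * (\<integral>\<^sup>+ y. \<phi> (y \<otimes> x) \<partial>\<nu>) \<partial>\<mu>)"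
proof -
  interpret L: haar G T \<nu> by fact
  note L.sets_haar [measurable_cong]
  interpret M: sigma_finite_measure \<mu> by (rule sigma_finite)
  interpret LS: sigma_finite_measure \<nu> by (rule L.sigma_finite)
  interpret P: pair_sigma_finite \<mu> \<nu> ..
  have "(\<integral>\<^sup>+ x. \<phi> x \<partial>\<mu>) * (\<integral>\<^sup>+ y. \<psi> (inv y) \<partial>\<nu>) = (\<integral>\<^sup>+ x. \<phi> x * (\<integral>\<^sup>+ y. \<psi> (inv y) \<partial>\<nu>) \<partial>\<mu>)"
    by (rule nn_integral_multc[symmetric]) measurable
  also have "\<dots> = (\<integral>\<^sup>+ x. (\<integral>\<^sup>+ y. \<phi> x * \<psi> (inv y \<otimes> x) \<partial>\<nu>) \<partial>\<mu>)"
  proof (rule nn_integral_cong)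
    fix x assume "x \<in> space \<mu>"
    then have x [simp]: "x \<in> carrier G" by simp
    then have [measurable]: "x \<in> space (borel_of T)" by simp
    have "(\<integral>\<^sup>+ y. \<psi> (inv y \<otimes> x) \<partial>\<nu>) = (\<integral>\<^sup>+ y. \<psi> (inv (x \<otimes> y) \<otimes> x) \<partial>\<nu>)"
      by (rule L.nn_integral_left_translate[symmetric, where \<phi> = "\<lambda>y. \<psi> (inv y \<otimes> x)"]) simp_all
    also have "\<dots> = (\<integral>\<^sup>+ y. \<psi> (inv y) \<partial>\<nu>)"
      by (rule nn_integral_cong) (simp add: inv_mult_group m_assoc)
    finally show "\<phi> x * (\<integral>\<^sup>+ y. \<psi> (inv y) \<partial>\<nu>) = (\<integral>\<^sup>+ y. \<phi> x * \<psi> (inv y \<otimes> x) \<partial>\<nu>)"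
      by (simp add: nn_integral_cmult)
  qed
  also have "\<dots> = (\<integral>\<^sup>+ y. (\<integral>\<^sup>+ x. \<phi> x * \<psi> (inv y \<otimes> x) \<partial>\<mu>) \<partial>\<nu>)"
    by (rule P.Fubini'[symmetric]) measurable
  also have "\<dots> = (\<integral>\<^sup>+ y. (\<integral>\<^sup>+ x. \<phi> (y \<otimes> x) * \<psi> x \<partial>\<mu>) \<partial>\<nu>)"
  proof (rule nn_integral_cong)
    fix y assume "y \<in> space \<nu>"
    then have y [simp]: "y \<in> carrier G" by simp
    then have [measurable]: "y \<in> space (borel_of T)" by simp
    have "(\<integral>\<^sup>+ x. \<phi> x * \<psi> (inv y \<otimes> x) \<partial>\<mu>) = (\<integral>\<^sup>+ x. \<phi> (y \<otimes> x) * \<psi> (inv y \<otimes> (y \<otimes> x)) \<partial>\<mu>)"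
      by (rule nn_integral_left_translate[symmetric, where \<phi> = "\<lambda>x. \<phi> x * \<psi> (inv y \<otimes> x)"]) simp_all
    also have "\<dots> = (\<integral>\<^sup>+ x. \<phi> (y \<otimes> x) * \<psi> x \<partial>\<mu>)"
      by (rule nn_integral_cong) (simp add: m_assoc[symmetric])
    finally show "(\<integral>\<^sup>+ x. \<phi> x * \<psi> (inv y \<otimes> x) \<partial>\<mu>) = (\<integral>\<^sup>+ x. \<phi> (y \<otimes> x) * \<psi> x \<partial>\<mu>)" .
  qed
  also have "\<dots> = (\<integral>\<^sup>+ x. (\<integral>\<^sup>+ y. \<phi> (y \<otimes> x) * \<psi> x \<partial>\<nu>) \<partial>\<mu>)"
    by (rule P.Fubini') measurable
  also have "\<dots> = (\<integral>\<^sup>+ x. \<psi> x * (\<integral>\<^sup>+ y. \<phi> (y \<otimes> x) \<partial>\<nu>) \<partial>\<mu>)"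
  proof (rule nn_integral_cong)
    fix x assume "x \<in> space \<mu>"
    then have [measurable]: "x \<in> space (borel_of T)" by simp
    show "(\<integral>\<^sup>+ y. \<phi> (y \<otimes> x) * \<psi> x \<partial>\<nu>) = \<psi> x * (\<integral>\<^sup>+ y. \<phi> (y \<otimes> x) \<partial>\<nu>)"
      by (subst nn_integral_multc) (simp_all add: mult.commute)
  qed
  finally show ?thesis .
qed

end

locale uniform_lattice = second_countable_group G T for G :: "'g monoid" (structure) and T +
  fixes \<Gamma> :: "'g set"
  assumes uniform: "uniform_subgroup G T \<Gamma>"
begin

lemma lattice_subgroup: "subgroup \<Gamma> G"
  using uniform by (simp add: uniform_subgroup_def discrete_subgroup_def)

lemma lattice_discrete: "subtopology T \<Gamma> = discrete_topology \<Gamma>"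
  using uniform by (simp add: uniform_subgroup_def discrete_subgroup_def)

lemma lattice_carrier: "\<gamma> \<in> \<Gamma> \<Longrightarrow> \<gamma> \<in> carrier G"
  using subgroup.mem_carrier[OF lattice_subgroup] .

lemma lattice_countable: "countable \<Gamma>"
  using second_countable_subtopology[OF second_countable, of \<Gamma>]
  by (simp add: lattice_discrete second_countable_discrete_topology)

text \<open>Distinct lattice elements move such a neighbourhood, and each of its left translates, to disjoint
  sets.\<close>

lemma lattice_injective_neighbourhood:
  obtains W where "openin T W" "\<one> \<in> W"
    "\<And>v w. v \<in> W \<Longrightarrow> w \<in> W \<Longrightarrow> inv v \<otimes> w \<in> \<Gamma> \<Longrightarrow> v = w"
proof -
  have one: "\<one> \<in> \<Gamma>" using subgroup.one_closed[OF lattice_subgroup] .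
  then have "openin (subtopology T \<Gamma>) {\<one>}" by (simp add: lattice_discrete)
  then obtain V where V: "openin T V" "{\<one>} = V \<inter> \<Gamma>" by (auto simp: openin_subtopology)
  have "continuous_map (prod_topology T T) T (\<lambda>z. inv (fst z) \<otimes> snd z)"
    by (intro continuous_map_mult continuous_map_inv continuous_map_fst continuous_map_snd)
  from openin_continuous_map_preimage[OF this V(1)]
  have op: "openin (prod_topology T T) {z \<in> carrier G \<times> carrier G. inv (fst z) \<otimes> snd z \<in> V}"
    by simp
  have mem: "(\<one>, \<one>) \<in> {z \<in> carrier G \<times> carrier G. inv (fst z) \<otimes> snd z \<in> V}"
    using V(2) by auto
  from op[unfolded openin_prod_topology_alt, rule_format, OF mem] obtain A B where AB: "openin T A" "openin T B" "\<one> \<in> A" "\<one> \<in> B"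
    "A \<times> B \<subseteq> {z \<in> carrier G \<times> carrier G. inv (fst z) \<otimes> snd z \<in> V}"
    by (elim exE conjE) (rule that)
  show thesis
  proof
    show "openin T (A \<inter> B)" "\<one> \<in> A \<inter> B" using AB by auto
    fix v w assume vw: "v \<in> A \<inter> B" "w \<in> A \<inter> B" "inv v \<otimes> w \<in> \<Gamma>"
    then have "(v, w) \<in> A \<times> B" by simp
    then have *: "v \<in> carrier G" "w \<in> carrier G" "inv v \<otimes> w \<in> V" using AB(5) by auto
    then have "inv v \<otimes> w = \<one>" using V(2) vw(3) by blast
    then have "inv w = inv v" using * by (intro inv_equality) simp_all
    then show "v = w" using *(1,2) inv_inv by metis
  qed
qed

lemma fundamental_domain_sum:
  assumes F: "fundamental_domain G T \<Gamma> F" and x: "x \<in> carrier G"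
  shows "(\<integral>\<^sup>+ \<gamma>. indicator F (x \<otimes> inv \<gamma>) \<partial>count_space \<Gamma>) = 1"
    and "(\<integral>\<^sup>+ \<gamma>. indicator F (x \<otimes> \<gamma>) \<partial>count_space \<Gamma>) = 1"
proof -
  have FG: "F \<subseteq> carrier G"
    using F sets.sets_into_space unfolding fundamental_domain_def by fastforce
  have iff: "(\<exists>y\<in>F. x = y \<otimes> \<gamma>) \<longleftrightarrow> x \<otimes> inv \<gamma> \<in> F" if "\<gamma> \<in> \<Gamma>" for \<gamma>
  proof
    assume "\<exists>y\<in>F. x = y \<otimes> \<gamma>"
    then show "x \<otimes> inv \<gamma> \<in> F" using FG lattice_carrier[OF that] by (auto simp: m_assoc subset_iff)
  next
    assume "x \<otimes> inv \<gamma> \<in> F"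
    then show "\<exists>y\<in>F. x = y \<otimes> \<gamma>" using x lattice_carrier[OF that]
      by (intro bexI[of _ "x \<otimes> inv \<gamma>"]) (simp_all add: m_assoc)
  qed
  obtain \<gamma>0 where \<gamma>0: "\<gamma>0 \<in> \<Gamma>" "\<And>\<gamma>. \<gamma> \<in> \<Gamma> \<Longrightarrow> x \<otimes> inv \<gamma> \<in> F \<longleftrightarrow> \<gamma> = \<gamma>0"
    using F x iff unfolding fundamental_domain_def by metis
  have one: "(\<integral>\<^sup>+ \<gamma>. indicator {\<gamma>1} \<gamma> \<partial>count_space \<Gamma>) = 1" if "\<gamma>1 \<in> \<Gamma>" for \<gamma>1
    using that by (simp add: nn_integral_indicator)
  show "(\<integral>\<^sup>+ \<gamma>. indicator F (x \<otimes> inv \<gamma>) \<partial>count_space \<Gamma>) = 1"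
    unfolding one[OF \<gamma>0(1), symmetric]
    by (rule nn_integral_cong) (simp add: \<gamma>0 indicator_def)
  have inv\<gamma>: "inv \<gamma> \<in> \<Gamma>" if "\<gamma> \<in> \<Gamma>" for \<gamma>
    using subgroup.m_inv_closed[OF lattice_subgroup that] .
  have "x \<otimes> \<gamma> \<in> F \<longleftrightarrow> \<gamma> = inv \<gamma>0" if "\<gamma> \<in> \<Gamma>" for \<gamma>
    using \<gamma>0(2)[OF inv\<gamma>[OF that]] \<gamma>0(1) that lattice_carrier by (metis inv_inv)
  then show "(\<integral>\<^sup>+ \<gamma>. indicator F (x \<otimes> \<gamma>) \<partial>count_space \<Gamma>) = 1"
    unfolding one[OF inv\<gamma>[OF \<gamma>0(1)], symmetric]
    by (intro nn_integral_cong) (simp add: indicator_def)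
qed

text \<open>Insert \<open>1 = \<Sum>\<^sub>\<gamma> 1\<^sub>F (x \<gamma>\<^sup>-\<^sup>1)\<close> and substitute \<open>x \<mapsto> x \<gamma>\<close> in each summand.\<close>

lemma nn_integral_unfold:
  assumes sets_M [measurable_cong]: "sets M = sets (borel_of T)"
    and invariant: "\<And>\<phi> \<gamma>. \<phi> \<in> borel_measurable (borel_of T) \<Longrightarrow> \<gamma> \<in> \<Gamma> \<Longrightarrow>
      (\<integral>\<^sup>+ x. \<phi> (x \<otimes> \<gamma>) \<partial>M) = (\<integral>\<^sup>+ x. \<phi> x \<partial>M)"
    and F: "fundamental_domain G T \<Gamma> F"
    and [measurable]: "\<phi> \<in> borel_measurable (borel_of T)"
  shows "(\<integral>\<^sup>+ x. \<phi> x \<partial>M) = (\<integral>\<^sup>+ x. indicator F x * (\<integral>\<^sup>+ \<gamma>. \<phi> (x \<otimes> \<gamma>) \<partial>count_space \<Gamma>) \<partial>M)"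
proof -
  have [measurable]: "F \<in> sets (borel_of T)"
    using F by (simp add: fundamental_domain_def)
  have sp: "space M = carrier G" using sets_eq_imp_space_eq[OF sets_M] by simp
  have \<gamma>m: "\<gamma> \<in> space (borel_of T)" if "\<gamma> \<in> \<Gamma>" for \<gamma>
    using lattice_carrier[OF that] by simp
  have "(\<integral>\<^sup>+ x. \<phi> x \<partial>M) = (\<integral>\<^sup>+ x. (\<integral>\<^sup>+ \<gamma>. \<phi> x * indicator F (x \<otimes> inv \<gamma>) \<partial>count_space \<Gamma>) \<partial>M)"
    by (rule nn_integral_cong) (simp add: sp nn_integral_cmult fundamental_domain_sum(1)[OF F])
  also have "\<dots> = (\<integral>\<^sup>+ \<gamma>. (\<integral>\<^sup>+ x. \<phi> x * indicator F (x \<otimes> inv \<gamma>) \<partial>M) \<partial>count_space \<Gamma>)"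
  proof (rule nn_integral_count_space_nn_integral[OF lattice_countable])
    fix \<gamma> assume "\<gamma> \<in> \<Gamma>"
    note [measurable] = \<gamma>m[OF this]
    show "(\<lambda>x. \<phi> x * indicator F (x \<otimes> inv \<gamma>)) \<in> borel_measurable M" by measurable
  qed
  also have "\<dots> = (\<integral>\<^sup>+ \<gamma>. (\<integral>\<^sup>+ x. indicator F x * \<phi> (x \<otimes> \<gamma>) \<partial>M) \<partial>count_space \<Gamma>)"
  proof (rule nn_integral_cong)
    fix \<gamma> assume "\<gamma> \<in> space (count_space \<Gamma>)"
    then have \<gamma>: "\<gamma> \<in> \<Gamma>" by simp
    note [measurable] = \<gamma>m[OF \<gamma>]
    have "(\<integral>\<^sup>+ x. \<phi> x * indicator F (x \<otimes> inv \<gamma>) \<partial>M)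
        = (\<integral>\<^sup>+ x. \<phi> (x \<otimes> \<gamma>) * indicator F (x \<otimes> \<gamma> \<otimes> inv \<gamma>) \<partial>M)"
      by (rule invariant[symmetric, where \<phi> = "\<lambda>x. \<phi> x * indicator F (x \<otimes> inv \<gamma>)", OF _ \<gamma>]) measurable
    also have "\<dots> = (\<integral>\<^sup>+ x. indicator F x * \<phi> (x \<otimes> \<gamma>) \<partial>M)"
      by (rule nn_integral_cong) (simp add: sp m_assoc lattice_carrier[OF \<gamma>] mult.commute)
    finally show "(\<integral>\<^sup>+ x. \<phi> x * indicator F (x \<otimes> inv \<gamma>) \<partial>M) = (\<integral>\<^sup>+ x. indicator F x * \<phi> (x \<otimes> \<gamma>) \<partial>M)" .
  qed
  also have "\<dots> = (\<integral>\<^sup>+ x. (\<integral>\<^sup>+ \<gamma>. indicator F x * \<phi> (x \<otimes> \<gamma>) \<partial>count_space \<Gamma>) \<partial>M)"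
  proof (rule nn_integral_count_space_nn_integral[symmetric, OF lattice_countable])
    fix \<gamma> assume "\<gamma> \<in> \<Gamma>"
    note [measurable] = \<gamma>m[OF this]
    show "(\<lambda>x. indicator F x * \<phi> (x \<otimes> \<gamma>)) \<in> borel_measurable M" by measurable
  qed
  finally show ?thesis by (simp add: nn_integral_cmult)
qed

lemma fundamental_domain_measure_unique:
  assumes sets_M: "sets M = sets (borel_of T)"
    and invariant: "\<And>\<phi> \<gamma>. \<phi> \<in> borel_measurable (borel_of T) \<Longrightarrow> \<gamma> \<in> \<Gamma> \<Longrightarrow>
      (\<integral>\<^sup>+ x. \<phi> (x \<otimes> \<gamma>) \<partial>M) = (\<integral>\<^sup>+ x. \<phi> x \<partial>M)"
    and F: "fundamental_domain G T \<Gamma> F" and F': "fundamental_domain G T \<Gamma> F'"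
  shows "emeasure M F = emeasure M F'"
proof -
  have [measurable]: "F \<in> sets (borel_of T)" "F' \<in> sets (borel_of T)"
    using F F' by (simp_all add: fundamental_domain_def)
  have sp: "space M = carrier G" using sets_eq_imp_space_eq[OF sets_M] by simp
  have "emeasure M F' = (\<integral>\<^sup>+ x. indicator F' x \<partial>M)"
    by (simp add: sets_M)
  also have "\<dots> = (\<integral>\<^sup>+ x. indicator F x * (\<integral>\<^sup>+ \<gamma>. indicator F' (x \<otimes> \<gamma>) \<partial>count_space \<Gamma>) \<partial>M)"
    by (rule nn_integral_unfold[OF sets_M invariant F]) (auto intro: borel_measurable_indicator)
  also have "\<dots> = (\<integral>\<^sup>+ x. indicator F x \<partial>M)"
    by (rule nn_integral_cong) (simp add: sp fundamental_domain_sum(2)[OF F'])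
  also have "\<dots> = emeasure M F" by (simp add: sets_M)
  finally show ?thesis by simp
qed

lemma fundamental_domain_translate:
  assumes F: "fundamental_domain G T \<Gamma> F" and a: "a \<in> carrier G"
  shows "fundamental_domain G T \<Gamma> ((\<lambda>x. a \<otimes> x) ` F)"
  unfolding fundamental_domain_def
proof (intro conjI ballI)
  have Fm [measurable]: "F \<in> sets (borel_of T)"
    using F by (simp add: fundamental_domain_def)
  have FG: "F \<subseteq> carrier G" using sets.sets_into_space[OF Fm] by simp
  have [measurable]: "a \<in> space (borel_of T)" using a by simp
  have "(\<lambda>x. a \<otimes> x) ` F = (\<lambda>x. inv a \<otimes> x) -` F \<inter> space (borel_of T)"
    using left_translate_image[OF a FG] by auto
  also have "\<dots> \<in> sets (borel_of T)"
    by (rule measurable_sets[OF _ Fm]) measurable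
  finally show "(\<lambda>x. a \<otimes> x) ` F \<in> sets (borel_of T)" .
  fix x assume x: "x \<in> carrier G"
  have "(\<exists>y\<in>(\<lambda>x. a \<otimes> x) ` F. x = y \<otimes> \<gamma>) \<longleftrightarrow> (\<exists>y\<in>F. inv a \<otimes> x = y \<otimes> \<gamma>)" if "\<gamma> \<in> \<Gamma>" for \<gamma>
  proof -
    have "x = a \<otimes> y \<otimes> \<gamma> \<longleftrightarrow> inv a \<otimes> x = y \<otimes> \<gamma>" if "y \<in> F" for y
    proof -
      have y: "y \<in> carrier G" "\<gamma> \<in> carrier G"
        using FG \<open>y \<in> F\<close> lattice_carrier[OF \<open>\<gamma> \<in> \<Gamma>\<close>] by auto
      show ?thesis
        using inv_solve_left[of "y \<otimes> \<gamma>" a x] y x a by (auto simp: m_assoc)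
    qed
    then show ?thesis by auto
  qed
  moreover have "\<exists>!\<gamma>. \<gamma> \<in> \<Gamma> \<and> (\<exists>y\<in>F. inv a \<otimes> x = y \<otimes> \<gamma>)"
    using F x a by (simp add: fundamental_domain_def)
  ultimately show "\<exists>!\<gamma>. \<gamma> \<in> \<Gamma> \<and> (\<exists>y\<in>(\<lambda>x. a \<otimes> x) ` F. x = y \<otimes> \<gamma>)"
    by (simp cong: conj_cong)
qed

text \<open>Finitely many small open sets have translates that cover the group.  From each of them, remove
  the translates of the previous ones.\<close>

lemma fundamental_domain_exists:
  assumes U: "\<And>x. x \<in> carrier G \<Longrightarrow> openin T (U x) \<and> x \<in> U x"
  obtains F K where "fundamental_domain G T \<Gamma> F" "finite K" "K \<subseteq> carrier G" "F \<subseteq> (\<Union>x\<in>K. U x)"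
proof -
  obtain W where W: "openin T W" "\<one> \<in> W"
    "\<And>v w. v \<in> W \<Longrightarrow> w \<in> W \<Longrightarrow> inv v \<otimes> w \<in> \<Gamma> \<Longrightarrow> v = w"
    using lattice_injective_neighbourhood by blast
  have WG: "W \<subseteq> carrier G" using openin_subset[OF W(1)] by simp
  \<comment> \<open>Two points of \<open>V x\<close> in the same lattice coset coincide; \<open>S x\<close> is the union of the cosets that
    meet \<open>V x\<close>.\<close>
  define V where "V = (\<lambda>x. U x \<inter> (\<lambda>w. x \<otimes> w) ` W)"
  have V_open: "openin T (V x)" and V_mem: "x \<in> V x" if "x \<in> carrier G" for x
    using U[OF that] openin_left_translate[OF that W(1)] W(2) that
    by (auto simp: V_def intro!: image_eqI[of _ _ \<one>])
  have VG: "V x \<subseteq> carrier G" if "x \<in> carrier G" for x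
    using openin_subset[OF V_open[OF that]] by simp
  have V_small: "v = w" if x: "x \<in> carrier G" and vw: "v \<in> V x" "w \<in> V x" "inv v \<otimes> w \<in> \<Gamma>" for x v w
  proof -
    obtain v' w' where v'w': "v' \<in> W" "w' \<in> W" "v = x \<otimes> v'" "w = x \<otimes> w'"
      using vw(1,2) by (auto simp: V_def)
    then have "inv v \<otimes> w = inv v' \<otimes> w'"
      using x WG by (simp add: inv_mult_group subset_iff m_assoc) (simp add: m_assoc[symmetric])
    then show ?thesis using W(3) v'w' vw(3) by metis
  qed
  define S where "S = (\<lambda>x. \<Union>\<gamma>\<in>\<Gamma>. (\<lambda>y. y \<otimes> \<gamma>) ` V x)"
  have S_open: "openin T (S x)" if "x \<in> carrier G" for x
    unfolding S_def by (rule openin_saturation[OF lattice_subgroup V_open[OF that]])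
  let ?q = "\<lambda>x. x <#\<^bsub>G\<^esub> \<Gamma>"
  have pre: "{y \<in> carrier G. ?q y \<in> ?q ` V x} = S x" if "x \<in> carrier G" for x
    unfolding S_def by (rule l_coset_saturation[OF lattice_subgroup VG[OF that]])
  let ?Q = "quotient_topology T ?q"
  have compact: "compact_space ?Q" using uniform by (simp add: uniform_subgroup_def)
  have q_open: "openin ?Q (?q ` V x)" if "x \<in> carrier G" for x
    using open_map_quotient[OF lattice_subgroup] V_open[OF that] by (simp add: open_map_def)
  have "topspace ?Q \<subseteq> \<Union> ((\<lambda>x. ?q ` V x) ` carrier G)"
    using V_mem by (auto simp: topspace_quotient)
  then obtain \<F> where \<F>: "finite \<F>" "\<F> \<subseteq> (\<lambda>x. ?q ` V x) ` carrier G" "topspace ?Q \<subseteq> \<Union>\<F>"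
    using compact[unfolded compact_space_alt, rule_format, of "(\<lambda>x. ?q ` V x) ` carrier G"] q_open
    by blast
  obtain K where K: "finite K" "K \<subseteq> carrier G" "\<F> = (\<lambda>x. ?q ` V x) ` K"
    using \<F>(1,2) by (metis finite_subset_image)
  have cover: "carrier G \<subseteq> (\<Union>x\<in>K. S x)"
  proof
    fix y assume y: "y \<in> carrier G"
    then have "?q y \<in> \<Union>\<F>" using \<F>(3) topspace_quotient by auto
    then obtain x where "x \<in> K" "?q y \<in> ?q ` V x" using K(3) by auto
    then show "y \<in> (\<Union>x\<in>K. S x)" using pre[of x] y K(2) by blast
  qed
  obtain xs where xs: "set xs = K" using K(1) finite_list by blast
  have xsG: "xs ! i \<in> carrier G" if "i < length xs" for i
    using that xs K(2) nth_mem by blast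
  define F where "F = (\<Union>i<length xs. V (xs ! i) - (\<Union>j<i. S (xs ! j)))"
  have S_right: "y \<otimes> \<gamma> \<in> S x \<longleftrightarrow> y \<in> S x" if "x \<in> carrier G" "y \<in> carrier G" "\<gamma> \<in> \<Gamma>" for x y \<gamma>
  proof -
    have "?q (y \<otimes> \<gamma>) = ?q y" using l_coset_eq_iff[OF lattice_subgroup, of "y \<otimes> \<gamma>" y] that lattice_carrier by auto
    then show ?thesis
      unfolding pre[OF that(1), symmetric] using that(2) lattice_carrier[OF that(3)] by simp
  qed
  have FG: "F \<subseteq> carrier G" using VG xsG by (auto simp: F_def)
  have "fundamental_domain G T \<Gamma> F"
    unfolding fundamental_domain_def
  proof (intro conjI ballI)
    have "V (xs ! i) - (\<Union>j<i. S (xs ! j)) \<in> sets (borel_of T)" if "i < length xs" for i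
      using that xsG
      by (intro sets.Diff sets.countable_UN' openin_borel_of V_open) (auto intro!: openin_borel_of S_open)
    then show "F \<in> sets (borel_of T)"
      unfolding F_def by (intro sets.countable_UN') auto
    fix x assume x: "x \<in> carrier G"
    have ex: "\<exists>i. i < length xs \<and> x \<in> S (xs ! i)"
      using cover x by (metis UN_E in_set_conv_nth subsetD xs)
    \<comment> \<open>A coset meets only the piece of \<open>F\<close> that belongs to the first index whose set it meets.\<close>
    define i where "i = (LEAST i. i < length xs \<and> x \<in> S (xs ! i))"
    have i: "i < length xs" "x \<in> S (xs ! i)"
      using LeastI_ex[OF ex] by (simp_all add: i_def)
    have minimal: "x \<notin> S (xs ! j)" if "j < i" for j
      using not_less_Least[of j "\<lambda>i. i < length xs \<and> x \<in> S (xs ! i)"] that i(1) by (auto simp: i_def)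
    obtain y \<gamma> where y: "y \<in> V (xs ! i)" "\<gamma> \<in> \<Gamma>" "x = y \<otimes> \<gamma>"
      using i(2) by (auto simp: S_def)
    have yG: "y \<in> carrier G" using y(1) VG xsG i(1) by blast
    have "y \<notin> S (xs ! j)" if "j < i" for j
      using minimal[OF that] S_right[of "xs ! j" y \<gamma>] xsG that i(1) yG y by auto
    then have yF: "y \<in> F" using y(1) i(1) by (auto simp: F_def)
    show "\<exists>!\<gamma>. \<gamma> \<in> \<Gamma> \<and> (\<exists>y\<in>F. x = y \<otimes> \<gamma>)"
    proof (intro ex1I[of _ \<gamma>] conjI bexI[OF _ yF] y)
      fix \<gamma>' assume "\<gamma>' \<in> \<Gamma> \<and> (\<exists>y\<in>F. x = y \<otimes> \<gamma>')"
      then obtain z where z: "\<gamma>' \<in> \<Gamma>" "z \<in> F" "x = z \<otimes> \<gamma>'" by blast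
      have zG: "z \<in> carrier G" using z(2) FG by blast
      obtain i' where i': "i' < length xs" "z \<in> V (xs ! i')" "\<And>j. j < i' \<Longrightarrow> z \<notin> S (xs ! j)"
        using z(2) by (auto simp: F_def)
      have "x \<in> S (xs ! i')" using i'(2) z by (auto simp: S_def)
      then have "\<not> i' < i" using minimal by blast
      moreover have "z \<in> S (xs ! i)"
        using i S_right[of "xs ! i" z \<gamma>'] z zG xsG by auto
      then have "\<not> i < i'" using i'(3) by blast
      ultimately have "i' = i" by simp
      have eq: "y \<otimes> \<gamma> = z \<otimes> \<gamma>'" using y(3) z(3) by simp
      have \<gamma>G: "\<gamma> \<in> carrier G" "\<gamma>' \<in> carrier G" using y(2) z(1) lattice_carrier by auto
      have "inv y \<otimes> z = \<gamma> \<otimes> inv \<gamma>'"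
      proof -
        have "z = y \<otimes> \<gamma> \<otimes> inv \<gamma>'" unfolding eq using zG \<gamma>G by (simp add: m_assoc)
        then show ?thesis using yG \<gamma>G by (simp add: m_assoc) (simp add: m_assoc[symmetric])
      qed
      also have "\<dots> \<in> \<Gamma>" using y(2) z(1) lattice_subgroup
        by (intro subgroup.m_closed[OF lattice_subgroup] subgroup.m_inv_closed[OF lattice_subgroup])
      finally have "y = z" using V_small[OF xsG[OF i(1)] y(1)] i'(2) \<open>i' = i\<close> by blast
      then show "\<gamma>' = \<gamma>" using eq yG \<gamma>G by simp
    qed
  qed
  moreover have "F \<subseteq> (\<Union>x\<in>K. U x)"
    using xs by (auto simp: F_def V_def)
  ultimately show thesis using that K by blast
qed

end

locale haar_lattice = haar G T \<mu> + uniform_lattice G T \<Gamma>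
  for G :: "'g monoid" (structure) and T \<mu> \<Gamma>
begin

text \<open>The right-invariant companion of \<open>\<mu>\<close>; it turns out to be \<open>\<mu>\<close> itself.\<close>

definition inv_measure :: "'g measure" where
  "inv_measure = distr \<mu> (borel_of T) (\<lambda>x. inv x)"

lemma nn_integral_inv_measure:
  assumes [measurable]: "\<phi> \<in> borel_measurable (borel_of T)"
  shows "(\<integral>\<^sup>+ x. \<phi> x \<partial>inv_measure) = (\<integral>\<^sup>+ x. \<phi> (inv x) \<partial>\<mu>)"
  unfolding inv_measure_def by (rule nn_integral_distr) measurable

lemma inv_measure_right_invariant:
  assumes [measurable]: "\<phi> \<in> borel_measurable (borel_of T)" and a: "a \<in> carrier G"
  shows "(\<integral>\<^sup>+ x. \<phi> (x \<otimes> a) \<partial>inv_measure) = (\<integral>\<^sup>+ x. \<phi> x \<partial>inv_measure)"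
proof -
  have [measurable]: "a \<in> space (borel_of T)" using a by simp
  have "(\<integral>\<^sup>+ x. \<phi> (x \<otimes> a) \<partial>inv_measure) = (\<integral>\<^sup>+ x. \<phi> (inv (inv a \<otimes> x)) \<partial>\<mu>)"
    by (subst nn_integral_inv_measure) (auto intro!: nn_integral_cong simp: inv_mult_group a)
  also have "\<dots> = (\<integral>\<^sup>+ x. \<phi> (inv x) \<partial>\<mu>)"
    by (rule nn_integral_left_translate[where \<phi> = "\<lambda>x. \<phi> (inv x)"]) (use a in simp_all)
  finally show ?thesis by (simp add: nn_integral_inv_measure)
qed

lemma sets_inv_measure [measurable_cong]: "sets inv_measure = sets (borel_of T)"
  by (simp add: inv_measure_def)

text \<open>By right invariance, every point has an open neighbourhood of finite inverse measure, and finitely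
  many of these contain a fundamental domain.  It is not null, since its countably many translates
  cover the group.\<close>

lemma finite_fundamental_domain:
  obtains F where "fundamental_domain G T \<Gamma> F"
    "emeasure inv_measure F < \<infinity>" "emeasure inv_measure F \<noteq> 0"
proof -
  obtain U where U: "openin T U" "\<one> \<in> U" "emeasure \<mu> U \<noteq> 0" "emeasure \<mu> U < \<infinity>"
    using open_nonempty_finite .
  have [measurable]: "U \<in> sets (borel_of T)" by (rule openin_borel_of[OF U(1)])
  define V where "V = (\<lambda>x. {y \<in> carrier G. inv (y \<otimes> inv x) \<in> U})"
  have V: "openin T (V x) \<and> x \<in> V x" if x: "x \<in> carrier G" for x
  proof
    have "continuous_map T T (\<lambda>y. inv (y \<otimes> inv x))"
      using x by (intro continuous_map_inv continuous_map_translate(2)) simp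
    from openin_continuous_map_preimage[OF this U(1)] show "openin T (V x)"
      by (simp add: V_def)
    show "x \<in> V x" using x U(2) by (simp add: V_def)
  qed
  have V_fin: "emeasure inv_measure (V x) < \<infinity>" if x: "x \<in> carrier G" for x
  proof -
    have [measurable]: "x \<in> space (borel_of T)" using x by simp
    have "emeasure inv_measure (V x) = (\<integral>\<^sup>+ y. indicator (V x) y \<partial>inv_measure)"
      using V[OF x] by (simp add: sets_inv_measure openin_borel_of)
    also have "\<dots> = (\<integral>\<^sup>+ y. indicator U (inv (y \<otimes> inv x)) \<partial>inv_measure)"
      by (rule nn_integral_cong)
        (use sets_eq_imp_space_eq[OF sets_inv_measure] in \<open>auto simp: V_def indicator_def\<close>)
    also have "\<dots> = (\<integral>\<^sup>+ y. indicator U (inv y) \<partial>inv_measure)"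
      by (rule inv_measure_right_invariant[where \<phi> = "\<lambda>y. indicator U (inv y)"]) (use x in simp_all)
    also have "\<dots> = (\<integral>\<^sup>+ y. indicator U (inv (inv y)) \<partial>\<mu>)"
      by (rule nn_integral_inv_measure) measurable
    also have "\<dots> = (\<integral>\<^sup>+ y. indicator U y \<partial>\<mu>)"
      by (rule nn_integral_cong) simp
    also have "\<dots> = emeasure \<mu> U" by (simp add: sets_haar)
    finally show ?thesis using U(4) by simp
  qed
  obtain F K where F: "fundamental_domain G T \<Gamma> F" and K: "finite K" "K \<subseteq> carrier G" "F \<subseteq> (\<Union>x\<in>K. V x)"
    using fundamental_domain_exists[of V] V by blast
  have Vs: "V ` K \<subseteq> sets inv_measure"
    using K(2) V openin_borel_of by (auto simp: sets_inv_measure)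
  have Fm: "F \<in> sets (borel_of T)" using F by (simp add: fundamental_domain_def)
  have "emeasure inv_measure F \<le> emeasure inv_measure (\<Union>x\<in>K. V x)"
    using K Vs by (intro emeasure_mono) (auto intro!: sets.finite_UN)
  also have "\<dots> \<le> (\<Sum>x\<in>K. emeasure inv_measure (V x))"
    by (rule emeasure_subadditive_finite[OF K(1) Vs])
  also have "\<dots> < \<infinity>"
    using K V_fin by (auto simp: subset_iff)
  finally have fin: "emeasure inv_measure F < \<infinity>" .
  have "emeasure inv_measure F \<noteq> 0"
  proof
    assume 0: "emeasure inv_measure F = 0"
    have sp: "space inv_measure = carrier G"
      using sets_eq_imp_space_eq[OF sets_inv_measure] by simp
    have "(\<integral>\<^sup>+ x. 1 \<partial>\<mu>) = (\<integral>\<^sup>+ x. 1 \<partial>inv_measure)"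
      by (subst nn_integral_inv_measure) simp_all
    also have "\<dots> = (\<integral>\<^sup>+ x. indicator F x * (\<integral>\<^sup>+ \<gamma>. 1 \<partial>count_space \<Gamma>) \<partial>inv_measure)"
      by (rule nn_integral_unfold[OF sets_inv_measure inv_measure_right_invariant F])
        (simp_all add: lattice_carrier)
    also have "\<dots> = (\<integral>\<^sup>+ \<gamma>. 1 \<partial>count_space \<Gamma>) * emeasure inv_measure F"
      using Fm by (subst mult.commute, subst nn_integral_cmult)
        (auto intro!: borel_measurable_indicator simp: sets_inv_measure)
    finally show False using 0 nonzero by simp
  qed
  then show thesis using that F fin by blast
qed

text \<open>Groups with a uniform lattice are unimodular.  Let \<open>\<nu>\<close> be the inverse measure and
  \<open>D x = \<mu> (U x\<^sup>-\<^sup>1)\<close> for an open set \<open>U\<close>.  By the comparison formula, \<open>D / \<mu> U\<close> is the density of \<open>\<nu>\<close>, and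
  \<open>D (x a) \<mu> = D a \<nu>\<close> as measures in \<open>x\<close>.  Integrating the latter over \<open>a\<close> in a fundamental domain \<open>F\<close>
  leaves \<open>\<mu> U \<nu> F\<close> times \<open>\<nu>\<close> on the right.  On the left, the integral of \<open>D (x a)\<close> is
  \<open>\<mu> U \<nu> (x F) = \<mu> U \<nu> F\<close>, because \<open>x F\<close> is again a fundamental domain.\<close>

theorem nn_integral_inv:
  assumes [measurable]: "\<psi> \<in> borel_measurable (borel_of T)"
  shows "(\<integral>\<^sup>+ x. \<psi> (inv x) \<partial>\<mu>) = (\<integral>\<^sup>+ x. \<psi> x \<partial>\<mu>)"
proof -
  interpret M: sigma_finite_measure \<mu> by (rule sigma_finite)
  interpret P: pair_sigma_finite \<mu> \<mu> ..
  obtain U where U: "openin T U" "\<one> \<in> U" "emeasure \<mu> U \<noteq> 0" "emeasure \<mu> U < \<infinity>"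
    using open_nonempty_finite .
  have [measurable]: "U \<in> sets (borel_of T)" by (rule openin_borel_of[OF U(1)])
  obtain F where F: "fundamental_domain G T \<Gamma> F"
    "emeasure inv_measure F < \<infinity>" "emeasure inv_measure F \<noteq> 0"
    using finite_fundamental_domain .
  have Fm [measurable]: "F \<in> sets (borel_of T)" using F(1) by (simp add: fundamental_domain_def)
  have FG: "F \<subseteq> carrier G" using sets.sets_into_space[OF Fm] by simp
  have self: "haar G T \<mu>" by unfold_locales
  define D :: "'g \<Rightarrow> ennreal" where "D = (\<lambda>x. \<integral>\<^sup>+ y. indicator U (y \<otimes> x) \<partial>\<mu>)"
  have Dm [measurable]: "D \<in> borel_measurable (borel_of T)" unfolding D_def by measurable
  have 1: "emeasure \<mu> U * (\<integral>\<^sup>+ y. f (inv y) \<partial>\<mu>) = (\<integral>\<^sup>+ x. f x * D x \<partial>\<mu>)"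
    if [measurable]: "f \<in> borel_measurable (borel_of T)" for f
    using haar_comparison[OF self, of "indicator U" f] by (simp add: D_def sets_haar)
  have 2: "D a * (\<integral>\<^sup>+ y. \<psi> (inv y) \<partial>\<mu>) = (\<integral>\<^sup>+ x. \<psi> x * D (x \<otimes> a) \<partial>\<mu>)" if a: "a \<in> carrier G" for a
  proof -
    have [measurable]: "a \<in> space (borel_of T)" using a by simp
    have "D a * (\<integral>\<^sup>+ y. \<psi> (inv y) \<partial>\<mu>)
        = (\<integral>\<^sup>+ x. \<psi> x * (\<integral>\<^sup>+ y. indicator U (y \<otimes> x \<otimes> a) \<partial>\<mu>) \<partial>\<mu>)"
      unfolding D_def by (rule haar_comparison[OF self, of "\<lambda>y. indicator U (y \<otimes> a)"]) measurable
    also have "\<dots> = (\<integral>\<^sup>+ x. \<psi> x * D (x \<otimes> a) \<partial>\<mu>)"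
      unfolding D_def
      by (intro nn_integral_cong arg_cong2[where f = "(*)"] refl) (simp add: m_assoc a)
    finally show ?thesis .
  qed
  have 3: "(\<integral>\<^sup>+ a. indicator F a * D (x \<otimes> a) \<partial>\<mu>) = emeasure \<mu> U * emeasure inv_measure F"
    if x: "x \<in> carrier G" for x
  proof -
    have [measurable]: "x \<in> space (borel_of T)" using x by simp
    have "(\<integral>\<^sup>+ a. indicator F a * D (x \<otimes> a) \<partial>\<mu>)
        = (\<integral>\<^sup>+ a. indicator F (inv x \<otimes> (x \<otimes> a)) * D (x \<otimes> a) \<partial>\<mu>)"
      by (rule nn_integral_cong) (simp add: x m_assoc[symmetric])
    also have "\<dots> = (\<integral>\<^sup>+ a. indicator F (inv x \<otimes> a) * D a \<partial>\<mu>)"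
      by (rule nn_integral_left_translate[where \<phi> = "\<lambda>a. indicator F (inv x \<otimes> a) * D a"]) (use x in simp_all)
    also have "\<dots> = emeasure \<mu> U * (\<integral>\<^sup>+ y. indicator F (inv x \<otimes> inv y) \<partial>\<mu>)"
      by (rule 1[symmetric]) measurable
    also have "(\<integral>\<^sup>+ y. indicator F (inv x \<otimes> inv y) \<partial>\<mu>) = (\<integral>\<^sup>+ y. indicator F (inv x \<otimes> y) \<partial>inv_measure)"
      by (rule nn_integral_inv_measure[symmetric, where \<phi> = "\<lambda>y. indicator F (inv x \<otimes> y)"]) measurable
    also have "\<dots> = (\<integral>\<^sup>+ y. indicator ((\<lambda>z. x \<otimes> z) ` F) y \<partial>inv_measure)"
      by (rule nn_integral_cong)
        (use sets_eq_imp_space_eq[OF sets_inv_measure] left_translate_image[OF x FG] in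
          \<open>auto simp: indicator_def\<close>)
    also have "\<dots> = emeasure inv_measure ((\<lambda>z. x \<otimes> z) ` F)"
      using fundamental_domain_translate[OF F(1) x]
      by (simp add: fundamental_domain_def sets_inv_measure)
    also have "\<dots> = emeasure inv_measure F"
      by (rule fundamental_domain_measure_unique[OF sets_inv_measure inv_measure_right_invariant
            fundamental_domain_translate[OF F(1) x] F(1)]) (simp_all add: lattice_carrier)
    finally show ?thesis .
  qed
  let ?c = "emeasure \<mu> U * emeasure inv_measure F"
  have "(\<integral>\<^sup>+ x. \<psi> x \<partial>\<mu>) * ?c = (\<integral>\<^sup>+ x. \<psi> x * (\<integral>\<^sup>+ a. indicator F a * D (x \<otimes> a) \<partial>\<mu>) \<partial>\<mu>)"
    by (subst nn_integral_multc[symmetric]) (auto intro!: nn_integral_cong simp: 3)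
  also have "\<dots> = (\<integral>\<^sup>+ x. (\<integral>\<^sup>+ a. \<psi> x * (indicator F a * D (x \<otimes> a)) \<partial>\<mu>) \<partial>\<mu>)"
  proof (rule nn_integral_cong)
    fix x assume "x \<in> space \<mu>"
    then have [measurable]: "x \<in> space (borel_of T)" by simp
    show "\<psi> x * (\<integral>\<^sup>+ a. indicator F a * D (x \<otimes> a) \<partial>\<mu>) = (\<integral>\<^sup>+ a. \<psi> x * (indicator F a * D (x \<otimes> a)) \<partial>\<mu>)"
      by (rule nn_integral_cmult[symmetric]) measurable
  qed
  also have "\<dots> = (\<integral>\<^sup>+ a. (\<integral>\<^sup>+ x. \<psi> x * (indicator F a * D (x \<otimes> a)) \<partial>\<mu>) \<partial>\<mu>)"
    by (rule P.Fubini'[symmetric]) measurable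
  also have "\<dots> = (\<integral>\<^sup>+ a. (indicator F a * D a) * (\<integral>\<^sup>+ y. \<psi> (inv y) \<partial>\<mu>) \<partial>\<mu>)"
  proof (rule nn_integral_cong)
    fix a assume "a \<in> space \<mu>"
    then have a: "a \<in> carrier G" and [measurable]: "a \<in> space (borel_of T)" by simp_all
    have "(\<integral>\<^sup>+ x. \<psi> x * (indicator F a * D (x \<otimes> a)) \<partial>\<mu>) = (\<integral>\<^sup>+ x. indicator F a * (\<psi> x * D (x \<otimes> a)) \<partial>\<mu>)"
      by (simp add: mult.left_commute)
    also have "\<dots> = indicator F a * (\<integral>\<^sup>+ x. \<psi> x * D (x \<otimes> a) \<partial>\<mu>)"
      by (rule nn_integral_cmult) measurable
    finally show "(\<integral>\<^sup>+ x. \<psi> x * (indicator F a * D (x \<otimes> a)) \<partial>\<mu>)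
        = (indicator F a * D a) * (\<integral>\<^sup>+ y. \<psi> (inv y) \<partial>\<mu>)"
      by (simp add: 2[OF a, symmetric] mult.assoc)
  qed
  also have "\<dots> = (\<integral>\<^sup>+ a. indicator F a * D a \<partial>\<mu>) * (\<integral>\<^sup>+ y. \<psi> (inv y) \<partial>\<mu>)"
    by (rule nn_integral_multc) measurable
  also have "(\<integral>\<^sup>+ a. indicator F a * D a \<partial>\<mu>) = ?c"
  proof -
    have "(\<integral>\<^sup>+ a. indicator F a * D a \<partial>\<mu>) = (\<integral>\<^sup>+ a. indicator F a * D (\<one> \<otimes> a) \<partial>\<mu>)"
      by (rule nn_integral_cong) simp
    then show ?thesis using 3[of \<one>] by simp
  qed
  finally have "?c * (\<integral>\<^sup>+ x. \<psi> x \<partial>\<mu>) = ?c * (\<integral>\<^sup>+ y. \<psi> (inv y) \<partial>\<mu>)"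
    by (simp add: mult.commute)
  moreover have "?c \<noteq> 0" "?c \<noteq> \<infinity>"
    using U F by (auto simp: ennreal_mult_eq_top_iff)
  ultimately show ?thesis by (simp add: ennreal_mult_cancel_left)
qed

lemma nn_integral_right_translate:
  assumes [measurable]: "\<phi> \<in> borel_measurable (borel_of T)" and a: "a \<in> carrier G"
  shows "(\<integral>\<^sup>+ x. \<phi> (x \<otimes> a) \<partial>\<mu>) = (\<integral>\<^sup>+ x. \<phi> x \<partial>\<mu>)"
proof -
  have [measurable]: "a \<in> space (borel_of T)" using a by simp
  have "(\<integral>\<^sup>+ x. \<phi> (x \<otimes> a) \<partial>\<mu>) = (\<integral>\<^sup>+ x. \<phi> (inv x \<otimes> a) \<partial>\<mu>)"
    by (rule nn_integral_inv[symmetric, where \<psi> = "\<lambda>x. \<phi> (x \<otimes> a)"]) measurable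
  also have "\<dots> = (\<integral>\<^sup>+ x. \<phi> x \<partial>inv_measure)"
    by (subst inv_measure_right_invariant[OF assms, symmetric], subst nn_integral_inv_measure) simp_all
  also have "\<dots> = (\<integral>\<^sup>+ x. \<phi> x \<partial>\<mu>)"
    by (simp add: nn_integral_inv_measure nn_integral_inv)
  finally show ?thesis .
qed

lemma inv_measure_eq: "inv_measure = \<mu>"
proof (rule measure_eqI)
  show "sets inv_measure = sets \<mu>" by (simp add: sets_inv_measure sets_haar)
  fix B assume "B \<in> sets inv_measure"
  then have [measurable]: "B \<in> sets (borel_of T)" by (simp add: sets_inv_measure)
  have "emeasure inv_measure B = (\<integral>\<^sup>+ x. indicator B x \<partial>inv_measure)"
    by (simp add: sets_inv_measure)
  also have "\<dots> = (\<integral>\<^sup>+ x. indicator B (inv x) \<partial>\<mu>)"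
    by (rule nn_integral_inv_measure) measurable
  also have "\<dots> = (\<integral>\<^sup>+ x. indicator B x \<partial>\<mu>)"
    by (rule nn_integral_inv) measurable
  finally show "emeasure inv_measure B = emeasure \<mu> B" by (simp add: sets_haar)
qed

lemma fundamental_domain_covolume:
  obtains F where "fundamental_domain G T \<Gamma> F" "emeasure \<mu> F \<noteq> 0" "emeasure \<mu> F < \<infinity>"
    "covolume G T \<mu> \<Gamma> = emeasure \<mu> F"
proof -
  obtain F where F: "fundamental_domain G T \<Gamma> F" "emeasure \<mu> F < \<infinity>" "emeasure \<mu> F \<noteq> 0"
    using finite_fundamental_domain by (auto simp: inv_measure_eq)
  have "covolume G T \<mu> \<Gamma> = emeasure \<mu> F"
    unfolding covolume_def
    using F(1) fundamental_domain_measure_unique[OF sets_haar nn_integral_right_translate[OF _ lattice_carrier]]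
    by (intro the_equality) blast+
  then show thesis using that F by blast
qed

text \<open>For two measures that are invariant under inversion and both translations, the comparison formula
  reads \<open>\<mu> U \<integral> \<psi> d\<nu> = \<nu> U \<integral> \<psi> d\<mu>\<close>, so they are proportional.\<close>

lemma haar_finite_integral:
  assumes \<nu>: "haar G T \<nu>" and [measurable]: "\<psi> \<in> borel_measurable (borel_of T)"
    and fin: "(\<integral>\<^sup>+ x. \<psi> x \<partial>\<mu>) < \<infinity>"
  shows "(\<integral>\<^sup>+ x. \<psi> x \<partial>\<nu>) < \<infinity>"
proof -
  interpret L: haar_lattice G T \<nu> \<Gamma>
    using \<nu> uniform_lattice_axioms by (simp add: haar_lattice_def)
  obtain U where U: "openin T U" "\<one> \<in> U" "emeasure \<nu> U \<noteq> 0" "emeasure \<nu> U < \<infinity>"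
    using L.open_nonempty_finite .
  have [measurable]: "U \<in> sets (borel_of T)" by (rule openin_borel_of[OF U(1)])
  have "emeasure \<mu> U * (\<integral>\<^sup>+ x. \<psi> x \<partial>\<nu>) = (\<integral>\<^sup>+ x. indicator U x \<partial>\<mu>) * (\<integral>\<^sup>+ y. \<psi> (inv y) \<partial>\<nu>)"
    by (simp add: sets_haar L.nn_integral_inv)
  also have "\<dots> = (\<integral>\<^sup>+ x. \<psi> x * (\<integral>\<^sup>+ y. indicator U (y \<otimes> x) \<partial>\<nu>) \<partial>\<mu>)"
    by (rule haar_comparison[OF \<nu>]) measurable
  also have "\<dots> = (\<integral>\<^sup>+ x. \<psi> x * emeasure \<nu> U \<partial>\<mu>)"
    by (rule nn_integral_cong)
      (simp add: L.nn_integral_right_translate[where \<phi> = "indicator U"] L.sets_haar)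
  also have "\<dots> = (\<integral>\<^sup>+ x. \<psi> x \<partial>\<mu>) * emeasure \<nu> U"
    by (rule nn_integral_multc) measurable
  also have "\<dots> < \<infinity>" using fin U(4) by (simp add: ennreal_mult_less_top)
  finally have "emeasure \<mu> U * (\<integral>\<^sup>+ x. \<psi> x \<partial>\<nu>) < \<infinity>" .
  moreover have "emeasure \<mu> U > 0" using open_positive[OF U(1)] U(2) by blast
  ultimately show ?thesis by (auto simp: ennreal_mult_less_top)
qed

end

section \<open>Square-integrable projective representations\<close>

locale projective_representation = second_countable_group G T
  for G :: "'g monoid" (structure) and T +
  fixes \<rho> :: "'g \<Rightarrow> 'h::complex_hilbert \<Rightarrow> 'h"
  assumes unitary: "\<And>x. x \<in> carrier G \<Longrightarrow> unitary_operator (\<rho> x)"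
    and mult: "\<And>x y. x \<in> carrier G \<Longrightarrow> y \<in> carrier G \<Longrightarrow>
      \<exists>z. cmod z = 1 \<and> (\<forall>v. \<rho> (x \<otimes> y) v = z *\<^sub>C \<rho> x (\<rho> y v))"
    and coefficient_measurable [measurable]:
      "\<And>f v. (\<lambda>x. cinner f (\<rho> x v)) \<in> borel_measurable (borel_of T)"
    and irreducible: "irreducible_representation G \<rho>"
begin

lemma isometry: "x \<in> carrier G \<Longrightarrow> cinner (\<rho> x v) (\<rho> x w) = cinner v w"
  using unitary by (simp add: unitary_operator_def)

lemma cmod_mult:
  assumes "x \<in> carrier G" "y \<in> carrier G"
  shows "cmod (cinner f (\<rho> (x \<otimes> y) v)) = cmod (cinner f (\<rho> x (\<rho> y v)))"
  using mult[OF assms] by (auto simp: cinner_scaleC_right norm_mult)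

text \<open>The operator of the identity is a scalar: it is injective and a multiple of its square.\<close>

lemma cmod_one: "cmod (cinner f (\<rho> \<one> v)) = cmod (cinner f v)"
proof -
  obtain z where z: "cmod z = 1" "\<And>v. \<rho> (\<one> \<otimes> \<one>) v = z *\<^sub>C \<rho> \<one> (\<rho> \<one> v)"
    using mult[of \<one> \<one>] by auto
  interpret U: Vector_Spaces.linear scaleC scaleC "\<rho> \<one>"
    by (rule unitary_operator_linear[OF unitary]) simp
  have "\<rho> \<one> (v - z *\<^sub>C \<rho> \<one> v) = 0"
    using z(2)[of v] by (simp add: U.diff U.scale)
  then have "v = z *\<^sub>C \<rho> \<one> v"
    using unitary_operator_norm[OF unitary[OF one_closed], of "v - z *\<^sub>C \<rho> \<one> v"] by simp
  then have "cmod (cinner f v) = cmod (cinner f (z *\<^sub>C \<rho> \<one> v))" by simp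
  then show ?thesis using z(1) by (simp add: cinner_scaleC_right norm_mult)
qed

text \<open>Up to a phase, \<open>\<rho> (inv x)\<close> is the adjoint of \<open>\<rho> x\<close>.\<close>

lemma cmod_adjoint:
  assumes x: "x \<in> carrier G"
  shows "cmod (cinner (\<rho> (inv x) f) v) = cmod (cinner f (\<rho> x v))"
proof -
  have "cmod (cinner f (\<rho> x v)) = cmod (cinner (\<rho> (inv x) f) (\<rho> (inv x) (\<rho> x v)))"
    using x by (simp add: isometry)
  also have "\<dots> = cmod (cinner (\<rho> (inv x) f) (\<rho> (inv x \<otimes> x) v))"
    using x by (simp only: cmod_mult inv_closed)
  also have "\<dots> = cmod (cinner (\<rho> (inv x) f) v)"
    using x by (simp add: cmod_one)
  finally show ?thesis by simp
qed

lemma coefficient_sq_measurable [measurable]: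
  "(\<lambda>x. sqcoeff f (\<rho> x v)) \<in> borel_measurable (borel_of T)"
  by measurable

end

locale projective_haar_system = haar_lattice G T \<mu> \<Gamma> + projective_representation G T \<rho>
  for G :: "'g monoid" (structure) and T \<mu> \<Gamma> and \<rho> :: "'g \<Rightarrow> 'h::complex_hilbert \<Rightarrow> 'h"
begin

abbreviation coeff_energy :: "'h \<Rightarrow> 'h \<Rightarrow> ennreal" where
  "coeff_energy \<eta> f \<equiv> energy \<mu> (\<lambda>x. \<rho> x \<eta>) f"

lemma energy_form: "energy_form \<mu> (\<lambda>x. \<rho> x \<eta>)"
  by unfold_locales measurable

lemma coeff_energy_invariant:
  assumes a: "a \<in> carrier G"
  shows "coeff_energy \<eta> (\<rho> a f) = coeff_energy \<eta> f"
proof -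
  have "coeff_energy \<eta> (\<rho> a f) = (\<integral>\<^sup>+ x. sqcoeff f (\<rho> (inv a \<otimes> x) \<eta>) \<partial>\<mu>)"
    unfolding energy_def
  proof (rule nn_integral_cong)
    fix x assume "x \<in> space \<mu>"
    then show "sqcoeff (\<rho> a f) (\<rho> x \<eta>)
        = sqcoeff f (\<rho> (inv a \<otimes> x) \<eta>)"
      using a cmod_adjoint[of "inv a" f "\<rho> x \<eta>"] by (simp add: cmod_mult)
  qed
  also have "\<dots> = coeff_energy \<eta> f"
    unfolding energy_def
    by (rule nn_integral_left_translate[where \<phi> = "\<lambda>x. sqcoeff f (\<rho> x \<eta>)"])
      (use a in simp_all)
  finally show ?thesis .
qed

text \<open>This symmetry is where unimodularity enters.\<close>

lemma coeff_energy_swap: "coeff_energy \<eta> f = coeff_energy f \<eta>"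
proof -
  have "coeff_energy \<eta> f = (\<integral>\<^sup>+ x. sqcoeff \<eta> (\<rho> (inv x) f) \<partial>\<mu>)"
    unfolding energy_def
  proof (rule nn_integral_cong)
    fix x assume "x \<in> space \<mu>"
    then show "sqcoeff f (\<rho> x \<eta>) = sqcoeff \<eta> (\<rho> (inv x) f)"
      using cmod_adjoint[of x f \<eta>] cmod_cinner_commute[of \<eta> "\<rho> (inv x) f"] by simp
  qed
  also have "\<dots> = coeff_energy f \<eta>"
    unfolding energy_def by (rule nn_integral_inv) measurable
  finally show ?thesis .
qed

text \<open>The resolvent of an invariant form commutes with the representation, so it is scalar, and then so
  is the form.\<close>

lemma coeff_energy_scalar:
  assumes fin: "\<And>f. coeff_energy \<eta> f < \<infinity>"
  obtains c where "c \<ge> 0" "\<And>f. coeff_energy \<eta> f = ennreal (c * (norm f)\<^sup>2)"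
proof -
  interpret E: energy_form \<mu> "\<lambda>x. \<rho> x \<eta>" by (rule energy_form)
  let ?R = "E.resolvent 1"
  have "\<rho> x (?R v) = ?R (\<rho> x v)" if "x \<in> carrier G" for x v
    using unitary[OF that] coeff_energy_invariant[OF that]
    by (intro E.resolvent_commute) simp_all
  then obtain r :: real where r: "\<And>v. ?R v = r *\<^sub>R v"
    using schur[where A = ?R and \<pi> = \<rho>, OF irreducible unitary E.resolvent_bounded_symmetric] by auto
  \<comment> \<open>The resolvent equation for the scalar resolvent \<open>r\<close>, tested on \<open>v\<close> itself.\<close>
  have eq: "r * enn2real (coeff_energy \<eta> v) + r * (norm v)\<^sup>2 = (norm v)\<^sup>2" for v
  proof -
    have "E.B (?R v) v + cinner (?R v) v = cinner v v"
      using E.resolvent_eq[OF zero_less_one fin, of v v] by simp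
    then have "complex_of_real (r * enn2real (coeff_energy \<eta> v) + r * (norm v)\<^sup>2)
        = complex_of_real ((norm v)\<^sup>2)"
      unfolding r by (simp add: scaleR_scaleC E.B_scaleC_left E.B_self[OF fin] cinner_scaleC_left cinner_self)
    then show ?thesis by (simp only: of_real_eq_iff)
  qed
  obtain e :: 'h where e: "e \<noteq> 0"
    using irreducible by (auto simp: irreducible_representation_def)
  have r0: "r \<noteq> 0" using eq[of e] e by auto
  define c where "c = 1 / r - 1"
  have c: "enn2real (coeff_energy \<eta> v) = c * (norm v)\<^sup>2" for v
  proof -
    have "r * enn2real (coeff_energy \<eta> v) = (1 - r) * (norm v)\<^sup>2"
      using eq[of v] by (simp add: algebra_simps)
    then have "enn2real (coeff_energy \<eta> v) = ((1 - r) * (norm v)\<^sup>2) / r"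
      using r0 by (simp add: nonzero_eq_divide_eq mult.commute)
    also have "\<dots> = c * (norm v)\<^sup>2"
      using r0 by (simp add: c_def left_diff_distrib diff_divide_distrib)
    finally show ?thesis .
  qed
  have "c * (norm e)\<^sup>2 \<ge> 0" unfolding c[symmetric] by simp
  then have "c \<ge> 0" using e by (simp add: zero_le_mult_iff)
  moreover have "coeff_energy \<eta> f = ennreal (c * (norm f)\<^sup>2)" for f
    using E.energy_eq_ennreal[OF fin] by (simp only: c)
  ultimately show thesis using that by blast
qed

text \<open>The symmetry in \<open>f\<close> and \<open>\<eta>\<close> determines the constant up to a factor that does not depend on \<open>\<eta>\<close>.  The
  admissible vectors then form a closed invariant subspace.\<close>

theorem orthogonality_relation:
  assumes \<eta>1: "\<eta>1 \<noteq> 0" "\<And>f. coeff_energy \<eta>1 f < \<infinity>"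
  obtains \<kappa> where "\<kappa> \<ge> 0" "\<And>f \<eta>. coeff_energy \<eta> f = ennreal (\<kappa> * (norm f)\<^sup>2 * (norm \<eta>)\<^sup>2)"
proof -
  obtain c1 where c1: "c1 \<ge> 0" "\<And>f. coeff_energy \<eta>1 f = ennreal (c1 * (norm f)\<^sup>2)"
    using coeff_energy_scalar[OF \<eta>1(2)] by blast
  define \<kappa> where "\<kappa> = c1 / (norm \<eta>1)\<^sup>2"
  have \<kappa>: "\<kappa> \<ge> 0" using c1(1) by (simp add: \<kappa>_def)
  let ?A = "{\<eta>. \<forall>f. coeff_energy \<eta> f < \<infinity>}"
  have rel: "coeff_energy \<eta> f = ennreal (\<kappa> * (norm f)\<^sup>2 * (norm \<eta>)\<^sup>2)" if \<eta>: "\<eta> \<in> ?A" for \<eta> f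
  proof -
    obtain c where c: "c \<ge> 0" "\<And>f. coeff_energy \<eta> f = ennreal (c * (norm f)\<^sup>2)"
      using coeff_energy_scalar[of \<eta>] \<eta> by blast
    have "ennreal (c * (norm \<eta>1)\<^sup>2) = ennreal (c1 * (norm \<eta>)\<^sup>2)"
      using coeff_energy_swap[of \<eta> \<eta>1] by (simp only: c(2) c1(2))
    then have "c * (norm \<eta>1)\<^sup>2 = c1 * (norm \<eta>)\<^sup>2"
      using c(1) c1(1) by (subst (asm) ennreal_inj) simp_all
    then have "c = \<kappa> * (norm \<eta>)\<^sup>2" using \<eta>1(1) by (simp add: \<kappa>_def field_simps)
    then show ?thesis by (simp add: c(2) mult_ac)
  qed
  have "complex_vector.subspace ?A"
  proof (unfold complex_vector.subspace_def, intro conjI ballI allI)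
    show "0 \<in> ?A" by (auto simp: coeff_energy_swap[of 0])
  next
    fix a b assume ab: "a \<in> ?A" "b \<in> ?A"
    have "coeff_energy (a + b) f < \<infinity>" for f
    proof -
      interpret E: energy_form \<mu> "\<lambda>x. \<rho> x f" by (rule energy_form)
      have "E.Q a < \<infinity>" "E.Q b < \<infinity>"
        using ab unfolding coeff_energy_swap[of f] by blast+
      then show ?thesis
        unfolding coeff_energy_swap[of _ f] by (rule E.finite_energy_add)
    qed
    then show "a + b \<in> ?A" by blast
  next
    fix z a assume a: "a \<in> ?A"
    have "coeff_energy (z *\<^sub>C a) f < \<infinity>" for f
    proof -
      interpret E: energy_form \<mu> "\<lambda>x. \<rho> x f" by (rule energy_form)
      have "E.Q a < \<infinity>" using a unfolding coeff_energy_swap[of f] by blast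
      then show ?thesis
        unfolding coeff_energy_swap[of _ f] by (rule E.finite_energy_scaleC)
    qed
    then show "z *\<^sub>C a \<in> ?A" by blast
  qed
  moreover have "closed ?A"
    unfolding closed_sequential_limits
  proof (intro allI impI, elim conjE)
    fix v :: "nat \<Rightarrow> 'h" and u assume v: "\<forall>n. v n \<in> ?A" and lim: "v \<longlonglongrightarrow> u"
    have "coeff_energy u f < \<infinity>" for f
    proof -
      interpret E: energy_form \<mu> "\<lambda>x. \<rho> x f" by (rule energy_form)
      have "\<forall>\<^sub>F n in sequentially. norm (v n) < norm u + 1"
        using tendsto_norm[OF lim] by (rule order_tendstoD) simp
      then have "\<forall>\<^sub>F n in sequentially. coeff_energy f (v n)
          \<le> ennreal (\<kappa> * (norm f)\<^sup>2 * (norm u + 1)\<^sup>2)"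
      proof eventually_elim
        case (elim n)
        have "v n \<in> ?A" using v by blast
        then show ?case
          unfolding coeff_energy_swap[of f "v n"] rel[OF \<open>v n \<in> ?A\<close>]
          using elim \<kappa> by (intro ennreal_leI mult_left_mono power_mono) simp_all
      qed
      from E.energy_le_of_tendsto[OF lim this] show ?thesis
        unfolding coeff_energy_swap[of u f] by (rule le_less_trans) simp
    qed
    then show "u \<in> ?A" by blast
  qed
  moreover have "\<forall>a\<in>carrier G. \<rho> a ` ?A \<subseteq> ?A"
  proof (intro ballI subsetI)
    fix a w assume a: "a \<in> carrier G" and "w \<in> \<rho> a ` ?A"
    then obtain v where v: "w = \<rho> a v" "v \<in> ?A" by blast
    have "coeff_energy w f = coeff_energy v f" for f
      unfolding v(1) coeff_energy_swap[of _ f] by (rule coeff_energy_invariant[OF a])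
    then show "w \<in> ?A" using v(2) by simp
  qed
  moreover have "?A \<noteq> {0}" using \<eta>1 by blast
  ultimately have "?A = UNIV"
    using irreducible unfolding irreducible_representation_def by blast
  then show thesis using that \<kappa> rel by blast
qed

text \<open>The dual vector \<open>h = (S + \<epsilon>)\<^sup>-\<^sup>1 \<eta>\<close>, with \<open>S\<close> the frame operator of the orbit of \<open>\<eta>\<close> under
  the lattice, satisfies \<open>\<langle>\<eta>, h\<rangle> \<le> 1\<close>, while the mixed frame operator of \<open>\<eta>\<close> and \<open>h\<close> is
  \<open>1 - \<epsilon> (S + \<epsilon>)\<^sup>-\<^sup>1\<close> and tends weakly to the identity.  Taking its quadratic form at \<open>\<rho> (inv x) f\<close> and
  integrating over a fundamental domain turns the sum over the lattice into the integral of the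
  orthogonality relation, whose value is \<open>\<kappa> \<langle>\<eta>, h\<rangle> \<le> \<kappa>\<close>.  All products are expressed by polarisation,
  that is by the orbits of \<open>h + \<eta>\<close> and \<open>h - \<eta>\<close>, and Fatou's lemma takes the limit \<open>\<epsilon> \<rightarrow> 0\<close>.\<close>

theorem fundamental_domain_measure_le:
  assumes \<kappa>: "\<kappa> \<ge> 0" "\<And>f \<eta>. coeff_energy \<eta> f = ennreal (\<kappa> * (norm f)\<^sup>2 * (norm \<eta>)\<^sup>2)"
    and complete: "complete_family {\<rho> \<gamma> \<eta> | \<gamma>. \<gamma> \<in> \<Gamma>}"
    and F: "fundamental_domain G T \<Gamma> F"
  shows "emeasure \<mu> F \<le> ennreal \<kappa>"
proof -
  interpret S: energy_form "count_space \<Gamma>" "\<lambda>\<gamma>. \<rho> \<gamma> \<eta>"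
    by unfold_locales simp
  have [measurable]: "F \<in> sets (borel_of T)"
    using F by (simp add: fundamental_domain_def)
  have complete': "complete_family ((\<lambda>\<gamma>. \<rho> \<gamma> \<eta>) ` \<Gamma>)"
    using complete by (simp add: Setcompr_eq_image)
  have point: "sqcoeff f (\<rho> \<gamma> \<eta>) \<le> S.Q f" if "\<gamma> \<in> \<Gamma>" for \<gamma> f
    unfolding energy_def using that by (rule nn_integral_ge_point)
  have invariant: "S.Q (\<rho> a f) = S.Q f" if a: "a \<in> \<Gamma>" for a f
  proof -
    have aG: "a \<in> carrier G" using a by (rule lattice_carrier)
    have ia: "inv a \<in> \<Gamma>" using subgroup.m_inv_closed[OF lattice_subgroup a] .
    have "S.Q (\<rho> a f) = (\<integral>\<^sup>+ \<gamma>. sqcoeff f (\<rho> (inv a \<otimes> \<gamma>) \<eta>) \<partial>count_space \<Gamma>)"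
      unfolding energy_def
    proof (rule nn_integral_cong)
      fix \<gamma> assume "\<gamma> \<in> space (count_space \<Gamma>)"
      then have "\<gamma> \<in> carrier G" by (simp add: lattice_carrier)
      then show "sqcoeff (\<rho> a f) (\<rho> \<gamma> \<eta>)
          = sqcoeff f (\<rho> (inv a \<otimes> \<gamma>) \<eta>)"
        using aG cmod_adjoint[of "inv a" f "\<rho> \<gamma> \<eta>"] by (simp add: cmod_mult)
    qed
    also have "\<dots> = S.Q f"
      unfolding energy_def
    proof (rule nn_integral_bij_count_space)
      show "bij_betw (\<lambda>\<gamma>. inv a \<otimes> \<gamma>) \<Gamma> \<Gamma>"
      proof (rule bij_betwI[where g = "\<lambda>\<gamma>. a \<otimes> \<gamma>"])
        show "(\<lambda>\<gamma>. inv a \<otimes> \<gamma>) \<in> \<Gamma> \<rightarrow> \<Gamma>" "(\<lambda>\<gamma>. a \<otimes> \<gamma>) \<in> \<Gamma> \<rightarrow> \<Gamma>"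
          using a ia subgroup.m_closed[OF lattice_subgroup] by auto
      qed (use aG lattice_carrier in \<open>simp_all add: m_assoc[symmetric]\<close>)
    qed
    finally show ?thesis .
  qed
  define \<epsilon> where "\<epsilon> = (\<lambda>n. inverse (real (Suc n)))"
  have \<epsilon>: "\<epsilon> n > 0" "\<epsilon> \<longlonglongrightarrow> 0" for n
    unfolding \<epsilon>_def by (simp, rule LIMSEQ_inverse_real_of_nat)
  let ?R = "\<lambda>n. S.resolvent (\<epsilon> n)"
  define h where "h = (\<lambda>n. ?R n \<eta>)"
  have R_commute: "\<rho> \<gamma> (?R n v) = ?R n (\<rho> \<gamma> v)" if "\<gamma> \<in> \<Gamma>" for \<gamma> n v
    using unitary[OF lattice_carrier[OF that]] invariant[OF that] \<epsilon>(1)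
    by (intro S.resolvent_commute) simp_all
  have h_coefficient: "cinner f (\<rho> \<gamma> (h n)) = cinner (?R n f) (\<rho> \<gamma> \<eta>)" if "\<gamma> \<in> \<Gamma>" for \<gamma> n f
    unfolding h_def R_commute[OF that] by (rule S.resolvent_symmetric[OF \<epsilon>(1), symmetric])
  \<comment> \<open>Up to a phase the orbit contains \<open>\<eta>\<close>, so \<open>|\<langle>\<eta>, h\<rangle>|\<^sup>2 \<le> Q h \<le> \<langle>\<eta>, h\<rangle>\<close>.\<close>
  have h_bound: "Re (cinner (h n) \<eta>) \<le> 1" for n
  proof -
    have one: "\<one> \<in> \<Gamma>" using subgroup.one_closed[OF lattice_subgroup] .
    have fin: "S.Q (h n) < \<infinity>" unfolding h_def by (rule S.resolvent_finite[OF \<epsilon>(1)])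
    have "sqcoeff (h n) \<eta> \<le> ennreal (enn2real (S.Q (h n)))"
      using point[OF one, of "h n"] unfolding cmod_one S.energy_eq_ennreal[OF fin, symmetric] .
    then have "(cmod (cinner (h n) \<eta>))\<^sup>2 \<le> enn2real (S.Q (h n))"
      by (simp add: ennreal_le_iff)
    also have "\<dots> \<le> Re (cinner \<eta> (h n))"
      using arg_cong[OF S.resolvent_energy[OF \<epsilon>(1), of n \<eta>], of Re] \<epsilon>(1)[of n] zero_le_power2[of "norm (h n)"]
      unfolding h_def by (smt (verit) Re_complex_of_real mult_nonneg_nonneg)
    also have "\<dots> = Re (cinner (h n) \<eta>)" by (rule Re_cinner_commute)
    finally have "(cmod (cinner (h n) \<eta>))\<^sup>2 \<le> cmod (cinner (h n) \<eta>)"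
      using complex_Re_le_cmod order_trans by blast
    then have "cmod (cinner (h n) \<eta>) \<le> 1"
      by (smt (verit) norm_ge_zero power2_eq_square mult_le_cancel_left1 mult_less_cancel_left1)
    then show ?thesis using complex_Re_le_cmod order_trans by blast
  qed
  obtain e :: 'h where e: "e \<noteq> 0"
    using irreducible by (auto simp: irreducible_representation_def)
  define f where "f = inverse (norm e) *\<^sub>R e"
  have f: "norm f = 1" using e by (simp add: f_def)
  define w where "w = (\<lambda>x. \<rho> (inv x) f)"
  have w_norm: "norm (w x) = 1" if "x \<in> carrier G" for x
    using unitary_operator_norm[OF unitary[of "inv x"]] that f by (simp add: w_def)
  \<comment> \<open>The quadratic form of the orbit of \<open>v\<close> at the moving vector \<open>\<rho> (inv x) f\<close>.\<close>
  define s where "s = (\<lambda>v x. energy (count_space \<Gamma>) (\<lambda>\<gamma>. \<rho> \<gamma> v) (w x))"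
  have s_eq: "s v x = (\<integral>\<^sup>+ \<gamma>. sqcoeff f (\<rho> (x \<otimes> \<gamma>) v) \<partial>count_space \<Gamma>)"
    if "x \<in> carrier G" for v x
    unfolding s_def energy_def
    by (rule nn_integral_cong) (simp add: w_def cmod_adjoint cmod_mult that lattice_carrier)
  have s_meas [measurable]: "s v \<in> borel_measurable (borel_of T)" for v
  proof -
    interpret C: sigma_finite_measure "count_space \<Gamma>"
      by (rule sigma_finite_measure_count_space_countable[OF lattice_countable])
    have "(\<lambda>(\<gamma>, x). sqcoeff f (\<rho> (x \<otimes> \<gamma>) v))
        \<in> borel_measurable (count_space \<Gamma> \<Otimes>\<^sub>M borel_of T)"
    proof (rule measurable_pair_measure_countable1[OF lattice_countable])
      fix \<gamma> assume "\<gamma> \<in> \<Gamma>"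
      then have [measurable]: "\<gamma> \<in> space (borel_of T)" by (simp add: lattice_carrier)
      show "(\<lambda>x. case (\<gamma>, x) of (\<gamma>, x) \<Rightarrow> sqcoeff f (\<rho> (x \<otimes> \<gamma>) v)) \<in> borel_measurable (borel_of T)"
        by simp
    qed
    from measurable_compose[OF measurable_pair_swap' this]
    have "(\<lambda>(x, \<gamma>). sqcoeff f (\<rho> (x \<otimes> \<gamma>) v))
        \<in> borel_measurable (borel_of T \<Otimes>\<^sub>M count_space \<Gamma>)"
      by (simp add: case_prod_unfold)
    from C.borel_measurable_nn_integral[OF this]
    have "(\<lambda>x. \<integral>\<^sup>+ \<gamma>. sqcoeff f (\<rho> (x \<otimes> \<gamma>) v) \<partial>count_space \<Gamma>)
        \<in> borel_measurable (borel_of T)" .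
    then show ?thesis
      by (rule measurable_cong[THEN iffD2, rotated]) (simp add: s_eq)
  qed
  have s_integral: "(\<integral>\<^sup>+ x. indicator F x * s v x \<partial>\<mu>) = ennreal (\<kappa> * (norm v)\<^sup>2)" for v
  proof -
    have "coeff_energy v f = (\<integral>\<^sup>+ x. indicator F x *
        (\<integral>\<^sup>+ \<gamma>. sqcoeff f (\<rho> (x \<otimes> \<gamma>) v) \<partial>count_space \<Gamma>) \<partial>\<mu>)"
      unfolding energy_def
      by (rule nn_integral_unfold[OF sets_haar nn_integral_right_translate[OF _ lattice_carrier] F]) simp_all
    also have "\<dots> = (\<integral>\<^sup>+ x. indicator F x * s v x \<partial>\<mu>)"
      by (rule nn_integral_cong) (simp add: s_eq)
    finally show ?thesis by (simp add: \<kappa>(2) f)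
  qed
  define g where "g = (\<lambda>n x. indicator F x * s (h n + \<eta>) x - indicator F x * s (h n - \<eta>) x)"
  \<comment> \<open>For almost every \<open>x\<close> in \<open>F\<close>, the moving vector lies in the form domain of the orbit of \<open>\<eta>\<close>, which need not be the
    whole space.\<close>
  have AE_finite: "AE x in \<mu>. indicator F x * s \<eta> x \<noteq> \<infinity>"
    by (rule nn_integral_noteq_infinite) (simp_all add: s_integral)
  have split: "s (h n + \<eta>) x = s (h n - \<eta>) x + ennreal (4 * (1 - \<epsilon> n * Re (cinner (?R n (w x)) (w x))))
      \<and> s (h n - \<eta>) x < \<infinity>" if x: "x \<in> carrier G" and fin: "s \<eta> x \<noteq> \<infinity>" for n x
  proof -
    let ?u = "?R n (w x)"
    have w_fin: "S.Q (w x) < \<infinity>" using fin by (simp add: s_def less_top)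
    have u_fin: "S.Q ?u < \<infinity>" by (rule S.resolvent_finite[OF \<epsilon>(1)])
    have plus: "s (h n + \<eta>) x = S.Q (?u + w x)" and minus: "s (h n - \<eta>) x = S.Q (?u - w x)"
      unfolding s_def energy_def
    proof -
      have "cinner (w x) (\<rho> \<gamma> (h n + \<eta>)) = cinner (?u + w x) (\<rho> \<gamma> \<eta>)"
        "cinner (w x) (\<rho> \<gamma> (h n - \<eta>)) = cinner (?u - w x) (\<rho> \<gamma> \<eta>)" if "\<gamma> \<in> \<Gamma>" for \<gamma>
      proof -
        interpret U: Vector_Spaces.linear scaleC scaleC "\<rho> \<gamma>"
          by (rule unitary_operator_linear[OF unitary[OF lattice_carrier[OF that]]])
        show "cinner (w x) (\<rho> \<gamma> (h n + \<eta>)) = cinner (?u + w x) (\<rho> \<gamma> \<eta>)"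
          "cinner (w x) (\<rho> \<gamma> (h n - \<eta>)) = cinner (?u - w x) (\<rho> \<gamma> \<eta>)"
          by (simp_all add: U.add U.diff cinner_algebra h_coefficient[OF that])
      qed
      then show "(\<integral>\<^sup>+ \<gamma>. sqcoeff (w x) (\<rho> \<gamma> (h n + \<eta>)) \<partial>count_space \<Gamma>)
          = (\<integral>\<^sup>+ \<gamma>. sqcoeff (?u + w x) (\<rho> \<gamma> \<eta>) \<partial>count_space \<Gamma>)"
        "(\<integral>\<^sup>+ \<gamma>. sqcoeff (w x) (\<rho> \<gamma> (h n - \<eta>)) \<partial>count_space \<Gamma>)
          = (\<integral>\<^sup>+ \<gamma>. sqcoeff (?u - w x) (\<rho> \<gamma> \<eta>) \<partial>count_space \<Gamma>)"
        by (auto intro!: nn_integral_cong)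
    qed
    have pos: "0 \<le> 1 - \<epsilon> n * Re (cinner ?u (w x))"
    proof -
      have "Re (cinner ?u (w x)) \<le> norm ?u"
        using cauchy_schwarz[of ?u "w x"] complex_Re_le_cmod[of "cinner ?u (w x)"] w_norm[OF x] by simp
      then have "\<epsilon> n * Re (cinner ?u (w x)) \<le> \<epsilon> n * norm ?u"
        using \<epsilon>(1)[of n] by simp
      also have "\<dots> \<le> 1" using S.resolvent_norm[OF \<epsilon>(1), of n "w x"] w_norm[OF x] by simp
      finally show ?thesis by simp
    qed
    have "Re (S.B ?u (w x)) = 1 - \<epsilon> n * Re (cinner ?u (w x))"
      using arg_cong[OF S.resolvent_eq[OF \<epsilon>(1) w_fin, of n "w x"], of Re] w_norm[OF x]
      by (simp add: Re_cinner_self)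
    then have "enn2real (S.Q (?u + w x)) = enn2real (S.Q (?u - w x)) + 4 * (1 - \<epsilon> n * Re (cinner ?u (w x)))"
      using S.energy_polarisation[OF u_fin w_fin] by simp
    then have "ennreal (enn2real (S.Q (?u + w x)))
        = ennreal (enn2real (S.Q (?u - w x))) + ennreal (4 * (1 - \<epsilon> n * Re (cinner ?u (w x))))"
      using pos by (simp add: ennreal_plus)
    then show ?thesis
      using S.finite_energy_add[OF u_fin w_fin] S.finite_energy_diff[OF u_fin w_fin]
      by (simp add: plus minus)
  qed
  have g_eq: "g n x = indicator F x * ennreal (4 * (1 - \<epsilon> n * Re (cinner (?R n (w x)) (w x))))"
    if "x \<in> carrier G" "indicator F x * s \<eta> x \<noteq> \<infinity>" for n x
  proof (cases "x \<in> F")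
    case True
    then show ?thesis using split[OF that(1), of n] that(2)
      by (auto simp: g_def ennreal_add_diff_cancel_left)
  qed (simp add: g_def)
  have g_integral: "(\<integral>\<^sup>+ x. g n x \<partial>\<mu>) \<le> ennreal (4 * \<kappa>)" for n
  proof -
    have "(\<integral>\<^sup>+ x. g n x \<partial>\<mu>) = (\<integral>\<^sup>+ x. indicator F x * s (h n + \<eta>) x \<partial>\<mu>) - (\<integral>\<^sup>+ x. indicator F x * s (h n - \<eta>) x \<partial>\<mu>)"
      unfolding g_def
    proof (rule nn_integral_diff)
      show "AE x in \<mu>. indicator F x * s (h n - \<eta>) x \<le> indicator F x * s (h n + \<eta>) x"
        using AE_finite AE_space
      proof eventually_elim
        case (elim x)
        then show ?case using split[of x n] by (cases "x \<in> F") auto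
      qed
    qed (simp_all add: s_integral)
    also have "\<dots> = ennreal (\<kappa> * (norm (h n + \<eta>))\<^sup>2 - \<kappa> * (norm (h n - \<eta>))\<^sup>2)"
      unfolding s_integral using \<kappa>(1) by (intro ennreal_minus) simp
    also have "\<kappa> * (norm (h n + \<eta>))\<^sup>2 - \<kappa> * (norm (h n - \<eta>))\<^sup>2 = 4 * \<kappa> * Re (cinner (h n) \<eta>)"
      using Re_cinner_commute[of \<eta> "h n"] by (simp add: norm_add_sq norm_diff_sq algebra_simps)
    also have "ennreal \<dots> \<le> ennreal (4 * \<kappa>)"
      using \<kappa>(1) h_bound[of n] by (intro ennreal_leI) (simp add: mult_left_le)
    finally show ?thesis .
  qed
  have g_liminf: "AE x in \<mu>. liminf (\<lambda>n. g n x) = 4 * indicator F x"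
    using AE_finite AE_space
  proof eventually_elim
    case (elim x)
    then have x: "x \<in> carrier G" by simp
    have "(\<lambda>n. \<epsilon> n * Re (cinner (?R n (w x)) (w x))) \<longlonglongrightarrow> 0"
      by (rule S.resolvent_weakly_null[OF \<epsilon> point complete'])
    then have "(\<lambda>n. ennreal (4 * (1 - \<epsilon> n * Re (cinner (?R n (w x)) (w x))))) \<longlonglongrightarrow> ennreal (4 * (1 - 0))"
      by (intro tendsto_intros)
    then have "(\<lambda>n. indicator F x * ennreal (4 * (1 - \<epsilon> n * Re (cinner (?R n (w x)) (w x)))))
        \<longlonglongrightarrow> 4 * indicator F x"
      by (auto simp: indicator_def)
    then have "(\<lambda>n. g n x) \<longlonglongrightarrow> 4 * indicator F x"
      using g_eq[OF x elim(1)] by simp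
    then show ?case by (rule lim_imp_Liminf[OF trivial_limit_sequentially])
  qed
  have "4 * emeasure \<mu> F = (\<integral>\<^sup>+ x. 4 * indicator F x \<partial>\<mu>)"
    by (subst nn_integral_cmult) (auto simp: sets_haar intro!: borel_measurable_indicator)
  also have "\<dots> = (\<integral>\<^sup>+ x. liminf (\<lambda>n. g n x) \<partial>\<mu>)"
    using g_liminf by (intro nn_integral_cong_AE) (auto elim: eventually_mono)
  also have "\<dots> \<le> liminf (\<lambda>n. \<integral>\<^sup>+ x. g n x \<partial>\<mu>)"
    by (rule nn_integral_liminf) (simp add: g_def)
  also have "\<dots> \<le> limsup (\<lambda>n. \<integral>\<^sup>+ x. g n x \<partial>\<mu>)"
    by (rule Liminf_le_Limsup) simp
  also have "\<dots> \<le> ennreal (4 * \<kappa>)"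
    using g_integral by (intro Limsup_bounded) simp
  also have "\<dots> = 4 * ennreal \<kappa>"
    using \<kappa>(1) by (simp add: ennreal_mult)
  finally show ?thesis
    by (simp add: ennreal_mult_le_mult_iff)
qed

text \<open>The constant is positive because it bounds the covolume, which is positive.\<close>

corollary completeness_density:
  assumes "\<eta>1 \<noteq> 0" "\<And>f. coeff_energy \<eta>1 f < \<infinity>"
    and "complete_family {\<rho> \<gamma> \<eta> | \<gamma>. \<gamma> \<in> \<Gamma>}"
  obtains \<kappa> where "\<kappa> > 0" "\<And>f \<eta>. coeff_energy \<eta> f = ennreal (\<kappa> * (norm f)\<^sup>2 * (norm \<eta>)\<^sup>2)"
    "covolume G T \<mu> \<Gamma> \<le> ennreal \<kappa>"
proof -
  obtain \<kappa> where \<kappa>: "\<kappa> \<ge> 0" "\<And>f \<eta>. coeff_energy \<eta> f = ennreal (\<kappa> * (norm f)\<^sup>2 * (norm \<eta>)\<^sup>2)"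
    using orthogonality_relation[OF assms(1,2)] by blast
  obtain F where F: "fundamental_domain G T \<Gamma> F" "emeasure \<mu> F \<noteq> 0"
    "covolume G T \<mu> \<Gamma> = emeasure \<mu> F"
    using fundamental_domain_covolume by blast
  have le: "emeasure \<mu> F \<le> ennreal \<kappa>"
    by (rule fundamental_domain_measure_le[OF \<kappa> assms(3) F(1)])
  then have "\<kappa> \<noteq> 0" using F(2) by auto
  then show thesis using that[of \<kappa>] \<kappa> le F(3) by simp
qed

end

section \<open>The quotient by a projective stabiliser\<close>

text \<open>The group is connected as the image of a vector space under the exponential map.\<close>

lemma exponential_lie_group_topological:
  fixes A :: "('g, 'v::real_normed_vector) atlas"
  assumes "exponential_lie_group G T A"
  shows "topological_group G T" "second_countable T" "connected_space T"
proof -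
  have lie: "lie_group G T A" using assms by (simp add: exponential_lie_group_def)
  then show "topological_group G T"
    by (simp add: lie_group_def topological_group_def smooth_map_def)
  show "second_countable T"
    using lie by (simp add: lie_group_def smooth_manifold_def)
  obtain \<phi> where "diffeomorphism euclidean vector_atlas T A (lie_exp G T A \<phi>)"
    using assms by (auto simp: exponential_lie_group_def)
  then have "continuous_map euclidean T (lie_exp G T A \<phi>)" "lie_exp G T A \<phi> ` UNIV = topspace T"
    by (auto simp: diffeomorphism_def smooth_map_def bij_betw_def)
  then show "connected_space T"
    using connectedin_continuous_map_image[of euclidean T "lie_exp G T A \<phi>" UNIV]
    by (simp add: connectedin_topspace connected_UNIV)
qed

lemma continuous_map_borel_measurable:
  assumes "continuous_map T euclidean f"
  shows "f \<in> borel_measurable (borel_of T)"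
proof (rule borel_measurableI)
  fix S :: "'b set" assume "open S"
  then have "openin T {x \<in> topspace T. f x \<in> S}"
    using openin_continuous_map_preimage[OF assms, of S] by simp
  then have "{x \<in> topspace T. f x \<in> S} \<in> sets (borel_of T)" by (rule openin_borel_of)
  moreover have "f -` S \<inter> space (borel_of T) = {x \<in> topspace T. f x \<in> S}" by auto
  ultimately show "f -` S \<inter> space (borel_of T) \<in> sets (borel_of T)" by simp
qed

locale stabiliser_quotient = second_countable_group G T
  for G :: "'g monoid" (structure) and T +
  fixes \<pi> :: "'g \<Rightarrow> 'h::complex_hilbert \<Rightarrow> 'h" and \<eta>\<^sub>0 :: 'h
  assumes connected: "connected_space T"
    and representation: "unitary_representation G T \<pi>"
    and irreducible: "irreducible_representation G \<pi>"
    and nonzero: "\<eta>\<^sub>0 \<noteq> 0"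
    and quotient_group: "group (G LMod projective_stabiliser G \<pi> \<eta>\<^sub>0)"
begin

definition H :: "'g set" where "H = projective_stabiliser G \<pi> \<eta>\<^sub>0"

abbreviation X :: "'g set monoid" where "X \<equiv> G LMod H"

abbreviation p :: "'g \<Rightarrow> 'g set" where "p \<equiv> \<lambda>g. g <#\<^bsub>G\<^esub> H"

abbreviation TX :: "'g set topology" where "TX \<equiv> quotient_topology T p"

lemma \<pi>_unitary: "x \<in> carrier G \<Longrightarrow> unitary_operator (\<pi> x)"
  using representation by (simp add: unitary_representation_def)

lemma \<pi>_linear: "x \<in> carrier G \<Longrightarrow> clinear (\<pi> x)"
  using \<pi>_unitary by (rule unitary_operator_linear)

lemma
  assumes "x \<in> carrier G"
  shows \<pi>_scaleC: "\<pi> x (c *\<^sub>C v) = c *\<^sub>C \<pi> x v"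
    and \<pi>_add: "\<pi> x (v + w) = \<pi> x v + \<pi> x w"
    and \<pi>_diff: "\<pi> x (v - w) = \<pi> x v - \<pi> x w"
proof -
  interpret P: Vector_Spaces.linear scaleC scaleC "\<pi> x" by (rule \<pi>_linear[OF assms])
  show "\<pi> x (c *\<^sub>C v) = c *\<^sub>C \<pi> x v" "\<pi> x (v + w) = \<pi> x v + \<pi> x w"
    "\<pi> x (v - w) = \<pi> x v - \<pi> x w"
    by (rule P.scale P.add P.diff)+
qed

lemma \<pi>_mult: "x \<in> carrier G \<Longrightarrow> y \<in> carrier G \<Longrightarrow> \<pi> (x \<otimes> y) v = \<pi> x (\<pi> y v)"
  using representation by (simp add: unitary_representation_def)

lemma \<pi>_isometry: "x \<in> carrier G \<Longrightarrow> cinner (\<pi> x v) (\<pi> x w) = cinner v w"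
  using \<pi>_unitary by (simp add: unitary_operator_def)

lemma \<pi>_continuous: "continuous_map T euclidean (\<lambda>x. \<pi> x v)"
  using representation by (simp add: unitary_representation_def)

lemma \<pi>_inject: "x \<in> carrier G \<Longrightarrow> \<pi> x v = \<pi> x w \<Longrightarrow> v = w"
proof -
  assume x: "x \<in> carrier G" and eq: "\<pi> x v = \<pi> x w"
  have "\<pi> x (v - w) = 0" using \<pi>_diff[OF x] eq by simp
  then show "v = w" using unitary_operator_norm[OF \<pi>_unitary[OF x], of "v - w"] by simp
qed

lemma \<pi>_one: "\<pi> \<one> v = v"
  using \<pi>_inject[OF one_closed] \<pi>_mult[of \<one> \<one> v] by simp

lemma \<pi>_inv: "x \<in> carrier G \<Longrightarrow> \<pi> (inv x) (\<pi> x v) = v"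
  by (simp add: \<pi>_mult[symmetric] \<pi>_one)

lemma H_iff: "x \<in> H \<longleftrightarrow> x \<in> carrier G \<and> (\<exists>z. cmod z = 1 \<and> \<pi> x \<eta>\<^sub>0 = z *\<^sub>C \<eta>\<^sub>0)"
  by (simp add: H_def projective_stabiliser_def)

lemma H_carrier: "x \<in> H \<Longrightarrow> x \<in> carrier G"
  by (simp add: H_iff)

lemma H_subgroup: "subgroup H G"
proof
  show "H \<subseteq> carrier G" by (auto simp: H_iff)
  show "\<one> \<in> H" unfolding H_iff by (intro conjI exI[of _ 1]) (simp_all add: \<pi>_one)
next
  fix x y assume "x \<in> H" "y \<in> H"
  then obtain a b where ab: "x \<in> carrier G" "y \<in> carrier G" "cmod a = 1" "cmod b = 1"
    "\<pi> x \<eta>\<^sub>0 = a *\<^sub>C \<eta>\<^sub>0" "\<pi> y \<eta>\<^sub>0 = b *\<^sub>C \<eta>\<^sub>0"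
    by (auto simp: H_iff)
  then have "\<pi> (x \<otimes> y) \<eta>\<^sub>0 = (b * a) *\<^sub>C \<eta>\<^sub>0" "cmod (b * a) = 1"
    by (simp_all add: \<pi>_mult \<pi>_scaleC norm_mult)
  then show "x \<otimes> y \<in> H" using ab(1,2) unfolding H_iff by blast
next
  fix x assume "x \<in> H"
  then obtain a where a: "x \<in> carrier G" "cmod a = 1" "\<pi> x \<eta>\<^sub>0 = a *\<^sub>C \<eta>\<^sub>0"
    by (auto simp: H_iff)
  have a0: "a \<noteq> 0" using a(2) by auto
  have "\<eta>\<^sub>0 = a *\<^sub>C \<pi> (inv x) \<eta>\<^sub>0"
    using \<pi>_inv[OF a(1), of \<eta>\<^sub>0] a by (simp add: \<pi>_scaleC)
  then have "inverse a *\<^sub>C \<eta>\<^sub>0 = inverse a *\<^sub>C (a *\<^sub>C \<pi> (inv x) \<eta>\<^sub>0)" by simp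
  then have "\<pi> (inv x) \<eta>\<^sub>0 = inverse a *\<^sub>C \<eta>\<^sub>0" "cmod (inverse a) = 1"
    using a0 a(2) by (simp_all add: norm_inverse)
  then show "inv x \<in> H" using a(1) unfolding H_iff by blast
qed

lemma p_eq_iff: "x \<in> carrier G \<Longrightarrow> y \<in> carrier G \<Longrightarrow> p x = p y \<longleftrightarrow> (\<exists>h\<in>H. x = y \<otimes> h)"
  by (rule l_coset_eq_iff[OF H_subgroup])

lemma p_one: "p \<one> = H"
  using H_carrier by (auto simp: l_coset_def)

lemma carrier_X: "carrier X = p ` carrier G"
  by (auto simp: LFactGroup_def LCOSETS_def)

lemma one_X: "\<one>\<^bsub>X\<^esub> = H"
  by (simp add: LFactGroup_def)

lemma group_X: "group X"
  using quotient_group by (simp add: H_def)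

text \<open>The unit law of the quotient says \<open>H g H = g H\<close>, which is normality.\<close>

lemma H_conjugate:
  assumes x: "x \<in> H" and g: "g \<in> carrier G"
  shows "inv g \<otimes> x \<otimes> g \<in> H"
proof -
  have "H <#> p g = p g"
    using monoid.l_one[OF group.is_monoid[OF group_X], of "p g"] g
    by (simp add: carrier_X one_X) (simp add: LFactGroup_def)
  moreover have "g \<in> p g" using lcos_self[OF g H_subgroup] .
  ultimately have "x \<otimes> g \<in> p g" using x unfolding set_mult_def by blast
  then obtain h where h: "h \<in> H" "x \<otimes> g = g \<otimes> h" by (auto simp: l_coset_def)
  then have "inv g \<otimes> x \<otimes> g = h"
    using x g H_carrier by (simp add: m_assoc) (simp add: m_assoc[symmetric])
  then show ?thesis using h(1) by simp
qed

text \<open>The product of two cosets is a coset by closedness of the group operation, and it contains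
  \<open>x \<otimes> y\<close>.\<close>

lemma mult_X:
  assumes "x \<in> carrier G" "y \<in> carrier G" shows "p x \<otimes>\<^bsub>X\<^esub> p y = p (x \<otimes> y)"
proof -
  have "p x \<otimes>\<^bsub>X\<^esub> p y \<in> carrier X"
    using assms by (intro monoid.m_closed[OF group.is_monoid[OF group_X]]) (auto simp: carrier_X)
  then obtain z where z: "z \<in> carrier G" "p x \<otimes>\<^bsub>X\<^esub> p y = p z" by (auto simp: carrier_X)
  have "x \<otimes> y \<in> p x \<otimes>\<^bsub>X\<^esub> p y"
    using lcos_self[OF assms(1) H_subgroup] lcos_self[OF assms(2) H_subgroup]
    by (auto simp: LFactGroup_def set_mult_def)
  then have "x \<otimes> y \<in> p z" using z(2) by simp
  from l_repr_independence[OF this z(1) H_subgroup] show ?thesis using z(2) by simp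
qed

text \<open>The vectors \<open>\<pi> g \<eta>\<^sub>0\<close> are joint eigenvectors of the normal subgroup \<open>H\<close>.  Eigenvectors to different
  eigenvalues are orthogonal, so the eigenvalue is locally constant in \<open>g\<close>, hence constant on the
  connected group, and the corresponding joint eigenspace is invariant.\<close>

lemma H_scalar:
  assumes x: "x \<in> H" shows "\<exists>z. cmod z = 1 \<and> (\<forall>v. \<pi> x v = z *\<^sub>C v)"
proof -
  have "\<exists>z. cmod z = 1 \<and> \<pi> x (\<pi> g \<eta>\<^sub>0) = z *\<^sub>C \<pi> g \<eta>\<^sub>0" if "x \<in> H" "g \<in> carrier G" for x g
  proof -
    have "inv g \<otimes> x \<otimes> g \<in> H" by (rule H_conjugate[OF that])
    then obtain z where z: "cmod z = 1" "\<pi> (inv g \<otimes> x \<otimes> g) \<eta>\<^sub>0 = z *\<^sub>C \<eta>\<^sub>0"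
      by (auto simp: H_iff)
    have "x \<otimes> g = g \<otimes> (inv g \<otimes> x \<otimes> g)"
      using that H_carrier by (simp add: m_assoc[symmetric])
    then have "\<pi> x (\<pi> g \<eta>\<^sub>0) = \<pi> g (\<pi> (inv g \<otimes> x \<otimes> g) \<eta>\<^sub>0)"
      using that H_carrier by (metis \<pi>_mult inv_closed m_closed)
    then show ?thesis using z that by (auto simp: \<pi>_scaleC)
  qed
  then obtain \<theta> where \<theta>: "\<And>x g. x \<in> H \<Longrightarrow> g \<in> carrier G \<Longrightarrow>
      cmod (\<theta> x g) = 1 \<and> \<pi> x (\<pi> g \<eta>\<^sub>0) = \<theta> x g *\<^sub>C \<pi> g \<eta>\<^sub>0"
    by metis
  define N where "N = (\<lambda>g. {g' \<in> carrier G. cinner (\<pi> g \<eta>\<^sub>0) (\<pi> g' \<eta>\<^sub>0) \<noteq> 0})"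
  have N_open: "openin T (N g)" for g
  proof -
    have "continuous_map T euclidean (\<lambda>g'. cinner (\<pi> g \<eta>\<^sub>0) (\<pi> g' \<eta>\<^sub>0))"
      using continuous_map_compose[OF \<pi>_continuous, of euclidean "cinner (\<pi> g \<eta>\<^sub>0)" \<eta>\<^sub>0]
        continuous_on_cinner[OF continuous_on_const continuous_on_id, of UNIV "\<pi> g \<eta>\<^sub>0"]
      by (simp add: o_def)
    from openin_continuous_map_preimage[OF this, of "- {0}"]
    show ?thesis by (simp add: N_def open_Compl)
  qed
  have N_self: "g \<in> N g" if "g \<in> carrier G" for g
    using that nonzero by (simp add: N_def \<pi>_isometry cinner_eq_zero_iff)
  have N_const: "\<theta> x g' = \<theta> x g" if "x \<in> H" "g \<in> carrier G" "g' \<in> N g" for x g g'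
  proof -
    have g': "g' \<in> carrier G" "cinner (\<pi> g \<eta>\<^sub>0) (\<pi> g' \<eta>\<^sub>0) \<noteq> 0" using that(3) by (simp_all add: N_def)
    have "cinner (\<pi> x (\<pi> g \<eta>\<^sub>0)) (\<pi> x (\<pi> g' \<eta>\<^sub>0)) = cinner (\<pi> g \<eta>\<^sub>0) (\<pi> g' \<eta>\<^sub>0)"
      using H_carrier[OF that(1)] by (rule \<pi>_isometry)
    then have *: "\<theta> x g * cnj (\<theta> x g') = 1"
      using \<theta>[OF that(1,2)] \<theta>[OF that(1) g'(1)] g'(2)
      by (simp add: cinner_algebra mult.commute)
    have "cnj (\<theta> x g') * \<theta> x g' = 1"
      using \<theta>[OF that(1) g'(1)] complex_norm_square[of "\<theta> x g'"] by (simp add: mult.commute)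
    then show ?thesis using * by (metis mult.assoc mult.commute mult.right_neutral)
  qed
  have const: "\<theta> x g = \<theta> x \<one>" if x: "x \<in> H" and g: "g \<in> carrier G" for x g
  proof -
    let ?S = "{g \<in> carrier G. \<theta> x g = \<theta> x \<one>}"
    have NG: "N g \<subseteq> carrier G" for g by (auto simp: N_def)
    have "openin T ?S"
    proof (subst openin_subopen, intro ballI)
      fix g assume g: "g \<in> ?S"
      then have "N g \<subseteq> ?S" using N_const[OF x, of g] NG[of g] by fastforce
      then show "\<exists>U. openin T U \<and> g \<in> U \<and> U \<subseteq> ?S"
        using N_open[of g] N_self[of g] g by blast
    qed
    moreover have "openin T (topspace T - ?S)"
    proof (subst openin_subopen, intro ballI)
      fix g assume g: "g \<in> topspace T - ?S"
      then have "N g \<subseteq> topspace T - ?S" using N_const[OF x, of g] NG[of g] by fastforce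
      then show "\<exists>U. openin T U \<and> g \<in> U \<and> U \<subseteq> topspace T - ?S"
        using N_open[of g] N_self[of g] g by fastforce
    qed
    then have "closedin T ?S" by (auto simp: closedin_def)
    ultimately have "?S = {} \<or> ?S = topspace T"
      using connected unfolding connected_space_clopen_in by blast
    moreover have "\<one> \<in> ?S" by simp
    ultimately show ?thesis using g by auto
  qed
  let ?M = "{v. \<forall>x\<in>H. \<pi> x v = \<theta> x \<one> *\<^sub>C v}"
  have "complex_vector.subspace ?M"
  proof -
    have "\<pi> x 0 = 0" if "x \<in> H" for x
      using \<pi>_scaleC[OF H_carrier[OF that], of 0 0] by simp
    then show ?thesis
      by (auto simp: complex_vector.subspace_def \<pi>_scaleC \<pi>_add H_carrier scaleC_add_right mult.commute)
  qed
  moreover have "closed ?M"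
  proof -
    have "closed {v. \<pi> x v = \<theta> x \<one> *\<^sub>C v}" if "x \<in> H" for x
      using unitary_operator_bounded[OF \<pi>_unitary[OF H_carrier[OF that]]]
      by (intro closed_Collect_eq continuous_on_scaleC continuous_on_const continuous_on_id)
        (simp add: linear_continuous_on)
    moreover have "?M = (\<Inter>x\<in>H. {v. \<pi> x v = \<theta> x \<one> *\<^sub>C v})" by auto
    ultimately show ?thesis by auto
  qed
  moreover have "\<forall>g\<in>carrier G. \<pi> g ` ?M \<subseteq> ?M"
  proof (intro ballI subsetI)
    fix g w assume g: "g \<in> carrier G" and "w \<in> \<pi> g ` ?M"
    then obtain v where v: "w = \<pi> g v" "v \<in> ?M" by blast
    have "\<pi> x w = \<theta> x \<one> *\<^sub>C w" if x: "x \<in> H" for x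
    proof -
      let ?y = "inv g \<otimes> x \<otimes> g"
      have y: "?y \<in> H" using H_conjugate[OF x g] .
      have xg: "x \<otimes> g = g \<otimes> ?y"
        using x g H_carrier by (simp add: m_assoc[symmetric])
      have conj: "\<pi> x (\<pi> g u) = \<pi> g (\<pi> ?y u)" for u
        using xg \<pi>_mult[OF H_carrier[OF x] g, of u] \<pi>_mult[OF g H_carrier[OF y], of u] by simp
      have "\<pi> ?y \<eta>\<^sub>0 = \<theta> ?y \<one> *\<^sub>C \<eta>\<^sub>0" using \<theta>[OF y one_closed] by (simp add: \<pi>_one)
      then have "\<theta> x g *\<^sub>C \<pi> g \<eta>\<^sub>0 = \<theta> ?y \<one> *\<^sub>C \<pi> g \<eta>\<^sub>0"
        using conj[of \<eta>\<^sub>0] \<theta>[OF x g] g by (simp add: \<pi>_scaleC)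
      moreover have "\<pi> g \<eta>\<^sub>0 \<noteq> 0"
        using unitary_operator_norm[OF \<pi>_unitary[OF g], of \<eta>\<^sub>0] nonzero by auto
      ultimately have "\<theta> ?y \<one> = \<theta> x \<one>" using const[OF x g] by simp
      moreover have "\<pi> ?y v = \<theta> ?y \<one> *\<^sub>C v" using v(2) y by blast
      ultimately show ?thesis using g by (simp add: v(1) conj \<pi>_scaleC)
    qed
    then show "w \<in> ?M" by blast
  qed
  moreover have "\<eta>\<^sub>0 \<in> ?M" using \<theta>[OF _ one_closed] by (simp add: \<pi>_one)
  then have "?M \<noteq> {0}" using nonzero by blast
  ultimately have "?M = UNIV"
    using irreducible unfolding irreducible_representation_def by blast
  then have "\<pi> x v = \<theta> x \<one> *\<^sub>C v" for v using x by blast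
  then show ?thesis using \<theta>[OF x one_closed] by blast
qed

lemma same_coset_phase:
  assumes "x \<in> carrier G" "y \<in> carrier G" "p x = p y"
  shows "\<exists>z. cmod z = 1 \<and> (\<forall>v. \<pi> x v = z *\<^sub>C \<pi> y v)"
proof -
  obtain h where h: "h \<in> H" "x = y \<otimes> h" using p_eq_iff assms by blast
  obtain z where "cmod z = 1" "\<And>v. \<pi> h v = z *\<^sub>C v" using H_scalar[OF h(1)] by blast
  then have "\<pi> x v = z *\<^sub>C \<pi> y v" for v
    using assms(2) h H_carrier[OF h(1)] by (simp add: \<pi>_mult \<pi>_scaleC)
  then show ?thesis using \<open>cmod z = 1\<close> by blast
qed

lemma topspace_TX: "topspace TX = carrier X"
  by (simp add: topspace_quotient carrier_X)

lemma second_countable_TX: "second_countable TX"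
  using second_countable_open_map_image[OF quotient_imp_continuous_map[OF quotient_map_quotient_topology]
      open_map_quotient[OF H_subgroup] _ second_countable]
  by (simp add: topspace_quotient)

lemma second_countable_group_X:
  assumes "topological_group X TX" shows "second_countable_group X TX"
  using assms second_countable_TX group_X
  by (simp add: second_countable_group_def second_countable_group_axioms_def)

lemma H_closed: "closedin T H"
proof -
  have "compact ((\<lambda>z. z *\<^sub>C \<eta>\<^sub>0) ` sphere 0 1)"
    by (intro compact_continuous_image continuous_on_scaleC continuous_intros) simp
  then have "closed ((\<lambda>z. z *\<^sub>C \<eta>\<^sub>0) ` sphere 0 1)" by (rule compact_imp_closed)
  then have "closedin T {x \<in> topspace T. \<pi> x \<eta>\<^sub>0 \<in> (\<lambda>z. z *\<^sub>C \<eta>\<^sub>0) ` sphere 0 1}"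
    by (intro closedin_continuous_map_preimage[OF \<pi>_continuous]) simp
  moreover have "{x \<in> topspace T. \<pi> x \<eta>\<^sub>0 \<in> (\<lambda>z. z *\<^sub>C \<eta>\<^sub>0) ` sphere 0 1} = H"
  proof -
    have "w \<in> (\<lambda>z. z *\<^sub>C \<eta>\<^sub>0) ` sphere 0 1 \<longleftrightarrow> (\<exists>z. cmod z = 1 \<and> w = z *\<^sub>C \<eta>\<^sub>0)" for w
      by (auto simp: image_iff)
    then show ?thesis by (simp add: H_iff set_eq_iff)
  qed
  ultimately show ?thesis by simp
qed

lemma closedin_one_X: "closedin TX {\<one>\<^bsub>X\<^esub>}"
proof -
  have "{x \<in> topspace T. p x \<in> topspace TX - {H}} = topspace T - H"
  proof -
    have "p x = H \<longleftrightarrow> x \<in> H" if "x \<in> carrier G" for x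
      using p_eq_iff[OF that one_closed] H_carrier by (auto simp: p_one)
    then show ?thesis by (auto simp: topspace_quotient)
  qed
  then have "openin TX (topspace TX - {H})"
    unfolding openin_quotient_topology using H_closed
    by (auto simp: topspace_quotient closedin_def)
  moreover have "H \<in> topspace TX"
    using p_one one_closed by (auto simp: topspace_quotient intro: image_eqI[of _ _ \<one>])
  ultimately show ?thesis by (simp add: closedin_def one_X)
qed

text \<open>The identity of the quotient is a closed point of finite measure, so outer regularity provides a
  neighbourhood of finite measure.\<close>

lemma haar_X:
  assumes group: "topological_group X TX" and \<mu>: "invariant_radon_measure G TX \<mu>"
  shows "haar X TX \<mu>"
proof -
  interpret Q: second_countable_group X TX by (rule second_countable_group_X[OF group])
  have sets: "sets \<mu> = sets (borel_of TX)" and radon: "radon_measure TX \<mu>"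
    using \<mu> by (simp_all add: invariant_radon_measure_def radon_measure_def)
  show ?thesis
  proof
    show "sets \<mu> = sets (borel_of TX)" by (rule sets)
    show "emeasure \<mu> (space \<mu>) \<noteq> 0" using \<mu> by (simp add: invariant_radon_measure_def)
    fix a B assume a: "a \<in> carrier X" and B: "B \<in> sets \<mu>"
    obtain g where g: "g \<in> carrier G" "a = p g" using a by (auto simp: carrier_X)
    have "B \<subseteq> carrier X"
      using sets.sets_into_space[of B "borel_of TX"] B by (simp add: sets topspace_TX)
    then have "(\<lambda>x. a \<otimes>\<^bsub>X\<^esub> x) ` B = (\<lambda>C. g <#\<^bsub>G\<^esub> C) ` B"
    proof (intro image_cong refl)
      fix C assume "B \<subseteq> carrier X" "C \<in> B"
      then obtain y where y: "y \<in> carrier G" "C = p y" by (auto simp: carrier_X)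
      have "g <#\<^bsub>G\<^esub> C = p (g \<otimes> y)"
        unfolding y(2) using H_carrier by (intro lcos_m_assoc g y) auto
      then show "a \<otimes>\<^bsub>X\<^esub> C = g <#\<^bsub>G\<^esub> C" by (simp add: y(2) g(2) mult_X g(1) y(1))
    qed
    then show "emeasure \<mu> ((\<lambda>x. a \<otimes>\<^bsub>X\<^esub> x) ` B) = emeasure \<mu> B"
      using \<mu> g(1) B by (simp add: invariant_radon_measure_def)
  next
    have one: "\<one>\<^bsub>X\<^esub> \<in> topspace TX" unfolding topspace_TX by (rule Q.one_closed)
    then have "compactin TX {\<one>\<^bsub>X\<^esub>}" by simp
    then have fin: "emeasure \<mu> {\<one>\<^bsub>X\<^esub>} < \<infinity>" using radon by (simp add: radon_measure_def)
    have "topspace TX - (topspace TX - {\<one>\<^bsub>X\<^esub>}) \<in> sets (borel_of TX)"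
      using closedin_one_X openin_borel_of[of TX "topspace TX - {\<one>\<^bsub>X\<^esub>}"]
        sets.compl_sets[of "topspace TX - {\<one>\<^bsub>X\<^esub>}" "borel_of TX"] by (simp add: closedin_def)
    then have "{\<one>\<^bsub>X\<^esub>} \<in> sets \<mu>" using one by (simp add: sets double_diff)
    then have "emeasure \<mu> {\<one>\<^bsub>X\<^esub>} = (INF U\<in>{U. openin TX U \<and> {\<one>\<^bsub>X\<^esub>} \<subseteq> U}. emeasure \<mu> U)"
      using radon unfolding radon_measure_def by blast
    with fin have "(INF U\<in>{U. openin TX U \<and> {\<one>\<^bsub>X\<^esub>} \<subseteq> U}. emeasure \<mu> U) < \<infinity>" by simp
    then show "\<exists>U. openin TX U \<and> \<one>\<^bsub>X\<^esub> \<in> U \<and> emeasure \<mu> U < \<infinity>"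
      by (auto simp: INF_less_iff)
  qed
qed

lemma section_carrier:
  assumes "borel_section T TX p s" "x \<in> carrier X"
  shows "s x \<in> carrier G" "p (s x) = x"
proof -
  have "s \<in> borel_of TX \<rightarrow>\<^sub>M borel_of T" using assms(1) by (simp add: borel_section_def)
  from measurable_space[OF this, of x] show "s x \<in> carrier G"
    using assms(2) by (simp add: topspace_TX)
  show "p (s x) = x" using assms by (simp add: borel_section_def topspace_TX)
qed

lemma projective_representation_X:
  assumes group: "topological_group X TX" and s: "borel_section T TX p s"
  shows "projective_representation X TX (\<lambda>x. \<pi> (s x))"
proof -
  interpret Q: second_countable_group X TX by (rule second_countable_group_X[OF group])
  note s_carrier = section_carrier[OF s]
  show ?thesis
  proof
    show "unitary_operator (\<pi> (s x))" if "x \<in> carrier X" for x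
      using \<pi>_unitary[OF s_carrier(1)[OF that]] .
    fix x y assume xy: "x \<in> carrier X" "y \<in> carrier X"
    have "p (s (x \<otimes>\<^bsub>X\<^esub> y)) = p (s x \<otimes> s y)"
      using xy s_carrier by (simp add: mult_X[symmetric])
    from same_coset_phase[OF _ _ this]
    show "\<exists>z. cmod z = 1 \<and> (\<forall>v. \<pi> (s (x \<otimes>\<^bsub>X\<^esub> y)) v = z *\<^sub>C \<pi> (s x) (\<pi> (s y) v))"
      using xy s_carrier(1) by (simp add: \<pi>_mult)
  next
    fix f v
    have "continuous_map T euclidean (\<lambda>g. cinner f (\<pi> g v))"
      using continuous_map_compose[OF \<pi>_continuous, of euclidean "cinner f" v]
        continuous_on_cinner[OF continuous_on_const continuous_on_id, of UNIV f]
      by (simp add: o_def)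
    moreover have "s \<in> borel_of TX \<rightarrow>\<^sub>M borel_of T" using s by (simp add: borel_section_def)
    ultimately show "(\<lambda>x. cinner f (\<pi> (s x) v)) \<in> borel_measurable (borel_of TX)"
      using measurable_compose continuous_map_borel_measurable by blast
  next
    have "\<pi> g ` S \<subseteq> S" if S: "complex_vector.subspace S" "\<forall>x\<in>carrier X. \<pi> (s x) ` S \<subseteq> S"
      and g: "g \<in> carrier G" for g S
    proof
      fix w assume "w \<in> \<pi> g ` S"
      then obtain v where v: "w = \<pi> g v" "v \<in> S" by blast
      have pg: "p g \<in> carrier X" using g by (auto simp: carrier_X)
      obtain z where "\<And>v. \<pi> g v = z *\<^sub>C \<pi> (s (p g)) v"
        using same_coset_phase[OF g s_carrier(1)[OF pg]] s_carrier(2)[OF pg] by metis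
      moreover have "\<pi> (s (p g)) v \<in> S" using S(2) pg v(2) by blast
      ultimately show "w \<in> S" using complex_vector.subspace_scale[OF S(1)] v(1) by simp
    qed
    then show "irreducible_representation X (\<lambda>x. \<pi> (s x))"
      using irreducible unfolding irreducible_representation_def by blast
  qed
qed

lemma complete_family_change_section:
  assumes s: "borel_section T TX p s" and s': "borel_section T TX p s'"
    and D: "D \<subseteq> carrier X"
    and complete: "complete_family {\<pi> (s \<gamma>) \<eta> | \<gamma>. \<gamma> \<in> D}"
  shows "complete_family {\<pi> (s' \<gamma>) \<eta> | \<gamma>. \<gamma> \<in> D}"
proof -
  let ?S = "{\<pi> (s \<gamma>) \<eta> | \<gamma>. \<gamma> \<in> D}" and ?S' = "{\<pi> (s' \<gamma>) \<eta> | \<gamma>. \<gamma> \<in> D}"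
  have "?S \<subseteq> complex_vector.span ?S'"
  proof
    fix w assume "w \<in> ?S"
    then obtain \<gamma> where \<gamma>: "\<gamma> \<in> D" "w = \<pi> (s \<gamma>) \<eta>" by blast
    then have "\<gamma> \<in> carrier X" using D by blast
    then obtain z where "\<pi> (s \<gamma>) \<eta> = z *\<^sub>C \<pi> (s' \<gamma>) \<eta>"
      using same_coset_phase section_carrier[OF s] section_carrier[OF s'] by metis
    moreover have "\<pi> (s' \<gamma>) \<eta> \<in> ?S'" using \<gamma>(1) by blast
    then have "z *\<^sub>C \<pi> (s' \<gamma>) \<eta> \<in> complex_vector.span ?S'"
      by (intro complex_vector.span_scale complex_vector.span_base)
    ultimately show "w \<in> complex_vector.span ?S'" by (simp only: \<gamma>(2))
  qed
  then have "complex_vector.span ?S \<subseteq> complex_vector.span ?S'"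
    by (rule complex_vector.span_minimal) (rule complex_vector.subspace_span)
  from closure_mono[OF this] show ?thesis
    using complete by (auto simp: complete_family_def)
qed

lemma cmod_change_section:
  assumes s: "borel_section T TX p s" and s': "borel_section T TX p s'" and x: "x \<in> carrier X"
  shows "cmod (cinner f (\<pi> (s' x) \<eta>)) = cmod (cinner f (\<pi> (s x) \<eta>))"
proof -
  obtain z where "cmod z = 1" "\<pi> (s' x) \<eta> = z *\<^sub>C \<pi> (s x) \<eta>"
    using same_coset_phase section_carrier[OF s x] section_carrier[OF s' x] by metis
  then show ?thesis by (simp add: cinner_scaleC_right norm_mult)
qed

end

section \<open>The density theorem\<close>

lemma coefficient_integral_energy:
  "coefficient_integral \<mu> \<pi> s f \<eta> = energy \<mu> (\<lambda>x. \<pi> (s x) \<eta>) f"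
  by (simp add: coefficient_integral_def energy_def)

lemma is_formal_degree_iff:
  fixes \<pi> :: "'g \<Rightarrow> 'h::complex_hilbert \<Rightarrow> 'h"
  assumes "\<kappa> > 0" "v \<noteq> (0::'h)"
    and \<kappa>: "\<And>f \<eta>. coefficient_integral \<mu> \<pi> s f \<eta> = ennreal (\<kappa> * (norm f)\<^sup>2 * (norm \<eta>)\<^sup>2)"
  shows "is_formal_degree \<mu> \<pi> s d \<longleftrightarrow> d = inverse \<kappa>"
proof
  assume d: "is_formal_degree \<mu> \<pi> s d"
  then have "ennreal (inverse d * (norm v)\<^sup>2 * (norm v)\<^sup>2) = ennreal (\<kappa> * (norm v)\<^sup>2 * (norm v)\<^sup>2)"
    unfolding is_formal_degree_def \<kappa>[symmetric] by simp
  then have "inverse d * (norm v)\<^sup>2 * (norm v)\<^sup>2 = \<kappa> * (norm v)\<^sup>2 * (norm v)\<^sup>2"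
    using d assms(1) by (subst (asm) ennreal_inj) (simp_all add: is_formal_degree_def)
  then have "inverse d = \<kappa>" using assms(2) by simp
  then show "d = inverse \<kappa>" by auto
next
  assume "d = inverse \<kappa>"
  then show "is_formal_degree \<mu> \<pi> s d" using assms(1) by (simp add: is_formal_degree_def \<kappa>)
qed

theorem theorem4p1:
  fixes G :: "'g monoid"
    and T :: "'g topology"
    and A :: "('g, 'v::real_normed_vector) atlas"
    and \<pi> :: "'g \<Rightarrow> 'h::complex_hilbert \<Rightarrow> 'h"
    and \<eta>\<^sub>0 :: 'h
    and \<mu> :: "'g set measure"
    and s :: "'g set \<Rightarrow> 'g"
    and \<Gamma> :: "'g set"
  defines "H \<equiv> projective_stabiliser G \<pi> \<eta>\<^sub>0"
  defines "X \<equiv> G LMod H"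
    and "p \<equiv> (\<lambda>g. g <#\<^bsub>G\<^esub> H)"
  defines "TX \<equiv> quotient_topology T p"
    and "\<Gamma>' \<equiv> p ` \<Gamma>"
  assumes "exponential_lie_group G T A"
    and "unitary_representation G T \<pi>"
    and "irreducible_representation G \<pi>"
    and "\<eta>\<^sub>0 \<noteq> 0"
    and "invariant_radon_measure G TX \<mu>"
    and "borel_section T TX p s"
    and "\<exists>\<eta>. admissible_vector \<mu> \<pi> s \<eta>"
    and "discrete_subgroup G T \<Gamma>"
    and "uniform_subgroup X TX \<Gamma>'"
    and "\<exists>\<eta>. complete_family {\<pi> (s \<gamma>) \<eta> | \<gamma>. \<gamma> \<in> \<Gamma>'}"
  shows "(\<exists>!d. is_formal_degree \<mu> \<pi> s d) \<and>
         covolume X TX \<mu> \<Gamma>' * ennreal (formal_degree \<mu> \<pi> s) \<le> 1 \<and>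
         (\<forall>\<mu>' s'. invariant_radon_measure G TX \<mu>' \<and> borel_section T TX p s' \<longrightarrow>
           (\<exists>!d. is_formal_degree \<mu>' \<pi> s' d) \<and>
           covolume X TX \<mu>' \<Gamma>' * ennreal (formal_degree \<mu>' \<pi> s') \<le> 1)"
proof -
  note top = exponential_lie_group_topological[OF assms(6)]
  have group_X: "topological_group X TX"
    using assms(14) by (simp add: uniform_subgroup_def discrete_subgroup_def)
  interpret G: second_countable_group G T
    using top by (simp add: second_countable_group_def second_countable_group_axioms_def topological_group_def)
  interpret Q: stabiliser_quotient G T \<pi> \<eta>\<^sub>0
    using top(3) assms(7-9) group_X G.second_countable_group_axioms
    by (simp add: stabiliser_quotient_def stabiliser_quotient_axioms_def topological_group_def
        X_def H_def)
  have H: "Q.H = H" by (simp add: Q.H_def H_def)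
  have eqs: "Q.X = X" "Q.p = p" "Q.TX = TX"
    by (simp_all add: H X_def p_def TX_def)
  note haar_X = Q.haar_X[unfolded H, folded X_def p_def, folded TX_def, OF group_X]
  note rep_X = Q.projective_representation_X[unfolded H, folded X_def p_def, folded TX_def, OF group_X]
  note change_complete = Q.complete_family_change_section[unfolded H, folded X_def p_def, folded TX_def]
  note change_cmod = Q.cmod_change_section[unfolded H, folded X_def p_def, folded TX_def]
  obtain \<eta>1 where \<eta>1: "\<eta>1 \<noteq> 0" "\<And>f. energy \<mu> (\<lambda>x. \<pi> (s x) \<eta>1) f < \<infinity>"
    using assms(12) by (auto simp: admissible_vector_def coefficient_integral_energy)
  obtain \<eta> where \<eta>: "complete_family {\<pi> (s \<gamma>) \<eta> | \<gamma>. \<gamma> \<in> \<Gamma>'}"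
    using assms(15) by blast
  interpret M: projective_haar_system X TX \<mu> \<Gamma>' "\<lambda>x. \<pi> (s x)"
    using haar_X[OF assms(10)] rep_X[OF assms(11)] assms(14)
    by (simp add: projective_haar_system_def haar_lattice_def uniform_lattice_def
        uniform_lattice_axioms_def haar_def)
  \<comment> \<open>Admissibility is inherited by any other pair because invariant measures are proportional and
    coefficients with respect to two sections differ by phases.\<close>
  have main: "(\<exists>!d. is_formal_degree \<mu>' \<pi> s' d) \<and>
      covolume X TX \<mu>' \<Gamma>' * ennreal (formal_degree \<mu>' \<pi> s') \<le> 1"
    if \<mu>': "invariant_radon_measure G TX \<mu>'" and s': "borel_section T TX p s'" for \<mu>' s'
  proof -
    interpret M': projective_haar_system X TX \<mu>' \<Gamma>' "\<lambda>x. \<pi> (s' x)"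
      using haar_X[OF \<mu>'] rep_X[OF s'] assms(14)
      by (simp add: projective_haar_system_def haar_lattice_def uniform_lattice_def
          uniform_lattice_axioms_def haar_def)
    have "energy \<mu>' (\<lambda>x. \<pi> (s' x) \<eta>1) f = energy \<mu>' (\<lambda>x. \<pi> (s x) \<eta>1) f" for f
      unfolding energy_def
      by (rule nn_integral_cong) (simp add: change_cmod[OF assms(11) s'])
    moreover have "energy \<mu>' (\<lambda>x. \<pi> (s x) \<eta>1) f < \<infinity>" for f
      using \<eta>1(2)[of f] unfolding energy_def
      by (intro M.haar_finite_integral[OF haar_X[OF \<mu>']]) measurable
    ultimately have fin: "energy \<mu>' (\<lambda>x. \<pi> (s' x) \<eta>1) f < \<infinity>" for f by simp
    have complete: "complete_family {\<pi> (s' \<gamma>) \<eta> | \<gamma>. \<gamma> \<in> \<Gamma>'}"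
      using M.lattice_carrier by (intro change_complete[OF assms(11) s' _ \<eta>]) auto
    obtain \<kappa> where \<kappa>: "\<kappa> > 0"
      "\<And>f \<eta>. energy \<mu>' (\<lambda>x. \<pi> (s' x) \<eta>) f = ennreal (\<kappa> * (norm f)\<^sup>2 * (norm \<eta>)\<^sup>2)"
      "covolume X TX \<mu>' \<Gamma>' \<le> ennreal \<kappa>"
      using M'.completeness_density[OF \<eta>1(1) fin complete] by blast
    have iff: "is_formal_degree \<mu>' \<pi> s' d \<longleftrightarrow> d = inverse \<kappa>" for d
      by (rule is_formal_degree_iff[OF \<kappa>(1) \<eta>1(1)]) (simp add: coefficient_integral_energy \<kappa>(2))
    have "covolume X TX \<mu>' \<Gamma>' * ennreal (inverse \<kappa>) \<le> ennreal \<kappa> * ennreal (inverse \<kappa>)"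
      using \<kappa>(3) by (rule mult_right_mono) simp
    also have "\<dots> = 1"
      using \<kappa>(1) by (simp add: ennreal_mult[symmetric])
    finally show ?thesis by (simp add: iff formal_degree_def)
  qed
  show ?thesis
    using main assms(10,11) by blast
qed

end
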